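(* Let $0<\alpha<1$ and $2\alpha<\delta<2$. There is a constant $C_{\alpha,\delta}>0$ such that for any odd (real-valued) function $u\in C_b^1(\mathbb R)\cap L^1(\mathbb R)$, we have $$\int_0^\infty \frac{\Lambda^{-\alpha}\bigl(\Lambda^{-\alpha}u\cdot\partial_x u\bigr)(x)}{x^\delta}\,dx\ \ge\ C_{\alpha,\delta}\int_0^\infty \frac{\bigl(\Lambda^{-\alpha}u(x)\bigr)^2}{x^{1+\delta}}\,dx.$$
   Context: $C_b^1(\mathbb R)=\{f\in C^1(\mathbb R):\|f\|_{L^\infty}+\|f'\|_{L^\infty}<\infty\}$. $\Lambda=(-\partial_{xx})^{1/2}$, and for $0<\alpha<1$ the operator $\Lambda^{-\alpha}$ has Fourier symbol $|\xi|^{-\alpha}$, i.e. it is the Riesz potential $\Lambda^{-\alpha}f(x)=c_\alpha\int_{\mathbb R}f(y)|x-y|^{\alpha-1}\,dy$ with $c_\alpha=\frac{\Gamma((1-\alpha)/2)}{2^\alpha\sqrt\pi\,\Gamma(\alpha/2)}>0$; for odd $f$ this reads $\Lambda^{-\alpha}f(x)=c_\alpha\int_0^\infty f(y)\bigl(|x-y|^{\alpha-1}-|x+y|^{\alpha-1}\bigr)\,dy$. *)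

theory Defs
  imports "HOL-Analysis.Analysis"
begin

definition odd_function :: "(real \<Rightarrow> real) \<Rightarrow> bool"
  where "odd_function f \<longleftrightarrow> (\<forall>x. f (- x) = - f x)"

definition C1_bounded :: "(real \<Rightarrow> real) \<Rightarrow> bool"
  where "C1_bounded f \<longleftrightarrow>
    f C1_differentiable_on UNIV \<and> bounded (range f) \<and> bounded (range (deriv f))"

definition riesz_const :: "real \<Rightarrow> real"
  where "riesz_const \<alpha> = Gamma ((1 - \<alpha>) / 2) / (2 powr \<alpha> * sqrt pi * Gamma (\<alpha> / 2))"

text \<open>
  The Riesz potential \<open>\<Lambda>\<^sup>-\<^sup>\<alpha>\<close>, \<open>0 < \<alpha> < 1\<close>. The integral over the line is taken as the limit of the
  Lebesgue integrals over \<open>[-R, R]\<close>. If \<open>f y * \<bar>x - y\<bar> powr (\<alpha> - 1)\<close> is integrable over the line,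
  this is the Lebesgue integral (lemma \<open>riesz_potential_eq_integral\<close>). For odd \<open>f\<close> it is the
  half-line integral against \<open>\<bar>x - y\<bar> powr (\<alpha> - 1) - \<bar>x + y\<bar> powr (\<alpha> - 1)\<close> (lemma
  \<open>riesz_potential_odd\<close>). That kernel decays like \<open>y powr (\<alpha> - 2)\<close>, so the half-line integral
  converges absolutely for every bounded odd \<open>f\<close>, even where the integral over the line does not.
  The product \<open>\<Lambda>\<^sup>-\<^sup>\<alpha>u \<cdot> u'\<close>, with \<open>u\<close> odd, in \<open>L\<^sup>1\<close> and in \<open>C\<^sup>1\<^sub>b\<close>, is odd and bounded, but for
  \<open>\<alpha>\<close> close to 1 it need not decay fast enough for absolute convergence over the line.
\<close>

definition riesz_potential :: "real \<Rightarrow> (real \<Rightarrow> real) \<Rightarrow> real \<Rightarrow> real"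
  where "riesz_potential \<alpha> f x =
    riesz_const \<alpha> * Lim at_top (\<lambda>R::real. LINT y:{-R..R}|lborel. f y * \<bar>x - y\<bar> powr (\<alpha> - 1))"

lemma riesz_potential_eq_integral:
  assumes "integrable lborel (\<lambda>y. f y * \<bar>x - y\<bar> powr (\<alpha> - 1))"
  shows "riesz_potential \<alpha> f x =
    riesz_const \<alpha> * (LINT y|lborel. f y * \<bar>x - y\<bar> powr (\<alpha> - 1))"
proof -
  let ?h = "\<lambda>y. f y * \<bar>x - y\<bar> powr (\<alpha> - 1)"
  have [measurable]: "?h \<in> borel_measurable lborel"
    using assms by (rule borel_measurable_integrable)
  have "((\<lambda>R::real. LINT y|lborel. indicator {-R..R} y *\<^sub>R ?h y) \<longlongrightarrow> (LINT y|lborel. ?h y)) at_top"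
  proof (rule integral_dominated_convergence_at_top[where w = "\<lambda>y. norm (?h y)"])
    show "AE y in lborel. ((\<lambda>R::real. indicator {-R..R} y *\<^sub>R ?h y) \<longlongrightarrow> ?h y) at_top"
    proof (intro AE_I2 tendsto_eventually)
      fix y :: real
      show "\<forall>\<^sub>F R in at_top. indicator {-R..R} y *\<^sub>R ?h y = ?h y"
        using eventually_ge_at_top[of "\<bar>y\<bar>"] by eventually_elim (auto simp: indicator_def)
    qed
  qed (use assms in \<open>auto intro!: always_eventually simp: indicator_def\<close>)
  then show ?thesis
    by (simp add: riesz_potential_def set_lebesgue_integral_def tendsto_Lim)
qed

lemma riesz_potential_odd:
  assumes odd: "odd_function f"
    and loc: "\<And>R::real. set_integrable lborel {-R..R} (\<lambda>y. f y * \<bar>x - y\<bar> powr (\<alpha> - 1))"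
    and int: "set_integrable lborel {0<..}
      (\<lambda>y. f y * (\<bar>x - y\<bar> powr (\<alpha> - 1) - \<bar>x + y\<bar> powr (\<alpha> - 1)))"
  shows "riesz_potential \<alpha> f x = riesz_const \<alpha> *
    (LINT y:{0<..}|lborel. f y * (\<bar>x - y\<bar> powr (\<alpha> - 1) - \<bar>x + y\<bar> powr (\<alpha> - 1)))"
proof -
  let ?h = "\<lambda>y. f y * \<bar>x - y\<bar> powr (\<alpha> - 1)"
  let ?k = "\<lambda>y. f y * (\<bar>x - y\<bar> powr (\<alpha> - 1) - \<bar>x + y\<bar> powr (\<alpha> - 1))"
  have fold: "(LINT y:{-R..R}|lborel. ?h y) = (LINT y:{0<..R}|lborel. ?k y)" if "R > 0" for R :: real
  proof -
    have I1: "set_integrable lborel {-R..<0} ?h" and I2: "set_integrable lborel {0..R} ?h"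
      and I3: "set_integrable lborel {0<..R} ?h"
      by (rule set_integrable_subset[OF loc[of R]]; use that in auto)+
    have neg: "indicator {-R..<0} (- y) *\<^sub>R ?h (- y) = indicator {0<..R} y *\<^sub>R (- f y * \<bar>x + y\<bar> powr (\<alpha> - 1))" for y
      using odd by (auto simp: indicator_def odd_function_def)
    have I4: "set_integrable lborel {0<..R} (\<lambda>y. - f y * \<bar>x + y\<bar> powr (\<alpha> - 1))"
      using I1 lborel_integrable_real_affine_iff[of "-1" "\<lambda>y. indicator {-R..<0} y *\<^sub>R ?h y" 0] neg
      by (simp add: set_integrable_def)
    have E1: "(LINT y:{-R..<0}|lborel. ?h y) = (LINT y:{0<..R}|lborel. - f y * \<bar>x + y\<bar> powr (\<alpha> - 1))"
      using lborel_integral_real_affine[of "-1" "\<lambda>y. indicator {-R..<0} y *\<^sub>R ?h y" 0] neg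
      by (simp add: set_lebesgue_integral_def)
    have E2: "(LINT y:{0..R}|lborel. ?h y) = (LINT y:{0<..R}|lborel. ?h y)"
    proof (rule set_integral_cong_set)
      show "set_borel_measurable lborel {0..R} ?h" "set_borel_measurable lborel {0<..R} ?h"
        using I2 I3 by (auto simp: set_integrable_def set_borel_measurable_def)
      show "AE y in lborel. (y \<in> {0<..R}) = (y \<in> {0..R})"
        using AE_lborel_singleton[of 0] by eventually_elim auto
    qed
    have "{-R..R} = {-R..<0} \<union> {0..R}" "{-R..<0} \<inter> {0..R} = {}"
      using that by auto
    then have "(LINT y:{-R..R}|lborel. ?h y) = (LINT y:{-R..<0}|lborel. ?h y) + (LINT y:{0..R}|lborel. ?h y)"
      using set_integral_Un[OF _ I1 I2] by simp
    also have "\<dots> = (LINT y:{0<..R}|lborel. (- f y * \<bar>x + y\<bar> powr (\<alpha> - 1)) + ?h y)"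
      unfolding E1 E2 using set_integral_add(2)[OF I4 I3] by simp
    also have "\<dots> = (LINT y:{0<..R}|lborel. ?k y)"
      by (simp add: algebra_simps)
    finally show ?thesis .
  qed
  have [measurable]: "(\<lambda>y. indicator {0<..} y *\<^sub>R ?k y) \<in> borel_measurable lborel"
    using int unfolding set_integrable_def by (rule borel_measurable_integrable)
  have eq: "indicator {0<..R} y *\<^sub>R ?k y = indicator {..R} y *\<^sub>R (indicator {0<..} y *\<^sub>R ?k y)" for R y
    by (auto simp: indicator_def)
  have "((\<lambda>R::real. LINT y|lborel. indicator {0<..R} y *\<^sub>R ?k y) \<longlongrightarrow>
      (LINT y|lborel. indicator {0<..} y *\<^sub>R ?k y)) at_top"
    unfolding eq
    by (rule tendsto_integral_at_top) (use int in \<open>auto simp: set_integrable_def\<close>)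
  then have "((\<lambda>R::real. LINT y:{0<..R}|lborel. ?k y) \<longlongrightarrow> (LINT y:{0<..}|lborel. ?k y)) at_top"
    by (simp add: set_lebesgue_integral_def)
  moreover have "\<forall>\<^sub>F R in at_top. (LINT y:{0<..R}|lborel. ?k y) = (LINT y:{-R..R}|lborel. ?h y)"
    using eventually_gt_at_top[of "0::real"] by eventually_elim (simp add: fold)
  ultimately have "((\<lambda>R::real. LINT y:{-R..R}|lborel. ?h y) \<longlongrightarrow> (LINT y:{0<..}|lborel. ?k y)) at_top"
    by (rule Lim_transform_eventually)
  then show ?thesis
    by (simp add: riesz_potential_def tendsto_Lim)
qed

end

theory Submission
  imports Defs
begin

text \<open>
  Write \<open>\<phi> = k * u\<close> with \<open>k z = \<bar>z\<bar> powr (\<alpha> - 1)\<close>. By Fubini the left-hand side is a positive multiple of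
  the integral of \<open>\<phi> u' x powr (\<alpha> - \<delta>)\<close> over the half-line. The fractional derivative truncated at
  scale \<open>e\<close> maps \<open>\<phi>\<close> to \<open>\<kappa>\<^sub>e * u\<close> with an explicit approximate identity \<open>\<kappa>\<^sub>e\<close>, so \<open>u'\<close> is, up to a
  constant, the limit of integrals of \<open>2 r \<phi>'(x) - \<phi>(x + r) + \<phi>(x - r)\<close> against \<open>w r\<close> over
  \<open>r \<ge> e\<close>. Folding to the half-line, all products \<open>\<phi> x \<phi> y\<close> appear in the weighted form with
  negative coefficients. AM-GM with the test function \<open>\<eta> x = x powr (\<delta> / 2)\<close> (a ground state
  substitution) reduces the inequality to a pointwise bound for powers, which follows from the
  positivity and the monotonicity of \<open>\<kappa>\<^sub>e\<close>.
\<close>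

section \<open>Signed powers\<close>

text \<open>The cutoff at \<open>e\<close> is there because \<open>\<phi>'\<close> is only known to
  be continuous, so \<open>2 r \<phi>'(x) - \<phi>(x + r) + \<phi>(x - r)\<close> is only known to
  be o(r), too weak near r = 0 against a weight of order \<open>r powr (-2 - \<alpha>)\<close>. With
  the cutoff each term can be integrated on its own. The exponent \<delta> / 2 of the test function
  makes both powers that arise, of order \<delta> / 2 - 1 and \<alpha> - \<delta> / 2, multiples of
  Riesz potentials of powers: 1 - \<delta> / 2 and \<delta> / 2 - \<alpha> lie in (0, 1 - \<alpha>)
  exactly when 2 \<alpha> < \<delta> < 2. Their bounds contribute \<delta> / 2 and \<delta> / 2 -
  \<alpha> times a factor that blows up like \<open>e powr (- \<alpha>)\<close>. The sum \<delta> -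
  \<alpha> is exactly what integrating \<open>\<phi> \<phi>' x powr (\<alpha> - \<delta>)\<close> by
  parts provides, so the divergent terms cancel without loss. What survives is the convolution of
  \<open>\<kappa>\<^sub>e\<close> with the power \<delta> / 2 - \<alpha> - 1. Multiplied by
  \<open>x powr (\<alpha> - \<delta>)\<close> and by the factor
  \<open>x powr (- \<delta> / 2)\<close> from AM-GM, it becomes the weight
  \<open>x powr (- 1 - \<delta>)\<close> of the right-hand side.\<close>

definition odd_powr :: "real \<Rightarrow> real \<Rightarrow> real"
  where "odd_powr p x = sgn x * \<bar>x\<bar> powr p"

lemma measurable_odd_powr [measurable]: "odd_powr p \<in> borel_measurable borel"
  unfolding odd_powr_def[abs_def] by measurable

lemma odd_powr_minus: "odd_powr p (- x) = - odd_powr p x"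
  by (auto simp: odd_powr_def sgn_if)

lemma DERIV_abs_powr:
  assumes "x \<noteq> 0"
  shows "((\<lambda>x. \<bar>x\<bar> powr p) has_real_derivative p * odd_powr (p - 1) x) (at x)"
proof (cases "x > 0")
  case True
  have "((\<lambda>x. x powr p) has_real_derivative p * odd_powr (p - 1) x) (at x)"
    using True by (auto intro!: derivative_eq_intros simp: odd_powr_def powr_diff)
  moreover have "eventually (\<lambda>y. y > 0) (nhds x)"
    using True by (intro eventually_nhds_in_open[of "{0<..}", simplified]) auto
  then have "eventually (\<lambda>y. y powr p = \<bar>y\<bar> powr p) (nhds x)"
    by eventually_elim simp
  ultimately show ?thesis using True by (subst (asm) DERIV_cong_ev[OF refl _ refl]) auto
next
  case False
  have "((\<lambda>x. (-x) powr p) has_real_derivative p * odd_powr (p - 1) x) (at x)"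
    using False assms by (auto intro!: derivative_eq_intros simp: odd_powr_def powr_diff divide_simps)
  moreover have "eventually (\<lambda>y. y < 0) (nhds x)"
    using False assms by (intro eventually_nhds_in_open[of "{..<0}", simplified]) auto
  then have "eventually (\<lambda>y. (-y) powr p = \<bar>y\<bar> powr p) (nhds x)"
    by eventually_elim simp
  ultimately show ?thesis by (subst (asm) DERIV_cong_ev[OF refl _ refl]) auto
qed

lemma DERIV_odd_powr:
  assumes "x \<noteq> 0"
  shows "(odd_powr p has_real_derivative p * \<bar>x\<bar> powr (p - 1)) (at x)"
proof -
  have "((\<lambda>y. sgn x * \<bar>y\<bar> powr p) has_real_derivative sgn x * (p * odd_powr (p - 1) x)) (at x)"
    by (intro DERIV_cmult DERIV_abs_powr assms)
  moreover have "sgn x * (p * odd_powr (p - 1) x) = p * \<bar>x\<bar> powr (p - 1)"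
    using assms by (auto simp: odd_powr_def sgn_if)
  moreover have "eventually (\<lambda>y. sgn y = sgn x) (nhds x)"
  proof (cases "x > 0")
    case True
    then have "eventually (\<lambda>y. y > 0) (nhds x)"
      by (intro eventually_nhds_in_open[of "{0<..}", simplified]) auto
    then show ?thesis by eventually_elim (use True in auto)
  next
    case False
    then have "eventually (\<lambda>y. y < 0) (nhds x)"
      using assms by (intro eventually_nhds_in_open[of "{..<0}", simplified]) auto
    then show ?thesis by eventually_elim (use False assms in auto)
  qed
  then have "eventually (\<lambda>y. sgn x * \<bar>y\<bar> powr p = odd_powr p y) (nhds x)"
    by eventually_elim (simp add: odd_powr_def)
  ultimately show ?thesis
    by (subst (asm) DERIV_cong_ev[OF refl _ refl]) auto
qed

text \<open>For exponents above 1 the formula survives at 0, where the difference quotient is at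
  most \<open>\<bar>h\<bar> powr (p - 1)\<close> in modulus. This permits differentiating the
  numerator of \<open>ktrunc\<close> across x = 1 and the primitive in
  \<open>kernel_identity\<close> across r = z.\<close>

lemma DERIV_abs_powr_gt1:
  assumes "1 < p"
  shows "((\<lambda>x. \<bar>x\<bar> powr p) has_real_derivative p * odd_powr (p - 1) x) (at x)"
proof (cases "x = 0")
  case True
  have "((\<lambda>h::real. \<bar>h\<bar> powr (p - 1)) \<longlongrightarrow> 0) (at 0)"
    using assms by (auto intro!: tendsto_eq_intros)
  then have "((\<lambda>h::real. \<bar>h\<bar> powr p / h) \<longlongrightarrow> 0) (at 0)"
  proof (rule Lim_null_comparison[rotated])
    show "\<forall>\<^sub>F h in at 0. norm (\<bar>h\<bar> powr p / h) \<le> \<bar>h\<bar> powr (p - 1)"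
      using eventually_neq_at_within[of 0] by eventually_elim (auto simp: powr_diff)
  qed
  then show ?thesis
    using True assms by (simp add: DERIV_def odd_powr_def)
qed (rule DERIV_abs_powr)

lemma DERIV_abs_powr_chain:
  assumes "1 < p" "(g has_real_derivative g') (at x)"
  shows "((\<lambda>x. \<bar>g x\<bar> powr p) has_real_derivative p * odd_powr (p - 1) (g x) * g') (at x)"
  by (rule DERIV_chain2[OF DERIV_abs_powr_gt1 assms(2)]) fact

lemma continuous_on_odd_powr:
  assumes "0 < p" shows "continuous_on A (odd_powr p)"
proof (rule continuous_at_imp_continuous_on, rule ballI)
  fix x
  show "isCont (odd_powr p) x"
  proof (cases "x = 0")
    case True
    have "((\<lambda>h::real. \<bar>h\<bar> powr p) \<longlongrightarrow> 0) (at 0)"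
      using assms by (auto intro!: tendsto_eq_intros)
    then have "(odd_powr p \<longlongrightarrow> 0) (at 0)"
      by (rule Lim_null_comparison[rotated]) (auto simp: odd_powr_def abs_mult sgn_if)
    then show ?thesis using True by (simp add: isCont_def odd_powr_def)
  next
    case False
    then show ?thesis using DERIV_odd_powr DERIV_isCont by blast
  qed
qed

text \<open>\<open>odd_powr p / p\<close> is a primitive that stays continuous across the integrable
  singularity, so one formula serves intervals with and without 0.\<close>

lemma nn_integral_abs_powr:
  assumes "0 < p" "a \<le> b"
  shows "(\<integral>\<^sup>+y\<in>{a..b}. ennreal (\<bar>y\<bar> powr (p - 1)) \<partial>lborel)
    = ennreal ((odd_powr p b - odd_powr p a) / p)"
proof -
  have "((\<lambda>y. \<bar>y\<bar> powr (p - 1)) has_integral odd_powr p b / p - odd_powr p a / p) {a..b}"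
  proof (rule fundamental_theorem_of_calculus_interior_strong[where S = "{0}"])
    show "((\<lambda>y. odd_powr p y / p) has_vector_derivative \<bar>x\<bar> powr (p - 1)) (at x)"
      if "x \<in> {a<..<b} - {0}" for x
      unfolding has_real_derivative_iff_has_vector_derivative[symmetric]
      using DERIV_cdivide[OF DERIV_odd_powr[of x p], of p] that assms by simp
  qed (use assms in \<open>auto intro!: continuous_intros continuous_on_odd_powr\<close>)
  moreover have "(\<lambda>y. \<bar>y\<bar> powr (p - 1) * indicator {a..b} y) =
    (\<lambda>y. if y \<in> {a..b} then \<bar>y\<bar> powr (p - 1) else 0)"
    by auto
  ultimately have "((\<lambda>y. \<bar>y\<bar> powr (p - 1) * indicator {a..b} y) has_integral
      (odd_powr p b - odd_powr p a) / p) UNIV"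
    by (simp only: has_integral_restrict_UNIV diff_divide_distrib)
  then have "(\<integral>\<^sup>+y. ennreal (\<bar>y\<bar> powr (p - 1) * indicator {a..b} y) \<partial>lborel)
    = ennreal ((odd_powr p b - odd_powr p a) / p)"
    by (intro nn_integral_has_integral_lborel) auto
  then show ?thesis
    by (simp add: ennreal_mult ennreal_indicator)
qed

lemma nn_integral_abs_powr_finite:
  assumes "-1 < p"
  shows "(\<integral>\<^sup>+y\<in>{a..b}. ennreal (\<bar>y\<bar> powr p) \<partial>lborel) < \<infinity>"
  using nn_integral_abs_powr[of "p + 1" a b] assms by (cases "a \<le> b") auto

lemma nn_integral_fold:
  fixes f :: "real \<Rightarrow> ennreal"
  assumes [measurable]: "f \<in> borel_measurable borel"
  shows "(\<integral>\<^sup>+x. f x \<partial>lborel) = (\<integral>\<^sup>+x\<in>{0<..}. (f x + f (- x)) \<partial>lborel)"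
proof -
  have "(\<integral>\<^sup>+x. f x \<partial>lborel) = (\<integral>\<^sup>+x. f x * indicator {0<..} x + f x * indicator {..<0} x \<partial>lborel)"
    by (intro nn_integral_cong_AE eventually_mono[OF AE_lborel_singleton[of 0]]) (auto simp: indicator_def)
  also have "\<dots> = (\<integral>\<^sup>+x\<in>{0<..}. f x \<partial>lborel) + (\<integral>\<^sup>+x\<in>{..<0}. f x \<partial>lborel)"
    by (rule nn_integral_add) auto
  also have "(\<integral>\<^sup>+x\<in>{..<0}. f x \<partial>lborel) = (\<integral>\<^sup>+x\<in>{0<..}. f (- x) \<partial>lborel)"
    by (subst nn_integral_real_affine[where c = "-1" and t = 0]) (auto simp: indicator_def)
  also have "(\<integral>\<^sup>+x\<in>{0<..}. f x \<partial>lborel) + \<dots> = (\<integral>\<^sup>+x. f x * indicator {0<..} x + f (- x) * indicator {0<..} x \<partial>lborel)"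
    by (rule nn_integral_add[symmetric]) auto
  finally show ?thesis by (simp add: distrib_right)
qed

lemma nn_integral_abs_powr_tail:
  assumes "p < -1" "0 < a"
  shows "(\<integral>\<^sup>+x. ennreal (\<bar>x\<bar> powr p) * indicator {x. a \<le> \<bar>x\<bar>} x \<partial>lborel) < \<infinity>"
proof -
  have "(\<integral>\<^sup>+x\<in>{a..}. ennreal (x powr p) \<partial>lborel) = ennreal (0 - a powr (p + 1) / (p + 1))"
  proof (rule nn_integral_FTC_atLeast)
    show "((\<lambda>x. x powr (p + 1) / (p + 1)) \<longlongrightarrow> 0) at_top"
      using tendsto_divide[OF tendsto_neg_powr[of "p + 1", OF _ filterlim_ident] tendsto_const[of "p + 1"]] assms
      by simp
    show "((\<lambda>x. x powr (p + 1) / (p + 1)) has_real_derivative x powr p) (at x)" if "a \<le> x" for x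
      using DERIV_cdivide[OF has_real_derivative_powr[of x "p + 1"], of "p + 1"] assms that by simp
  qed auto
  then have "2 * (\<integral>\<^sup>+x\<in>{a..}. ennreal (x powr p) \<partial>lborel) < \<infinity>"
    by (simp add: ennreal_mult_less_top)
  also have "2 * (\<integral>\<^sup>+x\<in>{a..}. ennreal (x powr p) \<partial>lborel) =
      (\<integral>\<^sup>+x. 2 * (ennreal (x powr p) * indicator {a..} x) \<partial>lborel)"
    by (rule nn_integral_cmult[symmetric]) auto
  also have "\<dots> = (\<integral>\<^sup>+x. ennreal (\<bar>x\<bar> powr p) * indicator {x. a \<le> \<bar>x\<bar>} x \<partial>lborel)"
    using assms by (subst (2) nn_integral_fold) (auto intro!: nn_integral_cong simp: indicator_def mult_2)
  finally show ?thesis .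
qed

lemma odd_powr_mono:
  assumes "0 < p" "a \<le> b" shows "odd_powr p a \<le> odd_powr p b"
proof -
  consider "a \<le> 0" "0 \<le> b" | "0 < a" | "b < 0" using assms by linarith
  then show ?thesis
  proof cases
    case 1
    then have "odd_powr p a \<le> 0" "0 \<le> odd_powr p b"
      by (auto simp: odd_powr_def sgn_if)
    then show ?thesis by linarith
  qed (use assms in \<open>auto simp: odd_powr_def sgn_if intro: powr_mono2\<close>)
qed

text \<open>Bernoulli's inequality, as the weighted AM-GM of 1 + y and 1 with weights p and 1 -
  p.\<close>

lemma powr_one_plus_le:
  assumes "0 \<le> p" "p \<le> 1" "-1 \<le> (y::real)"
  shows "(1 + y) powr p \<le> 1 + p * y"
proof (cases "p = 0 \<or> p = 1 \<or> y = -1")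
  case False
  then show ?thesis
    using Youngs_inequality_0[of p "1 - p" "1 + y" 1] assms by (simp add: algebra_simps)
qed (use assms in auto)

text \<open>Bernoulli's inequality for large exponents, from the one with exponent 1 / p at the
  point p y.\<close>

lemma powr_one_plus_ge:
  assumes "1 \<le> p" "-1 \<le> (y::real)"
  shows "1 + p * y \<le> (1 + y) powr p"
proof (cases "1 + p * y \<le> 0")
  case True
  then show ?thesis using powr_ge_zero[of "1 + y" p] by linarith
next
  case False
  have "(1 + p * y) powr (1 / p) \<le> 1 + y"
    using powr_one_plus_le[of "1 / p" "p * y"] False assms by (simp add: field_simps)
  then have "((1 + p * y) powr (1 / p)) powr p \<le> (1 + y) powr p"
    using assms by (intro powr_mono2) auto
  then show ?thesis using False assms by (simp add: powr_powr)
qed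

section \<open>The kernel of the truncated inverse of the Riesz potential\<close>

text \<open>
  The fractional derivative of order \<open>\<alpha>\<close>, truncated at scale 1, of the Riesz kernel (see
  \<open>kernel_identity\<close>). At 0 the division gives 0 instead of \<open>\<infinity>\<close>.
\<close>

definition ktrunc :: "real \<Rightarrow> real \<Rightarrow> real"
  where "ktrunc \<alpha> x =
    (2 * (1 + \<alpha>) * \<bar>x\<bar> powr \<alpha> - (1 + \<bar>x\<bar>) powr (1 + \<alpha>) + \<bar>\<bar>x\<bar> - 1\<bar> powr (1 + \<alpha>)) / (\<alpha> * \<bar>x\<bar>)"

lemma measurable_ktrunc [measurable]: "ktrunc \<alpha> \<in> borel_measurable borel"
  unfolding ktrunc_def[abs_def] by measurable

lemma ktrunc_minus [simp]: "ktrunc \<alpha> (- x) = ktrunc \<alpha> x"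
  by (simp add: ktrunc_def)

lemma ktrunc_abs: "ktrunc \<alpha> \<bar>x\<bar> = ktrunc \<alpha> x"
  by (simp add: ktrunc_def)

section \<open>Bounds, monotonicity and positivity of the truncated kernel\<close>

locale riesz_exponent =
  fixes \<alpha> :: real
  assumes \<alpha>: "0 < \<alpha>" "\<alpha> < 1"
begin

text \<open>With y = 1 / x the expression is \<open>ktrunc \<alpha> x\<close> up to the factor
  \<open>x powr \<alpha> / \<alpha>\<close>; its quadratic size at y = 0 becomes decay of order
  \<alpha> - 2 at infinity. The upper bound combines two Bernoulli inequalities. For the lower
  bound, the expression vanishes at 0 and its derivative is nonnegative because
  \<open>(1 + y) powr \<alpha> + (1 - y) powr \<alpha> \<le> 2\<close>.\<close>

lemma binomial_diff_bounds:
  assumes "0 \<le> y" "y \<le> 1"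
  shows "0 \<le> 2 * (1 + \<alpha>) * y - (1 + y) powr (1 + \<alpha>) + (1 - y) powr (1 + \<alpha>)" (is ?l)
    and "2 * (1 + \<alpha>) * y - (1 + y) powr (1 + \<alpha>) + (1 - y) powr (1 + \<alpha>) \<le> \<alpha> * y\<^sup>2" (is ?u)
proof -
  have e: "(1 - y) powr (1 + \<alpha>) = (1 - y) * (1 - y) powr \<alpha>"
    using assms by (cases "y = 1") (auto simp: powr_add)
  have "(1 - y) * (1 - y) powr \<alpha> \<le> (1 - y) * (1 - \<alpha> * y)"
    using powr_one_plus_le[of \<alpha> "- y"] assms \<alpha> by (intro mult_left_mono) auto
  then show ?u
    using powr_one_plus_ge[of "1 + \<alpha>" y] assms \<alpha>
    unfolding e by (simp add: algebra_simps power2_eq_square)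
  \<comment> \<open>The absolute value keeps the function differentiable at the endpoint 1.\<close>
  let ?E = "\<lambda>y. 2 * (1 + \<alpha>) * y - (1 + y) powr (1 + \<alpha>) + \<bar>1 - y\<bar> powr (1 + \<alpha>)"
  have "?E 0 \<le> ?E y"
  proof (rule DERIV_nonneg_imp_nondecreasing[OF assms(1)])
    fix t assume t: "0 \<le> t" "t \<le> y"
    have "(?E has_real_derivative (1 + \<alpha>) * (2 - (1 + t) powr \<alpha> - odd_powr \<alpha> (1 - t))) (at t)"
      using t \<alpha> by (intro DERIV_cong[OF DERIV_add[OF _ DERIV_abs_powr_chain[where g' = "-1"]]])
        (auto intro!: derivative_eq_intros simp: algebra_simps)
    moreover have "odd_powr \<alpha> (1 - t) = (1 - t) powr \<alpha>"
      using t assms by (auto simp: odd_powr_def sgn_if)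
    moreover have "0 \<le> (1 + \<alpha>) * (2 - (1 + t) powr \<alpha> - (1 - t) powr \<alpha>)"
      using powr_one_plus_le[of \<alpha> t] powr_one_plus_le[of \<alpha> "- t"] t assms \<alpha>
      by (intro mult_nonneg_nonneg) auto
    ultimately show "\<exists>d. (?E has_real_derivative d) (at t) \<and> 0 \<le> d" by auto
  qed
  then show ?l using assms by simp
qed

text \<open>The difference of the two sides vanishes at 0, and its derivative is \<alpha> (1 +
  \<alpha>) t times \<open>(1 - t) powr (\<alpha> - 1) - (1 + t) powr (\<alpha> - 1)\<close>, which
  is nonnegative.\<close>

lemma powr_ratio_ineq:
  assumes "0 \<le> y" "y < 1"
  shows "(1 - y) powr \<alpha> * (1 + \<alpha> * y) \<le> (1 + y) powr \<alpha> * (1 - \<alpha> * y)"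
proof -
  let ?G = "\<lambda>y. (1 + y) powr \<alpha> * (1 - \<alpha> * y) - (1 - y) powr \<alpha> * (1 + \<alpha> * y)"
  have "?G 0 \<le> ?G y"
  proof (rule DERIV_nonneg_imp_nondecreasing[OF assms(1)])
    fix t assume t: "0 \<le> t" "t \<le> y"
    have p: "(1 + t) powr \<alpha> = (1 + t) * (1 + t) powr (\<alpha> - 1)" "(1 - t) powr \<alpha> = (1 - t) * (1 - t) powr (\<alpha> - 1)"
      using t assms by (auto simp: powr_diff)
    have "(?G has_real_derivative (\<alpha> * (1 + t) powr (\<alpha> - 1)) * (1 - \<alpha> * t) + (1 + t) powr \<alpha> * (- \<alpha>)
       - ((- \<alpha> * (1 - t) powr (\<alpha> - 1)) * (1 + \<alpha> * t) + (1 - t) powr \<alpha> * \<alpha>)) (at t)"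
      using t assms by (auto intro!: derivative_eq_intros simp: field_simps)
    also have "(\<alpha> * (1 + t) powr (\<alpha> - 1)) * (1 - \<alpha> * t) + (1 + t) powr \<alpha> * (- \<alpha>)
       - ((- \<alpha> * (1 - t) powr (\<alpha> - 1)) * (1 + \<alpha> * t) + (1 - t) powr \<alpha> * \<alpha>) =
       \<alpha> * (1 + \<alpha>) * t * ((1 - t) powr (\<alpha> - 1) - (1 + t) powr (\<alpha> - 1))"
      unfolding p by algebra
    finally show "\<exists>d. (?G has_real_derivative d) (at t) \<and> 0 \<le> d"
      using t assms \<alpha> powr_mono2'[of "\<alpha> - 1" "1 - t" "1 + t"]
      by (intro exI[of _ "\<alpha> * (1 + \<alpha>) * t * ((1 - t) powr (\<alpha> - 1) - (1 + t) powr (\<alpha> - 1))"] conjI) auto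
  qed
  then show ?thesis by simp
qed

text \<open>With D the numerator of \<open>ktrunc\<close>, this is x D'(x) <= D(x), the sign of the
  derivative of D(x) / x. For x <= 1 it reduces to \<open>a * (1 - \<alpha> * x) - b * (1 + \<alpha>
  * x) \<le> 2 * (1 - \<alpha>\<^sup>2) * x powr \<alpha>\<close>; for x > 1 the power
  \<open>x powr \<alpha>\<close> is factored out and y = 1 / x is used.\<close>

lemma ktrunc_deriv_nonpos:
  assumes "0 < x"
  shows "x * (2 * (1 + \<alpha>) * \<alpha> * x powr (\<alpha> - 1) - (1 + \<alpha>) * (1 + x) powr \<alpha> + (1 + \<alpha>) * odd_powr \<alpha> (x - 1))
    \<le> 2 * (1 + \<alpha>) * x powr \<alpha> - (1 + x) powr (1 + \<alpha>) + \<bar>x - 1\<bar> powr (1 + \<alpha>)"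
proof -
  have p: "x * x powr (\<alpha> - 1) = x powr \<alpha>" "(1 + x) powr (1 + \<alpha>) = (1 + x) * (1 + x) powr \<alpha>"
    using assms by (auto simp: powr_diff powr_add)
  have p': "\<bar>x - 1\<bar> powr (1 + \<alpha>) = \<bar>x - 1\<bar> * \<bar>x - 1\<bar> powr \<alpha>"
    by (cases "x = 1") (auto simp: powr_add)
  have p2: "x * (2 * (1 + \<alpha>) * \<alpha> * x powr (\<alpha> - 1) - (1 + \<alpha>) * (1 + x) powr \<alpha> + (1 + \<alpha>) * odd_powr \<alpha> (x - 1))
    = 2 * (1 + \<alpha>) * \<alpha> * (x * x powr (\<alpha> - 1)) - x * (1 + \<alpha>) * (1 + x) powr \<alpha> + x * (1 + \<alpha>) * odd_powr \<alpha> (x - 1)"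
    by (simp add: algebra_simps)
  show ?thesis
  proof (cases "x \<le> 1")
    case True
    define a b where "a = (1 + x) powr \<alpha>" and "b = (1 - x) powr \<alpha>"
    have o: "odd_powr \<alpha> (x - 1) = - b" "\<bar>x - 1\<bar> powr \<alpha> = b" "\<bar>x - 1\<bar> = 1 - x"
      using True by (auto simp: odd_powr_def b_def sgn_if)
    \<comment> \<open>The estimates a <= 1 + \<alpha> x, b >= 1 - x and
      \<open>x \<le> x powr \<alpha>\<close> leave a polynomial inequality: (1 + \<alpha> x) (1 -
      \<alpha>) x is at most 2 (1 + \<alpha>) (1 - \<alpha>) x.\<close>
    have "a * (1 - \<alpha> * x) \<le> (1 + \<alpha> * x) * (1 - \<alpha> * x)"
      using powr_one_plus_le[of \<alpha> x] assms True \<alpha> mult_mono[of \<alpha> 1 x 1]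
      by (intro mult_right_mono) (auto simp: a_def)
    moreover have "(1 - x) * (1 + \<alpha> * x) \<le> b * (1 + \<alpha> * x)"
      using powr_mono'[of \<alpha> 1 "1 - x"] assms True \<alpha> by (intro mult_right_mono) (auto simp: b_def)
    moreover have "2 * (1 - \<alpha>\<^sup>2) * x \<le> 2 * (1 - \<alpha>\<^sup>2) * x powr \<alpha>"
      using powr_mono'[of \<alpha> 1 x] assms True \<alpha> by (intro mult_left_mono) (auto simp: power_le_one)
    moreover have "x * ((1 - \<alpha>) * (\<alpha> * x)) \<le> x * ((1 - \<alpha>) * (1 + 2 * \<alpha>))"
      using assms True \<alpha> mult_left_mono[of x 1 \<alpha>] by (intro mult_left_mono mult_nonneg_nonneg) linarith+
    ultimately have "a * (1 - \<alpha> * x) - b * (1 + \<alpha> * x) \<le> 2 * (1 - \<alpha>\<^sup>2) * x powr \<alpha>"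
      by (simp add: algebra_simps power2_eq_square)
    then show ?thesis
      unfolding p2 p p' unfolding o(1,2) a_def[symmetric] unfolding o(3)
      by (simp add: algebra_simps power2_eq_square)
  next
    case False
    define y where "y = 1 / x"
    have y: "0 < y" "y < 1" and x: "x = 1 / y" using False by (auto simp: y_def)
    define a b where "a = (1 + y) powr \<alpha>" and "b = (1 - y) powr \<alpha>"
    define s where "s = x powr \<alpha>"
    have e: "x * (1 + y) = 1 + x" "x * (1 - y) = x - 1" using y by (auto simp: x field_simps)
    have q: "(1 + x) powr \<alpha> = s * a" "(x - 1) powr \<alpha> = s * b"
      using y False by (auto simp: a_def b_def s_def powr_mult[symmetric] e[symmetric])
    have o: "odd_powr \<alpha> (x - 1) = s * b" "\<bar>x - 1\<bar> powr \<alpha> = s * b" "\<bar>x - 1\<bar> = x - 1"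
      using False q by (auto simp: odd_powr_def)
    have E: "0 \<le> 2 * (1 + \<alpha>) * y - (1 + y) * a + (1 - y) * b"
      using binomial_diff_bounds(1)[of y] y by (simp add: a_def b_def powr_add)
    have "b * (1 + \<alpha> * y) \<le> a * (1 - \<alpha> * y)"
      using powr_ratio_ineq[of y] y by (simp add: a_def b_def)
    \<comment> \<open>The target is exactly 1 - \<alpha> times the expression in \<open>E\<close>,
      plus a (1 - \<alpha> y) - b (1 + \<alpha> y), and both summands are nonnegative.\<close>
    with mult_left_mono[OF E, of "1 - \<alpha>"] \<alpha>
    have "0 \<le> a * (\<alpha> - y) - b * (\<alpha> + y) + 2 * (1 - \<alpha>\<^sup>2) * y"
      by (simp add: algebra_simps power2_eq_square)
    then have "0 \<le> s * x * (a * (\<alpha> - y) - b * (\<alpha> + y) + 2 * (1 - \<alpha>\<^sup>2) * y)"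
      using assms by (intro mult_nonneg_nonneg) (auto simp: s_def)
    also have "s * x * (a * (\<alpha> - y) - b * (\<alpha> + y) + 2 * (1 - \<alpha>\<^sup>2) * y) =
        s * (a * (\<alpha> * x - x * y) - b * (\<alpha> * x + x * y) + 2 * (1 - \<alpha>\<^sup>2) * (x * y))"
      by algebra
    also have "x * y = 1" using y by (simp add: x)
    finally have "0 \<le> s * (a * (\<alpha> * x - 1) - b * (\<alpha> * x + 1) + 2 * (1 - \<alpha>\<^sup>2))"
      by simp
    then show ?thesis
      unfolding p2 p p' unfolding o(1,2) q s_def[symmetric] unfolding o(3)
      by (simp add: algebra_simps power2_eq_square)
  qed
qed

lemma ktrunc_antimono:
  assumes "0 < x" "x \<le> y"
  shows "ktrunc \<alpha> y \<le> ktrunc \<alpha> x"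
proof -
  let ?D = "\<lambda>x. 2 * (1 + \<alpha>) * x powr \<alpha> - (1 + x) powr (1 + \<alpha>) + \<bar>x - 1\<bar> powr (1 + \<alpha>)"
  have "?D y / (\<alpha> * y) \<le> ?D x / (\<alpha> * x)"
  proof (rule DERIV_nonpos_imp_nonincreasing[OF assms(2)])
    fix t assume "x \<le> t" "t \<le> y"
    then have t: "0 < t" using assms by simp
    let ?D' = "2 * (1 + \<alpha>) * \<alpha> * t powr (\<alpha> - 1) - (1 + \<alpha>) * (1 + t) powr \<alpha> + (1 + \<alpha>) * odd_powr \<alpha> (t - 1)"
    have "(?D has_real_derivative ?D') (at t)"
      using t \<alpha> by (intro DERIV_cong[OF DERIV_add[OF _ DERIV_abs_powr_chain[where g' = 1]]])
        (auto intro!: derivative_eq_intros simp: algebra_simps powr_diff)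
    moreover have "((\<lambda>t. \<alpha> * t) has_real_derivative \<alpha>) (at t)"
      by (auto intro!: derivative_eq_intros)
    ultimately have "((\<lambda>t. ?D t / (\<alpha> * t)) has_real_derivative (?D' * (\<alpha> * t) - ?D t * \<alpha>) / ((\<alpha> * t) * (\<alpha> * t))) (at t)"
      using t \<alpha> by (intro DERIV_divide) auto
    moreover have "?D' * (\<alpha> * t) - ?D t * \<alpha> = \<alpha> * (t * ?D' - ?D t)"
      by (simp only: algebra_simps)
    moreover have "\<alpha> * (t * ?D' - ?D t) \<le> 0"
      using ktrunc_deriv_nonpos[OF t] \<alpha> by (intro mult_nonneg_nonpos) linarith+
    ultimately show "\<exists>d. ((\<lambda>t. ?D t / (\<alpha> * t)) has_real_derivative d) (at t) \<and> d \<le> 0"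
      using divide_nonpos_nonneg[OF _ zero_le_square[of "\<alpha> * t"], of "?D' * (\<alpha> * t) - ?D t * \<alpha>"]
      by (intro exI[of _ "(?D' * (\<alpha> * t) - ?D t * \<alpha>) / ((\<alpha> * t) * (\<alpha> * t))"] conjI) simp_all
  qed
  then show ?thesis using assms by (simp add: ktrunc_def)
qed

lemma ktrunc_ge1_bounds:
  assumes "1 \<le> x"
  shows "0 \<le> ktrunc \<alpha> x" "ktrunc \<alpha> x \<le> x powr (\<alpha> - 2)"
proof -
  define y where "y = 1 / x"
  have y: "0 < y" "y \<le> 1" and x: "x = 1 / y" using assms by (auto simp: y_def)
  have e: "x * (1 + y) = 1 + x" "x * (1 - y) = x - 1" using y by (auto simp: x field_simps)
  have q: "(1 + x) powr (1 + \<alpha>) = x powr (1 + \<alpha>) * (1 + y) powr (1 + \<alpha>)"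
    "(x - 1) powr (1 + \<alpha>) = x powr (1 + \<alpha>) * (1 - y) powr (1 + \<alpha>)"
    using y assms by (auto simp: powr_mult[symmetric] e)
  have k: "ktrunc \<alpha> x = x powr \<alpha> / \<alpha> * (2 * (1 + \<alpha>) * y - (1 + y) powr (1 + \<alpha>) + (1 - y) powr (1 + \<alpha>))"
  proof -
    obtain A B where AB: "(1 + y) powr (1 + \<alpha>) = A" "(1 - y) powr (1 + \<alpha>) = B" by blast
    have "ktrunc \<alpha> x = (2 * (1 + \<alpha>) * x powr \<alpha> - x * x powr \<alpha> * A + x * x powr \<alpha> * B) / (\<alpha> * x)"
      using assms q unfolding AB by (simp add: ktrunc_def powr_add)
    then show ?thesis
      using assms \<alpha> unfolding AB by (simp add: y_def field_simps)
  qed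
  have "0 \<le> x powr \<alpha> / \<alpha>" using \<alpha> by simp
  then show "0 \<le> ktrunc \<alpha> x"
    unfolding k using y by (intro mult_nonneg_nonneg binomial_diff_bounds) auto
  have "ktrunc \<alpha> x \<le> x powr \<alpha> / \<alpha> * (\<alpha> * y\<^sup>2)"
    unfolding k using y \<alpha> by (intro mult_left_mono binomial_diff_bounds) auto
  also have "\<dots> = x powr (\<alpha> - 2)"
    using assms \<alpha> by (simp add: y_def powr_diff power2_eq_square)
  finally show "ktrunc \<alpha> x \<le> x powr (\<alpha> - 2)" .
qed

text \<open>On (0, 1) this comes from monotonicity, because the value at 1 is already
  nonnegative.\<close>

lemma ktrunc_nonneg: "0 \<le> ktrunc \<alpha> x"
proof -
  consider "x = 0" | "1 \<le> \<bar>x\<bar>" | "0 < \<bar>x\<bar>" "\<bar>x\<bar> < 1" by linarith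
  then have "0 \<le> ktrunc \<alpha> \<bar>x\<bar>"
  proof cases
    case 3
    then show ?thesis using ktrunc_antimono[of "\<bar>x\<bar>" 1] ktrunc_ge1_bounds(1)[of 1] by simp
  qed (use ktrunc_ge1_bounds(1) in \<open>auto simp: ktrunc_def\<close>)
  then show ?thesis by (simp add: ktrunc_abs)
qed

lemma ktrunc_lt1_bound:
  assumes "0 < x" "x \<le> 1"
  shows "ktrunc \<alpha> x \<le> 2 * (1 + \<alpha>) / \<alpha> * x powr (\<alpha> - 1)"
proof -
  have "(1 - x) powr (1 + \<alpha>) \<le> (1 + x) powr (1 + \<alpha>)"
    using assms \<alpha> by (intro powr_mono2) auto
  then show ?thesis
    using assms \<alpha> by (simp add: ktrunc_def powr_diff field_simps)
qed

text \<open>\<open>ktrunc_nonneg\<close> alone leaves open that the kernel vanishes almost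
  everywhere. Strict positivity on an interval makes its integral positive, so that the integral can
  be cancelled after the passage to the limit.\<close>

lemma ktrunc_pos_near_0: "\<exists>b>0. \<forall>x. 0 < x \<longrightarrow> x \<le> b \<longrightarrow> 0 < ktrunc \<alpha> x"
proof (intro exI conjI allI impI)
  \<comment> \<open>Solves \<open>b powr \<alpha> = 2 * b\<close>; Bernoulli then bounds the
    numerator of \<open>ktrunc \<alpha> b\<close> below by 2 (1 + \<alpha>) b - \<alpha>
    b^2.\<close>
  define b where "b = 2 powr (- 1 / (1 - \<alpha>))"
  show b: "0 < b" by (simp add: b_def)
  have b1: "b \<le> 1" unfolding b_def using \<alpha> powr_mono[of "- 1 / (1 - \<alpha>)" 0 2] by simp
  have "- 1 / (1 - \<alpha>) * (\<alpha> - 1) = 1" using \<alpha> by (simp add: field_simps)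
  then have "b powr (\<alpha> - 1) = 2" by (simp add: b_def powr_powr)
  then have bp: "b powr \<alpha> = 2 * b" using b by (simp add: powr_diff field_simps)
  have "(1 + b) powr (1 + \<alpha>) \<le> (1 + b) * (1 + \<alpha> * b)"
    using powr_one_plus_le[of \<alpha> b] b \<alpha> by (simp add: powr_add mult_left_mono)
  moreover have "1 - (1 + \<alpha>) * b \<le> (1 - b) powr (1 + \<alpha>)"
    using powr_one_plus_ge[of "1 + \<alpha>" "- b"] b1 \<alpha> by simp
  moreover have "\<alpha> * b < 2 * (1 + \<alpha>)"
  proof -
    have "\<alpha> * b \<le> \<alpha>" using b1 \<alpha> by (simp add: mult_left_le)
    then show ?thesis by (rule le_less_trans) (use \<alpha> in simp)
  qed
  then have "\<alpha> * b * b < 2 * (1 + \<alpha>) * b"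
    using b by (rule mult_strict_right_mono)
  ultimately have "0 < 2 * (1 + \<alpha>) * b powr \<alpha> - (1 + b) powr (1 + \<alpha>) + (1 - b) powr (1 + \<alpha>)"
    unfolding bp by (simp add: algebra_simps)
  then have "0 < ktrunc \<alpha> b" using b b1 \<alpha> by (simp add: ktrunc_def)
  then show "0 < ktrunc \<alpha> x" if "0 < x" "x \<le> b" for x
    using ktrunc_antimono[OF that] by linarith
qed

lemma integrable_ktrunc: "integrable lborel (ktrunc \<alpha>)"
proof (rule integrableI_nonneg)
  let ?f = "\<lambda>x. ennreal (2 * (1 + \<alpha>) / \<alpha>) * (ennreal (\<bar>x\<bar> powr (\<alpha> - 1)) * indicator {-1..1} x)"
  let ?g = "\<lambda>x. ennreal (\<bar>x\<bar> powr (\<alpha> - 2)) * indicator {x. 1 \<le> \<bar>x\<bar>} x"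
  have le: "ennreal (ktrunc \<alpha> x) \<le> ?f x + ?g x" for x
  proof -
    consider "x = 0" | "1 \<le> \<bar>x\<bar>" | "0 < \<bar>x\<bar>" "\<bar>x\<bar> < 1" by linarith
    then have "ennreal (ktrunc \<alpha> \<bar>x\<bar>) \<le> ?f x + ?g x"
    proof cases
      case 2
      then have "ennreal (ktrunc \<alpha> \<bar>x\<bar>) \<le> ?g x"
        using ktrunc_ge1_bounds(2)[of "\<bar>x\<bar>"] by (simp add: ennreal_leI)
      then show ?thesis by (rule add_increasing[rotated]) simp
    next
      case 3
      then have "ennreal (ktrunc \<alpha> \<bar>x\<bar>) \<le> ?f x"
        using ktrunc_lt1_bound[of "\<bar>x\<bar>"] \<alpha>
        by (auto simp: indicator_def ennreal_mult[symmetric] abs_less_iff intro!: ennreal_leI)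
      then show ?thesis by (rule add_increasing2[rotated]) simp
    qed (auto simp: ktrunc_def)
    then show ?thesis by (simp only: ktrunc_abs)
  qed
  have "(\<integral>\<^sup>+x. ennreal (ktrunc \<alpha> x) \<partial>lborel) \<le> (\<integral>\<^sup>+x. ?f x + ?g x \<partial>lborel)"
    by (intro nn_integral_mono le)
  also have "\<dots> = (\<integral>\<^sup>+x. ?f x \<partial>lborel) + (\<integral>\<^sup>+x. ?g x \<partial>lborel)"
    by (rule nn_integral_add) auto
  also have "\<dots> < \<infinity>"
    using \<alpha> nn_integral_abs_powr_tail[of "\<alpha> - 2" 1] nn_integral_abs_powr_finite[of "\<alpha> - 1" "-1" 1]
    by (subst nn_integral_cmult) (auto simp: ennreal_mult_eq_top_iff ennreal_add_eq_top less_top[symmetric])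
  finally show "(\<integral>\<^sup>+x. ennreal (ktrunc \<alpha> x) \<partial>lborel) < \<infinity>" .
qed (auto simp: ktrunc_nonneg)

lemma ktrunc_integral_pos: "0 < (LBINT x. ktrunc \<alpha> x)"
proof -
  obtain b where b: "0 < b" "\<And>x. 0 < x \<Longrightarrow> x \<le> b \<Longrightarrow> 0 < ktrunc \<alpha> x"
    using ktrunc_pos_near_0 by blast
  have "(LBINT x. ktrunc \<alpha> x) \<noteq> 0"
  proof
    assume "(LBINT x. ktrunc \<alpha> x) = 0"
    then have "AE x in lborel. ktrunc \<alpha> x = 0"
      using integral_nonneg_eq_0_iff_AE[OF integrable_ktrunc] ktrunc_nonneg by simp
    then have "AE x in lborel. x \<notin> {0<..b}"
      by eventually_elim (use b(2) in force)
    then have "emeasure lborel {0<..b} = 0"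
      using emeasure_eq_0_AE[of "\<lambda>x. x \<in> {0<..b}" lborel] by (simp del: greaterThanAtMost_iff)
    then show False using b(1) by simp
  qed
  moreover have "0 \<le> (LBINT x. ktrunc \<alpha> x)"
    by (simp add: integral_nonneg ktrunc_nonneg)
  ultimately show ?thesis by simp
qed

end

abbreviation rker :: "real \<Rightarrow> real \<Rightarrow> real"
  where "rker \<alpha> x \<equiv> \<bar>x\<bar> powr (\<alpha> - 1)"

text \<open>Minus the derivative of \<open>r powr (- 1 - \<alpha>)\<close>, the kernel of the
  fractional derivative of order \<alpha>. Integration by parts in r therefore trades second
  differences of \<open>\<phi>'\<close> for differences of \<phi>.\<close>

definition jump_weight :: "real \<Rightarrow> real \<Rightarrow> real"
  where "jump_weight \<alpha> r = (1 + \<alpha>) * r powr (- 2 - \<alpha>)"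

text \<open>The integral of 2 r times the weight over r >= e, that is, the coefficient of
  \<open>\<phi>' x\<close> in the truncated operator.\<close>

definition jump_mass :: "real \<Rightarrow> real \<Rightarrow> real"
  where "jump_mass \<alpha> e = 2 * (1 + \<alpha>) / \<alpha> * e powr (- \<alpha>)"

lemma measurable_jump_weight [measurable]: "jump_weight \<alpha> \<in> borel_measurable borel"
  unfolding jump_weight_def[abs_def] by measurable

lemma odd_powr_divide: "0 < r \<Longrightarrow> odd_powr p (x / r) = odd_powr p x / r powr p"
  by (auto simp: odd_powr_def powr_divide sgn_if zero_less_divide_iff)

lemma ennreal_rearrangement:
  fixes p q P Q :: ennreal
  assumes "p \<le> P" "q \<le> Q"
  shows "p * Q + P * q \<le> p * q + P * Q"
proof -
  obtain a b where "P = p + a" "Q = q + b" using assms by (auto simp: le_iff_add)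
  then show ?thesis by (simp add: algebra_simps add_increasing2)
qed

text \<open>Reflection at the midpoint c, with d half the distance. For z > 0, f is smaller at c + z
  than at c - z, and g is smaller at d + z than at d - z. The integral at x pairs large values with
  large ones, the integral at x' pairs them crosswise, so \<open>ennreal_rearrangement\<close>
  applies pointwise. The hypotheses with \<open>\<bar>a\<bar> = \<bar>b\<bar>\<close> contain
  evenness. They exclude a = 0, since a negative power takes the value 0 there instead of
  infinity.\<close>

lemma convolution_symmetric_antimono:
  fixes f g :: "real \<Rightarrow> ennreal"
  assumes [measurable]: "f \<in> borel_measurable borel" "g \<in> borel_measurable borel"
    and f: "\<And>a b. 0 < \<bar>a\<bar> \<Longrightarrow> \<bar>a\<bar> \<le> \<bar>b\<bar> \<Longrightarrow> f b \<le> f a"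
    and g: "\<And>a b. 0 < \<bar>a\<bar> \<Longrightarrow> \<bar>a\<bar> \<le> \<bar>b\<bar> \<Longrightarrow> g b \<le> g a"
    and x: "0 < x" "x \<le> x'"
  shows "(\<integral>\<^sup>+y. f y * g (x' - y) \<partial>lborel) \<le> (\<integral>\<^sup>+y. f y * g (x - y) \<partial>lborel)"
proof -
  define c d where "c = (x + x') / 2" and "d = (x' - x) / 2"
  have cd: "0 < c" "0 \<le> d" "x = c - d" "x' = c + d" using x by (auto simp: c_def d_def field_simps)
  have "(\<integral>\<^sup>+y. f y * g (x' - y) \<partial>lborel) = (\<integral>\<^sup>+z. f (c + z) * g (d - z) \<partial>lborel)"
    by (subst nn_integral_real_affine[where c = 1 and t = c]) (auto simp: cd)
  also have "\<dots> = (\<integral>\<^sup>+z\<in>{0<..}. (f (c + z) * g (d - z) + f (c - z) * g (d + z)) \<partial>lborel)"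
    by (subst nn_integral_fold) auto
  also have "\<dots> \<le> (\<integral>\<^sup>+z\<in>{0<..}. (f (c + z) * g (d + z) + f (c - z) * g (d - z)) \<partial>lborel)"
  proof (rule nn_integral_mono_AE)
    have le: "(f (c + z) * g (d - z) + f (c - z) * g (d + z)) \<le> (f (c + z) * g (d + z) + f (c - z) * g (d - z))"
      if "z \<noteq> c" "z \<noteq> d" "0 < z" for z
      using that cd by (intro ennreal_rearrangement f g) auto
    show "AE z in lborel. (f (c + z) * g (d - z) + f (c - z) * g (d + z)) * indicator {0<..} z
      \<le> (f (c + z) * g (d + z) + f (c - z) * g (d - z)) * indicator {0<..} z"
      using AE_lborel_singleton[of c] AE_lborel_singleton[of d]
      by eventually_elim (simp add: indicator_def le)
  qed
  also have "\<dots> = (\<integral>\<^sup>+z\<in>{0<..}. (f (c + z) * g (- d - z) + f (c - z) * g (- d + z)) \<partial>lborel)"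
  proof -
    have "AE z in lborel. z \<noteq> d \<and> z \<noteq> - d"
      using AE_lborel_singleton[of d] AE_lborel_singleton[of "- d"] by eventually_elim auto
    then have "AE z in lborel. g (d + z) = g (- d - z) \<and> g (d - z) = g (- d + z)"
      by eventually_elim (auto intro!: antisym g)
    then show ?thesis
      by (intro nn_integral_cong_AE) auto
  qed
  also have "\<dots> = (\<integral>\<^sup>+z. f (c + z) * g (- d - z) \<partial>lborel)"
    by (subst (2) nn_integral_fold) auto
  also have "\<dots> = (\<integral>\<^sup>+y. f y * g (x - y) \<partial>lborel)"
    by (subst (2) nn_integral_real_affine[where c = 1 and t = c]) (auto simp: cd)
  finally show ?thesis .
qed

context riesz_exponent
begin

abbreviation "w \<equiv> jump_weight \<alpha>"
abbreviation "\<mu> \<equiv> jump_mass \<alpha>"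
abbreviation "\<kappa> \<equiv> ktrunc \<alpha>"

lemma jump_weight_nonneg: "0 \<le> w r"
  using \<alpha> by (simp add: jump_weight_def)

lemma jump_mass_pos: "0 < e \<Longrightarrow> 0 < \<mu> e"
  using \<alpha> by (simp add: jump_mass_def)

text \<open>The quotient by \<alpha> is the integral of the Riesz kernel over
  \<open>{z - r..z + r}\<close>. The integrand in r has the primitive \<open>?F\<close>, a function
  of z / r that vanishes at infinity. Its boundary value at e cancels the last two terms of the
  numerator of \<open>\<kappa> (z / e)\<close>, and the first term alone is the right-hand side. The
  formula for \<open>ktrunc\<close> originates here.\<close>

lemma kernel_identity:
  assumes "0 < e" "z \<noteq> 0"
  shows "(\<integral>\<^sup>+r\<in>{e..}. ennreal (w r * ((odd_powr \<alpha> (z + r) - odd_powr \<alpha> (z - r)) / \<alpha>)) \<partial>lborel)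
      + ennreal (\<kappa> (z / e) / e) = ennreal (\<mu> e * rker \<alpha> z)"
    (is "?P z")
proof -
  have pos: "?P z" if z: "0 < z" for z :: real
  proof -
    let ?F = "\<lambda>r. - (\<bar>z / r + 1\<bar> powr (1 + \<alpha>) - \<bar>z / r - 1\<bar> powr (1 + \<alpha>)) / (\<alpha> * z)"
    have "(\<integral>\<^sup>+r\<in>{e..}. ennreal (w r * ((odd_powr \<alpha> (z + r) - odd_powr \<alpha> (z - r)) / \<alpha>)) \<partial>lborel)
      = ennreal (0 - ?F e)"
    proof (rule nn_integral_FTC_atLeast)
      fix r assume "e \<le> r"
      then have r: "0 < r" using assms by simp
      have d: "((\<lambda>r. z / r + a) has_real_derivative - z / r\<^sup>2) (at r)" for a
        using r by (auto intro!: derivative_eq_intros simp: power2_eq_square)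
      have "(?F has_real_derivative - ((1 + \<alpha>) * odd_powr \<alpha> (z / r + 1) * (- z / r\<^sup>2)
          - (1 + \<alpha>) * odd_powr \<alpha> (z / r + - 1) * (- z / r\<^sup>2)) / (\<alpha> * z)) (at r)"
        using \<alpha> by (intro DERIV_cdivide DERIV_minus DERIV_diff)
          (use DERIV_abs_powr_chain[OF _ d[of 1], of "1 + \<alpha>"] DERIV_abs_powr_chain[OF _ d[of "-1"], of "1 + \<alpha>"] in auto)
      moreover have "odd_powr \<alpha> (z / r + 1) = odd_powr \<alpha> (z + r) / r powr \<alpha>"
        "odd_powr \<alpha> (z / r + - 1) = odd_powr \<alpha> (z - r) / r powr \<alpha>"
        using r by (simp_all add: odd_powr_divide[symmetric] field_simps)
      moreover have "- ((1 + \<alpha>) * (odd_powr \<alpha> (z + r) / r powr \<alpha>) * (- z / r\<^sup>2)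
          - (1 + \<alpha>) * (odd_powr \<alpha> (z - r) / r powr \<alpha>) * (- z / r\<^sup>2)) / (\<alpha> * z)
          = w r * ((odd_powr \<alpha> (z + r) - odd_powr \<alpha> (z - r)) / \<alpha>)"
      proof -
        have "r powr (- 2 - \<alpha>) = 1 / (r\<^sup>2 * r powr \<alpha>)"
          using r by (simp add: powr_diff powr_minus_divide)
        then show ?thesis
          unfolding jump_weight_def \<open>r powr (- 2 - \<alpha>) = 1 / (r\<^sup>2 * r powr \<alpha>)\<close>
          using r \<alpha> z by (simp add: divide_simps) (simp add: algebra_simps)
      qed
      ultimately show "DERIV ?F r :> w r * ((odd_powr \<alpha> (z + r) - odd_powr \<alpha> (z - r)) / \<alpha>)"
        by simp
      show "0 \<le> w r * ((odd_powr \<alpha> (z + r) - odd_powr \<alpha> (z - r)) / \<alpha>)"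
        using odd_powr_mono[of \<alpha> "z - r" "z + r"] r \<alpha>
        by (intro mult_nonneg_nonneg divide_nonneg_nonneg jump_weight_nonneg) auto
    next
      have "((\<lambda>r. z / r) \<longlongrightarrow> 0) at_top"
        by (intro tendsto_divide_0[OF tendsto_const] filterlim_at_top_imp_at_infinity filterlim_ident)
      then have "(?F \<longlongrightarrow> - (\<bar>0 + 1\<bar> powr (1 + \<alpha>) - \<bar>0 - 1\<bar> powr (1 + \<alpha>)) / (\<alpha> * z)) at_top"
        using \<alpha> z by (intro tendsto_intros) auto
      then show "(?F \<longlongrightarrow> 0) at_top" by simp
    qed simp
    also have "\<dots> + ennreal (\<kappa> (z / e) / e) = ennreal (0 - ?F e + \<kappa> (z / e) / e)"
    proof (rule ennreal_plus[symmetric])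
      have "\<bar>z / e - 1\<bar> powr (1 + \<alpha>) \<le> \<bar>z / e + 1\<bar> powr (1 + \<alpha>)"
        using assms z \<alpha> by (intro powr_mono2) (auto simp: abs_le_iff)
      then show "0 \<le> 0 - ?F e" using \<alpha> z by (simp add: divide_nonpos_pos)
    qed (use ktrunc_nonneg assms in auto)
    also have "0 - ?F e + \<kappa> (z / e) / e = \<mu> e * rker \<alpha> z"
      using assms z \<alpha> by (simp add: ktrunc_def jump_mass_def powr_diff powr_divide powr_minus_divide field_simps)
    finally show ?thesis .
  qed
  show ?thesis
  proof (cases "z > 0")
    case False
    have "odd_powr \<alpha> (- z + r) - odd_powr \<alpha> (- z - r) = odd_powr \<alpha> (z + r) - odd_powr \<alpha> (z - r)" for r
      using odd_powr_minus[of \<alpha> "z - r"] odd_powr_minus[of \<alpha> "z + r"] by simp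
    then show ?thesis using pos[of "- z"] ktrunc_minus[of \<alpha> "z / e"] False assms by simp
  qed (rule pos)
qed

end

lemma measurable_pred_atLeastAtMost [measurable (raw)]:
  fixes a b s :: "'a \<Rightarrow> real"
  assumes "a \<in> borel_measurable M" "b \<in> borel_measurable M" "s \<in> borel_measurable M"
  shows "Measurable.pred M (\<lambda>x. s x \<in> {a x..b x})"
  unfolding atLeastAtMost_iff using assms by measurable

context riesz_exponent
begin

text \<open>\<open>kernel_identity\<close> convolved with f. Integrals over
  \<open>{x - r..x + r}\<close>, in place of differences of values at x + r and x - r, keep every
  integrand nonnegative, so that Tonelli applies without any integrability hypothesis. Subtraction
  and differentiation wait until finiteness is known.\<close>

lemma riesz_kernel_convolution_identity:
  fixes f :: "real \<Rightarrow> ennreal"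
  assumes e: "0 < e" and [measurable]: "f \<in> borel_measurable borel"
  defines "R \<equiv> \<lambda>s. \<integral>\<^sup>+y. f y * ennreal (rker \<alpha> (s - y)) \<partial>lborel"
  shows "ennreal (\<mu> e) * R x =
    (\<integral>\<^sup>+r\<in>{e..}. ennreal (w r) * (\<integral>\<^sup>+s\<in>{x - r..x + r}. R s \<partial>lborel) \<partial>lborel)
    + (\<integral>\<^sup>+y. f y * ennreal (\<kappa> ((x - y) / e) / e) \<partial>lborel)"
proof -
  let ?k = "\<lambda>z. ennreal (rker \<alpha> z)"
  let ?w = "\<lambda>r. ennreal (w r)"
  have ind: "(\<integral>\<^sup>+s\<in>{x - r..x + r}. ?k (s - y) \<partial>lborel)
      = ennreal ((odd_powr \<alpha> ((x - y) + r) - odd_powr \<alpha> ((x - y) - r)) / \<alpha>)" if "0 \<le> r" for y r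
  proof -
    have "(\<integral>\<^sup>+s\<in>{x - r..x + r}. ?k (s - y) \<partial>lborel)
      = (\<integral>\<^sup>+s\<in>{(x - y) - r..(x - y) + r}. ?k s \<partial>lborel)"
      by (subst nn_integral_real_affine[where c = 1 and t = y]) (auto intro!: nn_integral_cong simp: indicator_def)
    then show ?thesis using nn_integral_abs_powr[of \<alpha> "(x - y) - r" "(x - y) + r"] \<alpha> that by simp
  qed
  have eq: "ennreal (\<mu> e) * (f y * ?k (x - y)) =
      (\<integral>\<^sup>+r. \<integral>\<^sup>+s. ?w r * indicator {e..} r * indicator {x - r..x + r} s * (f y * ?k (s - y)) \<partial>lborel \<partial>lborel)
      + f y * ennreal (\<kappa> ((x - y) / e) / e)" if "y \<noteq> x" for y
  proof -
    have inner: "(\<integral>\<^sup>+s. ?w r * indicator {e..} r * indicator {x - r..x + r} s * (f y * ?k (s - y)) \<partial>lborel)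
        = f y * (?w r * (\<integral>\<^sup>+s\<in>{x - r..x + r}. ?k (s - y) \<partial>lborel) * indicator {e..} r)" for r
    proof -
      have "(\<integral>\<^sup>+s. ?w r * indicator {e..} r * indicator {x - r..x + r} s * (f y * ?k (s - y)) \<partial>lborel)
        = (\<integral>\<^sup>+s. (f y * ?w r * indicator {e..} r) * (?k (s - y) * indicator {x - r..x + r} s) \<partial>lborel)"
        by (simp add: mult_ac)
      also have "\<dots> = (f y * ?w r * indicator {e..} r) * (\<integral>\<^sup>+s\<in>{x - r..x + r}. ?k (s - y) \<partial>lborel)"
        by (rule nn_integral_cmult) measurable
      finally show ?thesis by (simp add: mult_ac)
    qed
    have "x - y \<noteq> 0" using that by simp
    note ki = kernel_identity[OF e this, symmetric]
    have "ennreal (\<mu> e) * (f y * ?k (x - y)) = f y * ennreal (\<mu> e * rker \<alpha> (x - y))"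
      using jump_mass_pos[OF e] by (simp add: ennreal_mult mult_ac)
    also have "\<dots> = f y * ((\<integral>\<^sup>+r\<in>{e..}. ?w r * (\<integral>\<^sup>+s\<in>{x - r..x + r}. ?k (s - y) \<partial>lborel) \<partial>lborel)
        + ennreal (\<kappa> ((x - y) / e) / e))"
      unfolding ki
    proof (rule arg_cong2[of _ _ _ _ "(*)"], rule refl, rule arg_cong2[of _ _ _ _ "(+)"], rule nn_integral_cong)
      fix r
      show "ennreal (w r * ((odd_powr \<alpha> (x - y + r) - odd_powr \<alpha> (x - y - r)) / \<alpha>)) * indicator {e..} r
        = ?w r * (\<integral>\<^sup>+s\<in>{x - r..x + r}. ?k (s - y) \<partial>lborel) * indicator {e..} r"
        using e by (cases "e \<le> r") (simp_all only: ind ennreal_mult'[OF jump_weight_nonneg], simp_all)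
    qed simp
    also have "\<dots> = (\<integral>\<^sup>+r. \<integral>\<^sup>+s. ?w r * indicator {e..} r * indicator {x - r..x + r} s * (f y * ?k (s - y)) \<partial>lborel \<partial>lborel)
      + f y * ennreal (\<kappa> ((x - y) / e) / e)"
      unfolding distrib_left inner
      by (rule arg_cong2[of _ _ _ _ "(+)"], rule nn_integral_cmult[symmetric]) simp_all
    finally show ?thesis .
  qed
  have "ennreal (\<mu> e) * R x = (\<integral>\<^sup>+y. ennreal (\<mu> e) * (f y * ?k (x - y)) \<partial>lborel)"
    unfolding R_def by (rule nn_integral_cmult[symmetric]) measurable
  also have "\<dots> = (\<integral>\<^sup>+y. (\<integral>\<^sup>+r. \<integral>\<^sup>+s. ?w r * indicator {e..} r * indicator {x - r..x + r} s * (f y * ?k (s - y)) \<partial>lborel \<partial>lborel)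
      + f y * ennreal (\<kappa> ((x - y) / e) / e) \<partial>lborel)"
    using AE_lborel_singleton[of x] by (intro nn_integral_cong_AE, eventually_elim) (simp add: eq)
  also have "\<dots> = (\<integral>\<^sup>+y. \<integral>\<^sup>+r. \<integral>\<^sup>+s. ?w r * indicator {e..} r * indicator {x - r..x + r} s * (f y * ?k (s - y)) \<partial>lborel \<partial>lborel \<partial>lborel)
      + (\<integral>\<^sup>+y. f y * ennreal (\<kappa> ((x - y) / e) / e) \<partial>lborel)"
    by (rule nn_integral_add) measurable
  also have "(\<integral>\<^sup>+y. \<integral>\<^sup>+r. \<integral>\<^sup>+s. ?w r * indicator {e..} r * indicator {x - r..x + r} s * (f y * ?k (s - y)) \<partial>lborel \<partial>lborel \<partial>lborel)
    = (\<integral>\<^sup>+r. \<integral>\<^sup>+y. \<integral>\<^sup>+s. ?w r * indicator {e..} r * indicator {x - r..x + r} s * (f y * ?k (s - y)) \<partial>lborel \<partial>lborel \<partial>lborel)"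
    by (rule lborel_pair.Fubini') measurable
  also have "\<dots> = (\<integral>\<^sup>+r. \<integral>\<^sup>+s. \<integral>\<^sup>+y. ?w r * indicator {e..} r * indicator {x - r..x + r} s * (f y * ?k (s - y)) \<partial>lborel \<partial>lborel \<partial>lborel)"
    by (intro nn_integral_cong lborel_pair.Fubini') measurable
  also have "\<dots> = (\<integral>\<^sup>+r\<in>{e..}. ?w r * (\<integral>\<^sup>+s\<in>{x - r..x + r}. R s \<partial>lborel) \<partial>lborel)"
    unfolding R_def by (simp add: nn_integral_cmult nn_integral_multc mult_ac nn_integral_cmult[symmetric])
  finally show ?thesis .
qed

text \<open>The substitution y = x t extracts the power of x. The remaining constant is finite
  because q > -1 at t = 0, \<alpha> > 0 at t = 1, and q + \<alpha> < 0 at infinity.\<close>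

lemma riesz_potential_abs_powr:
  assumes q: "-1 < q" "q < - \<alpha>"
  shows "\<exists>m>0. \<forall>x. x \<noteq> 0 \<longrightarrow>
    (\<integral>\<^sup>+y. ennreal (\<bar>y\<bar> powr q) * ennreal (rker \<alpha> (x - y)) \<partial>lborel) = ennreal (m * \<bar>x\<bar> powr (q + \<alpha>))"
proof -
  let ?f = "\<lambda>t::real. ennreal (\<bar>t\<bar> powr q) * ennreal (rker \<alpha> (1 - t))"
  define M where "M = (\<integral>\<^sup>+t. ?f t \<partial>lborel)"
  have scale: "(\<integral>\<^sup>+y. ennreal (\<bar>y\<bar> powr q) * ennreal (rker \<alpha> (x - y)) \<partial>lborel) = ennreal (\<bar>x\<bar> powr (q + \<alpha>)) * M"
    if x: "x \<noteq> 0" for x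
  proof -
    have "(\<integral>\<^sup>+y. ennreal (\<bar>y\<bar> powr q) * ennreal (rker \<alpha> (x - y)) \<partial>lborel)
       = ennreal \<bar>x\<bar> * (\<integral>\<^sup>+t. ennreal (\<bar>x * t\<bar> powr q) * ennreal (rker \<alpha> (x - x * t)) \<partial>lborel)"
      using x by (subst nn_integral_real_affine[where c = x and t = 0]) auto
    also have "\<dots> = ennreal \<bar>x\<bar> * (\<integral>\<^sup>+t. ennreal (\<bar>x\<bar> powr (q + \<alpha> - 1)) * ?f t \<partial>lborel)"
    proof (rule arg_cong2[of _ _ _ _ "(*)"], rule refl, rule nn_integral_cong)
      fix t
      have "\<bar>x - x * t\<bar> = \<bar>x\<bar> * \<bar>1 - t\<bar>" by (simp add: abs_mult[symmetric] algebra_simps)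
      then have "\<bar>x * t\<bar> powr q * rker \<alpha> (x - x * t) = \<bar>x\<bar> powr (q + \<alpha> - 1) * (\<bar>t\<bar> powr q * rker \<alpha> (1 - t))"
        using powr_add[of "\<bar>x\<bar>" q "\<alpha> - 1"] by (simp add: abs_mult powr_mult add_diff_eq)
      then show "ennreal (\<bar>x * t\<bar> powr q) * ennreal (rker \<alpha> (x - x * t)) = ennreal (\<bar>x\<bar> powr (q + \<alpha> - 1)) * ?f t"
        by (simp add: ennreal_mult[symmetric])
    qed
    also have "\<dots> = ennreal (\<bar>x\<bar> * \<bar>x\<bar> powr (q + \<alpha> - 1)) * M"
      unfolding M_def by (subst nn_integral_cmult) (auto simp: ennreal_mult mult_ac)
    also have "\<bar>x\<bar> * \<bar>x\<bar> powr (q + \<alpha> - 1) = \<bar>x\<bar> powr (q + \<alpha>)"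
      using x by (simp add: powr_diff)
    finally show ?thesis .
  qed
  have "M < \<infinity>"
  proof -
    let ?a = "\<lambda>t::real. ennreal ((1/2) powr (\<alpha> - 1)) * (ennreal (\<bar>t\<bar> powr q) * indicator {-1..1} t)"
    let ?b = "\<lambda>t::real. ennreal ((1/2) powr q) * (ennreal (rker \<alpha> (1 - t)) * indicator {0..2} t)"
    let ?c = "\<lambda>t::real. ennreal ((1/3) powr (\<alpha> - 1)) * (ennreal (\<bar>t\<bar> powr (q + \<alpha> - 1)) * indicator {t. 1/2 \<le> \<bar>t\<bar>} t)"
    have le: "?f t \<le> ?a t + (?b t + ?c t)" for t
    proof -
      consider "\<bar>t\<bar> \<le> 1/2" | "\<bar>1 - t\<bar> \<le> 1/2" | "1/2 \<le> \<bar>t\<bar>" "1/2 \<le> \<bar>1 - t\<bar>" by linarith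
      then show ?thesis
      proof cases
        case 1
        then have "?f t \<le> ?a t"
        proof -
          have "rker \<alpha> (1 - t) \<le> (1/2) powr (\<alpha> - 1)"
            using 1 \<alpha> by (intro powr_mono2') auto
          then have "\<bar>t\<bar> powr q * rker \<alpha> (1 - t) \<le> (1/2) powr (\<alpha> - 1) * \<bar>t\<bar> powr q"
            by (subst mult.commute) (rule mult_right_mono, auto)
          then show ?thesis
            using 1 by (auto simp: indicator_def ennreal_mult[symmetric] intro!: ennreal_leI)
        qed
        then show ?thesis by (rule add_increasing2[rotated]) simp
      next
        case 2
        then have "?f t \<le> ?b t"
        proof -
          have "\<bar>t\<bar> powr q \<le> (1/2) powr q"
            using 2 \<alpha> q by (intro powr_mono2') linarith+
          then have "\<bar>t\<bar> powr q * rker \<alpha> (1 - t) \<le> (1/2) powr q * rker \<alpha> (1 - t)"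
            by (rule mult_right_mono) auto
          then show ?thesis
            using 2 by (auto simp: indicator_def ennreal_mult[symmetric] intro!: ennreal_leI)
        qed
        then have "?f t \<le> ?b t + ?c t" by (rule add_increasing2[rotated]) simp
        then show ?thesis by (rule add_increasing[rotated]) simp
      next
        case 3
        \<comment> \<open>\<open>\<bar>t\<bar> \<le> 1 + \<bar>1 - t\<bar> \<le> 3 * \<bar>1 -
          t\<bar>\<close>, because \<open>\<bar>1 - t\<bar>\<close> is at least 1/2.\<close>
        have "rker \<alpha> (1 - t) \<le> (1/3 * \<bar>t\<bar>) powr (\<alpha> - 1)"
          using 3 \<alpha> by (intro powr_mono2') linarith+
        then have "\<bar>t\<bar> powr q * rker \<alpha> (1 - t) \<le> \<bar>t\<bar> powr q * ((1/3) powr (\<alpha> - 1) * rker \<alpha> t)"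
          unfolding powr_mult by (intro mult_left_mono) auto
        also have "\<dots> = (1/3) powr (\<alpha> - 1) * \<bar>t\<bar> powr (q + \<alpha> - 1)"
          using powr_add[of "\<bar>t\<bar>" q "\<alpha> - 1"] by (simp add: mult_ac add_diff_eq)
        finally have "?f t \<le> ?c t"
          using 3 by (auto simp: ennreal_mult[symmetric] intro!: ennreal_leI)
        then have "?f t \<le> ?b t + ?c t" by (rule add_increasing[rotated]) simp
        then show ?thesis by (rule add_increasing[rotated]) simp
      qed
    qed
    have b: "(\<integral>\<^sup>+t\<in>{0..2}. ennreal (rker \<alpha> (1 - t)) \<partial>lborel) < \<infinity>"
    proof -
      have "(\<integral>\<^sup>+t\<in>{0..2}. ennreal (rker \<alpha> (1 - t)) \<partial>lborel)
        = (\<integral>\<^sup>+t\<in>{-1..1}. ennreal (rker \<alpha> t) \<partial>lborel)"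
        by (subst nn_integral_real_affine[where c = "1" and t = 1]) (auto intro!: nn_integral_cong simp: indicator_def)
      then show ?thesis using nn_integral_abs_powr_finite[of "\<alpha> - 1" "-1" 1] \<alpha> by simp
    qed
    have "M \<le> (\<integral>\<^sup>+t. ?a t + (?b t + ?c t) \<partial>lborel)"
      unfolding M_def by (intro nn_integral_mono le)
    also have "\<dots> = (\<integral>\<^sup>+t. ?a t \<partial>lborel) + ((\<integral>\<^sup>+t. ?b t \<partial>lborel) + (\<integral>\<^sup>+t. ?c t \<partial>lborel))"
      by (subst nn_integral_add; (subst nn_integral_add)?) auto
    also have "\<dots> < \<infinity>"
      using b q nn_integral_abs_powr_tail[of "q + \<alpha> - 1" "1/2"] nn_integral_abs_powr_finite[of q "-1" 1]
      by (simp add: nn_integral_cmult ennreal_mult_less_top)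
    finally show ?thesis .
  qed
  moreover have "M \<noteq> 0"
  proof
    assume "M = 0"
    then have "AE t in lborel. ?f t = 0" unfolding M_def by (subst (asm) nn_integral_0_iff_AE) auto
    then have "AE t::real in lborel. False"
      using AE_lborel_singleton[of 0] AE_lborel_singleton[of 1] by eventually_elim (auto simp: ennreal_mult[symmetric])
    then show False by (simp add: eventually_False ae_filter_eq_bot_iff)
  qed
  ultimately obtain m where m: "M = ennreal m" "0 < m"
    by (cases M) (auto simp: less_le)
  show ?thesis
    using scale m by (intro exI[of _ m]) (auto simp: ennreal_mult mult_ac)
qed

end

section \<open>Truncated inequalities for powers\<close>

text \<open>For X = x / e, the range of integration consists of the z with x - e z between x / 2 and
  3 x / 2.\<close>

definition ktrunc_mass :: "real \<Rightarrow> real \<Rightarrow> real"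
  where "ktrunc_mass \<alpha> X = (LBINT z. ktrunc \<alpha> z * indicator {- X / 2..X / 2} z)"

abbreviation ktrunc_powr :: "real \<Rightarrow> real \<Rightarrow> real \<Rightarrow> real \<Rightarrow> ennreal"
  where "ktrunc_powr \<alpha> q e x \<equiv>
    \<integral>\<^sup>+y. ennreal (\<bar>y\<bar> powr q) * ennreal (ktrunc \<alpha> ((x - y) / e) / e) \<partial>lborel"

text \<open>Formally the derivative in x is p times \<open>\<bar>x + r\<bar> powr (p - 1) - \<bar>x
  - r\<bar> powr (p - 1)\<close>, which is at most 0. Comparing integrals of the two powers over
  \<open>{x..x'}\<close> avoids the point x = r, where the derivative may fail to exist.\<close>

lemma odd_powr_increment_antimono:
  assumes "0 < p" "p \<le> 1" "0 \<le> r" "0 < x" "x \<le> x'"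
  shows "odd_powr p (x' + r) - odd_powr p (x' - r) \<le> odd_powr p (x + r) - odd_powr p (x - r)"
proof -
  have eq: "ennreal ((odd_powr p (x' + a) - odd_powr p (x + a)) / p)
    = (\<integral>\<^sup>+s\<in>{x..x'}. ennreal (\<bar>s + a\<bar> powr (p - 1)) \<partial>lborel)" for a
  proof -
    have "ennreal ((odd_powr p (x' + a) - odd_powr p (x + a)) / p)
      = (\<integral>\<^sup>+s\<in>{x + a..x' + a}. ennreal (\<bar>s\<bar> powr (p - 1)) \<partial>lborel)"
      using assms by (intro nn_integral_abs_powr[symmetric]) auto
    also have "\<dots> = (\<integral>\<^sup>+s\<in>{x..x'}. ennreal (\<bar>s + a\<bar> powr (p - 1)) \<partial>lborel)"
      by (subst nn_integral_real_affine[where c = 1 and t = a])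
         (auto simp: indicator_def add.commute intro!: nn_integral_cong)
    finally show ?thesis .
  qed
  have "(\<integral>\<^sup>+s\<in>{x..x'}. ennreal (\<bar>s + r\<bar> powr (p - 1)) \<partial>lborel)
    \<le> (\<integral>\<^sup>+s\<in>{x..x'}. ennreal (\<bar>s + - r\<bar> powr (p - 1)) \<partial>lborel)"
    using AE_lborel_singleton[of r]
    by (intro nn_integral_mono_AE, eventually_elim)
       (use assms in \<open>auto simp: indicator_def intro!: ennreal_leI powr_mono2'\<close>)
  then have "(odd_powr p (x' + r) - odd_powr p (x + r)) / p \<le> (odd_powr p (x' - r) - odd_powr p (x - r)) / p"
    unfolding eq[symmetric] using assms odd_powr_mono[of p "x - r" "x' - r"] by (subst (asm) ennreal_le_iff) auto
  then show ?thesis using assms by (simp add: divide_le_cancel)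
qed

context riesz_exponent
begin

lemma ktrunc_scaled_antimono:
  assumes "0 < e" "0 < \<bar>a\<bar>" "\<bar>a\<bar> \<le> \<bar>b\<bar>"
  shows "\<kappa> (b / e) / e \<le> \<kappa> (a / e) / e"
  using ktrunc_antimono[of "\<bar>a / e\<bar>" "\<bar>b / e\<bar>", unfolded ktrunc_abs] assms
  by (simp add: divide_right_mono)

text \<open>The convolution identity becomes explicit for f a power of order - p - \<alpha>: its
  Riesz potential is a multiple of the power of order - p, whose integral over
  \<open>{x - r..x + r}\<close> is an increment of \<open>odd_powr (1 - p)\<close>. The range of p
  is the one that \<open>riesz_potential_abs_powr\<close> permits.\<close>

lemma jump_integral_powr:
  assumes p: "0 < p" "p < 1 - \<alpha>"
  shows "\<exists>m>0. \<forall>x>0. \<forall>e>0.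
    ennreal m * (\<integral>\<^sup>+r\<in>{e..}. ennreal (w r * (odd_powr (1 - p) (x + r) - odd_powr (1 - p) (x - r))) \<partial>lborel)
    + ktrunc_powr \<alpha> (- p - \<alpha>) e x
    = ennreal (m * (1 - p) * \<mu> e * x powr (- p))"
proof -
  have "-1 < - p - \<alpha>" "- p - \<alpha> < - \<alpha>" using p \<alpha> by auto
  from riesz_potential_abs_powr[OF this] obtain m where m: "0 < m"
    "\<And>x. x \<noteq> 0 \<Longrightarrow> (\<integral>\<^sup>+y. ennreal (\<bar>y\<bar> powr (- p - \<alpha>)) * ennreal (rker \<alpha> (x - y)) \<partial>lborel) = ennreal (m * \<bar>x\<bar> powr (- p))"
    by auto
  define R where "R = (\<lambda>s. \<integral>\<^sup>+y. ennreal (\<bar>y\<bar> powr (- p - \<alpha>)) * ennreal (rker \<alpha> (s - y)) \<partial>lborel)"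
  show ?thesis
  proof (intro exI[of _ "m / (1 - p)"] conjI allI impI)
    show "0 < m / (1 - p)" using m p \<alpha> by simp
    fix x e :: real assume x: "0 < x" "0 < e"
    have inner: "(\<integral>\<^sup>+s\<in>{x - r..x + r}. R s \<partial>lborel)
        = ennreal (m * ((odd_powr (1 - p) (x + r) - odd_powr (1 - p) (x - r)) / (1 - p)))" if "0 \<le> r" for r
    proof -
      have "(\<integral>\<^sup>+s\<in>{x - r..x + r}. R s \<partial>lborel)
        = (\<integral>\<^sup>+s. ennreal m * (ennreal (\<bar>s\<bar> powr (1 - p - 1)) * indicator {x - r..x + r} s) \<partial>lborel)"
        using AE_lborel_singleton[of 0]
        by (intro nn_integral_cong_AE, eventually_elim) (use m(1) in \<open>simp add: R_def m(2) ennreal_mult mult_ac\<close>)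
      also have "\<dots> = ennreal m * ennreal ((odd_powr (1 - p) (x + r) - odd_powr (1 - p) (x - r)) / (1 - p))"
        using p \<alpha> that by (subst nn_integral_cmult) (auto simp: nn_integral_abs_powr[symmetric])
      finally show ?thesis by (simp only: ennreal_mult'[OF less_imp_le[OF m(1)]])
    qed
    have a: "ennreal (\<mu> e) * R x = ennreal (m / (1 - p) * (1 - p) * \<mu> e * x powr (- p))"
      using m x jump_mass_pos[OF x(2)] p \<alpha> by (simp add: R_def ennreal_mult[symmetric] mult_ac)
    have b: "(\<integral>\<^sup>+r\<in>{e..}. ennreal (w r) * (\<integral>\<^sup>+s\<in>{x - r..x + r}. R s \<partial>lborel) \<partial>lborel)
      = ennreal (m / (1 - p)) * (\<integral>\<^sup>+r\<in>{e..}. ennreal (w r * (odd_powr (1 - p) (x + r) - odd_powr (1 - p) (x - r))) \<partial>lborel)"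
      unfolding nn_integral_cmult[symmetric]
    proof (subst nn_integral_cmult[symmetric], simp, intro nn_integral_cong)
      fix r
      show "ennreal (w r) * (\<integral>\<^sup>+s\<in>{x - r..x + r}. R s \<partial>lborel) * indicator {e..} r
        = ennreal (m / (1 - p)) * (ennreal (w r * (odd_powr (1 - p) (x + r) - odd_powr (1 - p) (x - r))) * indicator {e..} r)"
      proof (cases "e \<le> r")
        case True
        have "0 \<le> odd_powr (1 - p) (x + r) - odd_powr (1 - p) (x - r)"
          using odd_powr_mono[of "1 - p" "x - r" "x + r"] True x p \<alpha> by simp
        then show ?thesis
          using True x m p \<alpha> jump_weight_nonneg[of r] by (simp add: inner ennreal_mult[symmetric] mult_ac)
      qed simp
    qed
    have c: "ennreal (\<mu> e) * R x =
      (\<integral>\<^sup>+r\<in>{e..}. ennreal (w r) * (\<integral>\<^sup>+s\<in>{x - r..x + r}. R s \<partial>lborel) \<partial>lborel)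
      + ktrunc_powr \<alpha> (- p - \<alpha>) e x"
      unfolding R_def by (rule riesz_kernel_convolution_identity[OF x(2)]) simp
    show "ennreal (m / (1 - p)) * (\<integral>\<^sup>+r\<in>{e..}. ennreal (w r * (odd_powr (1 - p) (x + r) - odd_powr (1 - p) (x - r))) \<partial>lborel)
      + ktrunc_powr \<alpha> (- p - \<alpha>) e x
      = ennreal (m / (1 - p) * (1 - p) * \<mu> e * x powr (- p))"
      unfolding a[symmetric] b[symmetric] by (rule c[symmetric])
  qed
qed

text \<open>The case p = 1 - \<beta> of \<open>jump_integral_powr\<close>. Of the convolution term
  only the part \<open>\<bar>x - y\<bar> \<le> x / 2\<close> is kept. The resulting term with C is
  the whole gain in the final inequality.\<close>

lemma jump_odd_powr_le:
  assumes \<beta>: "\<alpha> < \<beta>" "\<beta> < 1"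
  shows "\<exists>C>0. \<forall>x>0. \<forall>e>0.
    (\<integral>\<^sup>+r\<in>{e..}. ennreal (w r * (odd_powr \<beta> (x + r) - odd_powr \<beta> (x - r))) \<partial>lborel)
    + ennreal (C * x powr (\<beta> - \<alpha> - 1) * ktrunc_mass \<alpha> (x / e)) \<le> ennreal (\<beta> * \<mu> e * x powr (\<beta> - 1))"
proof -
  define q where "q = \<beta> - \<alpha> - 1"
  have q: "q < 0" using \<beta> \<alpha> by (simp add: q_def)
  obtain m where m: "0 < m" and id: "\<And>x e. 0 < x \<Longrightarrow> 0 < e \<Longrightarrow>
    ennreal m * (\<integral>\<^sup>+r\<in>{e..}. ennreal (w r * (odd_powr \<beta> (x + r) - odd_powr \<beta> (x - r))) \<partial>lborel)
    + ktrunc_powr \<alpha> q e x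
    = ennreal (m * \<beta> * \<mu> e * x powr (\<beta> - 1))"
    using jump_integral_powr[of "1 - \<beta>"] \<beta> by (auto simp: q_def diff_diff_eq2 algebra_simps)
  show ?thesis
  \<comment> \<open>On the kept range \<open>\<bar>x - e * z\<bar>\<close> is at most 3 x / 2, and q
    is negative; division by m normalises the jump integral.\<close>
  proof (intro exI[of _ "(3/2) powr q / m"] conjI allI impI)
    show "0 < (3/2) powr q / m" using m by simp
    fix x e :: real assume x: "0 < x" "0 < e"
    let ?I = "\<integral>\<^sup>+r\<in>{e..}. ennreal (w r * (odd_powr \<beta> (x + r) - odd_powr \<beta> (x - r))) \<partial>lborel"
    have "ennreal ((3/2) powr q * x powr q * ktrunc_mass \<alpha> (x / e))
      = ennreal ((3/2 * x) powr q) * (\<integral>\<^sup>+z. ennreal (\<kappa> z * indicator {- (x / e) / 2..x / e / 2} z) \<partial>lborel)"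
      unfolding ktrunc_mass_def powr_mult
      using ktrunc_nonneg integrable_ktrunc
      by (subst nn_integral_eq_integral) (auto simp: ennreal_mult integrable_real_mult_indicator)
    also have "\<dots> = (\<integral>\<^sup>+z. ennreal ((3/2 * x) powr q) * ennreal (\<kappa> z * indicator {- (x / e) / 2..x / e / 2} z) \<partial>lborel)"
      by (rule nn_integral_cmult[symmetric]) simp
    also have "\<dots> \<le> (\<integral>\<^sup>+z. ennreal e * (ennreal (\<bar>x + - e * z\<bar> powr q) * ennreal (\<kappa> ((x - (x + - e * z)) / e) / e)) \<partial>lborel)"
    proof (rule nn_integral_mono)
      fix z
      have "(3/2 * x) powr q * (\<kappa> z * indicator {- (x / e) / 2..x / e / 2} z) \<le> \<bar>x - e * z\<bar> powr q * \<kappa> z"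
      proof (cases "\<bar>e * z\<bar> \<le> x / 2")
        case True
        then have "(3/2 * x) powr q \<le> \<bar>x - e * z\<bar> powr q"
          using x q by (intro powr_mono2') (auto simp: abs_le_iff field_simps)
        then show ?thesis
          by (intro mult_mono) (auto simp: ktrunc_nonneg indicator_def)
      next
        case False
        then have "z \<notin> {- (x / e) / 2..x / e / 2}"
          using x by (auto simp: abs_le_iff field_simps)
        then show ?thesis by (simp add: ktrunc_nonneg)
      qed
      then show "ennreal ((3/2 * x) powr q) * ennreal (\<kappa> z * indicator {- (x / e) / 2..x / e / 2} z)
        \<le> ennreal e * (ennreal (\<bar>x + - e * z\<bar> powr q) * ennreal (\<kappa> ((x - (x + - e * z)) / e) / e))"
        using x ktrunc_nonneg[of z] by (auto simp: ennreal_mult[symmetric] intro!: ennreal_leI)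
    qed
    also have "\<dots> = ennreal e * (\<integral>\<^sup>+z. ennreal (\<bar>x + - e * z\<bar> powr q) * ennreal (\<kappa> ((x - (x + - e * z)) / e) / e) \<partial>lborel)"
      by (rule nn_integral_cmult) measurable
    also have "\<dots> = ktrunc_powr \<alpha> q e x"
      using x by (subst (2) nn_integral_real_affine[where c = "- e" and t = x]) auto
    finally have conv: "ennreal ((3/2) powr q * x powr q * ktrunc_mass \<alpha> (x / e)) \<le> \<dots>" .
    have "ennreal m * ?I + ennreal ((3/2) powr q * x powr q * ktrunc_mass \<alpha> (x / e))
      \<le> ennreal (m * \<beta> * \<mu> e * x powr (\<beta> - 1))"
      unfolding id[OF x, symmetric] by (intro add_left_mono conv)
    then have "ennreal (1 / m) * (ennreal m * ?I + ennreal ((3/2) powr q * x powr q * ktrunc_mass \<alpha> (x / e)))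
      \<le> ennreal (1 / m) * ennreal (m * \<beta> * \<mu> e * x powr (\<beta> - 1))"
      by (rule mult_left_mono) simp
    moreover have "ennreal (1 / m) * (ennreal m * ?I) = ?I"
      using m by (simp add: mult.assoc[symmetric] ennreal_mult[symmetric])
    ultimately show "?I + ennreal ((3/2) powr q / m * x powr (\<beta> - \<alpha> - 1) * ktrunc_mass \<alpha> (x / e)) \<le> ennreal (\<beta> * \<mu> e * x powr (\<beta> - 1))"
      using m by (simp add: distrib_left ennreal_mult'[symmetric] q_def mult_ac)
  qed
qed

text \<open>
  The truncated derivative of \<open>\<bar>x\<bar> powr (- \<sigma>)\<close> is a multiple of the convolution of \<open>\<kappa>\<^sub>e\<close> with
  \<open>\<bar>x\<bar> powr (- \<sigma> - \<alpha>)\<close>, hence decreasing in \<open>x > 0\<close> by rearrangement. Fatou's lemma turns this into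
  a statement on derivatives without any bound near the singularity \<open>r = x\<close>.
\<close>

lemma jump_abs_powr_le:
  assumes \<sigma>: "0 < \<sigma>" "\<sigma> < 1 - \<alpha>" and x: "0 < x" and e: "0 < e"
  shows "(\<integral>\<^sup>+r\<in>{e..}. ennreal (w r * (\<bar>x - r\<bar> powr (- \<sigma>) - \<bar>x + r\<bar> powr (- \<sigma>))) \<partial>lborel)
    \<le> ennreal (\<sigma> * \<mu> e * x powr (- \<sigma> - 1))"
proof -
  let ?g = "\<lambda>r. \<bar>x - r\<bar> powr (- \<sigma>) - \<bar>x + r\<bar> powr (- \<sigma>)"
  let ?D' = "\<lambda>r. (1 - \<sigma>) * \<bar>x + r\<bar> powr (1 - \<sigma> - 1) * 1 - (1 - \<sigma>) * \<bar>x - r\<bar> powr (1 - \<sigma> - 1) * 1"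
  define D where "D = (\<lambda>x r. odd_powr (1 - \<sigma>) (x + r) - odd_powr (1 - \<sigma>) (x - r))"
  have [measurable]: "(\<lambda>r. D x r) \<in> borel_measurable borel" for x unfolding D_def by measurable
  obtain m where m: "0 < m" and id: "\<And>x. 0 < x \<Longrightarrow>
    ennreal m * (\<integral>\<^sup>+r\<in>{e..}. ennreal (w r * D x r) \<partial>lborel)
    + ktrunc_powr \<alpha> (- \<sigma> - \<alpha>) e x
    = ennreal (m * (1 - \<sigma>) * \<mu> e * x powr (- \<sigma>))"
    using jump_integral_powr[OF \<sigma>] e by (auto simp: D_def)
  let ?J = "m * (1 - \<sigma>) * \<mu> e"
  \<comment> \<open>The identities at x and x' are subtracted. Their convolution terms are dropped
    because the term at x is the larger one.\<close>
  have diff: "(\<integral>\<^sup>+r\<in>{e..}. ennreal (w r * (D x r - D x' r)) \<partial>lborel)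
    \<le> ennreal ((1 - \<sigma>) * \<mu> e * (x powr (- \<sigma>) - x' powr (- \<sigma>)))" if x': "x \<le> x'" for x'
  proof -
    let ?W = "\<integral>\<^sup>+r\<in>{e..}. ennreal (w r * (D x r - D x' r)) \<partial>lborel"
    let ?T = "\<integral>\<^sup>+r\<in>{e..}. ennreal (w r * D x' r) \<partial>lborel"
    let ?h = "\<lambda>x. ktrunc_powr \<alpha> (- \<sigma> - \<alpha>) e x"
    have nn: "0 \<le> D x r - D x' r" "0 \<le> D x' r" if "e \<le> r" for r
      using odd_powr_increment_antimono[of "1 - \<sigma>" r x x'] odd_powr_mono[of "1 - \<sigma>" "x' - r" "x' + r"] that x x' \<sigma> \<alpha> e
      by (auto simp: D_def)
    have "(\<integral>\<^sup>+r\<in>{e..}. ennreal (w r * D x r) \<partial>lborel) =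
      (\<integral>\<^sup>+r. ennreal (w r * (D x r - D x' r)) * indicator {e..} r + ennreal (w r * D x' r) * indicator {e..} r \<partial>lborel)"
    proof (rule nn_integral_cong)
      fix r
      show "ennreal (w r * D x r) * indicator {e..} r =
        ennreal (w r * (D x r - D x' r)) * indicator {e..} r + ennreal (w r * D x' r) * indicator {e..} r"
      proof (cases "e \<le> r")
        case True
        have "w r * D x r = w r * (D x r - D x' r) + w r * D x' r"
          by (simp add: algebra_simps)
        then show ?thesis
          using True nn[OF True] jump_weight_nonneg[of r] by (simp add: ennreal_plus[symmetric] del: ennreal_plus)
      qed simp
    qed
    also have "\<dots> = ?W + ?T" by (rule nn_integral_add) measurable
    finally have T: "(\<integral>\<^sup>+r\<in>{e..}. ennreal (w r * D x r) \<partial>lborel) = ?W + ?T" .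
    have "?h x' \<le> ?h x"
      using x x' \<sigma> \<alpha> e
      by (intro convolution_symmetric_antimono[of _ "\<lambda>z. ennreal (\<kappa> (z / e) / e)"])
        (auto intro!: ennreal_leI powr_mono2' ktrunc_scaled_antimono)
    then have "ennreal m * ?W + (ennreal m * ?T + ?h x') \<le> ennreal m * (?W + ?T) + ?h x"
      by (simp add: distrib_left add.assoc add_left_mono)
    then have "ennreal m * ?W + ennreal (?J * x' powr (- \<sigma>))
      \<le> ennreal (?J * x powr (- \<sigma>))"
      using id[of x] id[of x'] x x' by (simp add: T)
    then have "ennreal m * ?W \<le> ennreal (?J * x powr (- \<sigma>) - ?J * x' powr (- \<sigma>))"
      using m \<sigma> \<alpha> jump_mass_pos[OF e]
      by (cases "ennreal m * ?W") (auto simp: top_unique ennreal_plus[symmetric] simp del: ennreal_plus intro!: ennreal_leI)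
    then have "ennreal (1 / m) * (ennreal m * ?W) \<le> ennreal (1 / m) *
      ennreal (?J * x powr (- \<sigma>) - ?J * x' powr (- \<sigma>))"
      by (rule mult_left_mono) simp
    moreover have "ennreal (1 / m) * (ennreal m * ?W) = ?W"
      using m by (simp add: mult.assoc[symmetric] ennreal_mult[symmetric])
    moreover have "1 / m * (?J * x powr (- \<sigma>) - ?J * x' powr (- \<sigma>))
      = (1 - \<sigma>) * \<mu> e * (x powr (- \<sigma>) - x' powr (- \<sigma>))"
      using m by (simp only: mult.assoc right_diff_distrib[symmetric]) simp
    ultimately show ?thesis
      using m by (simp only: ennreal_mult'[symmetric] zero_le_divide_1_iff less_imp_le)
  qed
  define h where "h = (\<lambda>n. inverse (real (Suc n)))"
  have h: "h n > 0" for n by (simp add: h_def)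
  have h0: "filterlim h (at 0) sequentially"
    unfolding h_def using LIMSEQ_inverse_real_of_nat by (auto simp: filterlim_at)
  define u where "u = (\<lambda>n r. ennreal (w r * ((D x r - D (x + h n) r) / h n / (1 - \<sigma>))) * indicator {e..} r)"
  have [measurable]: "u n \<in> borel_measurable borel" for n unfolding u_def by measurable
  have lim_u: "(\<lambda>n. u n r) \<longlonglongrightarrow> ennreal (w r * ?g r) * indicator {e..} r"
    if r: "r \<noteq> x" for r
  proof (cases "e \<le> r")
    case True
    have "((\<lambda>x. D x r) has_real_derivative ?D' r) (at x)"
      unfolding D_def using r x True e
      by (intro DERIV_diff DERIV_chain2[OF DERIV_odd_powr]) (auto intro!: derivative_eq_intros)
    then have "(\<lambda>n. (D (x + h n) r - D x r) / h n) \<longlonglongrightarrow> ?D' r"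
      unfolding DERIV_def by (rule filterlim_compose[OF _ h0])
    then have "(\<lambda>n. w r * (- ((D (x + h n) r - D x r) / h n) / (1 - \<sigma>))) \<longlonglongrightarrow> w r * (- ?D' r / (1 - \<sigma>))"
      using \<sigma> \<alpha> by (intro tendsto_intros) auto
    moreover have "- ((D (x + h n) r - D x r) / h n) / (1 - \<sigma>) = (D x r - D (x + h n) r) / h n / (1 - \<sigma>)" for n
      by (simp add: minus_divide_left)
    moreover have "- ?D' r / (1 - \<sigma>) = ?g r"
      using \<sigma> \<alpha> by (simp add: field_simps)
    ultimately have "(\<lambda>n. w r * ((D x r - D (x + h n) r) / h n / (1 - \<sigma>))) \<longlonglongrightarrow> w r * ?g r"
      by (simp only:)
    from tendsto_ennrealI[OF this] show ?thesis using True by (simp only: u_def indicator_simps atLeast_iff mult_1_right)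
  qed (simp add: u_def)
  have le_u: "(\<integral>\<^sup>+r. u n r \<partial>lborel) \<le> ennreal (\<mu> e * ((x powr (- \<sigma>) - (x + h n) powr (- \<sigma>)) / h n))" for n
  proof -
    have c: "0 \<le> 1 / (h n * (1 - \<sigma>))" using h[of n] \<sigma> \<alpha> by simp
    have "(\<integral>\<^sup>+r. u n r \<partial>lborel) = (\<integral>\<^sup>+r. ennreal (1 / (h n * (1 - \<sigma>))) * (ennreal (w r * (D x r - D (x + h n) r)) * indicator {e..} r) \<partial>lborel)"
      unfolding u_def by (intro nn_integral_cong) (simp add: mult.assoc[symmetric] ennreal_mult'[OF c, symmetric])
    also have "\<dots> = ennreal (1 / (h n * (1 - \<sigma>))) * (\<integral>\<^sup>+r\<in>{e..}. ennreal (w r * (D x r - D (x + h n) r)) \<partial>lborel)"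
      by (rule nn_integral_cmult) measurable
    also have "\<dots> \<le> ennreal (1 / (h n * (1 - \<sigma>))) * ennreal ((1 - \<sigma>) * \<mu> e * (x powr (- \<sigma>) - (x + h n) powr (- \<sigma>)))"
      using h[of n] by (intro mult_left_mono diff) auto
    also have "\<dots> = ennreal (\<mu> e * ((x powr (- \<sigma>) - (x + h n) powr (- \<sigma>)) / h n))"
    proof -
      have "1 / (h n * (1 - \<sigma>)) * ((1 - \<sigma>) * \<mu> e * d) = \<mu> e * (d / h n)" for d
        using h[of n] \<sigma> \<alpha> by simp
      then show ?thesis unfolding ennreal_mult'[OF c, symmetric] by (simp only:)
    qed
    finally show ?thesis .
  qed
  have "((\<lambda>x. x powr (- \<sigma>)) has_real_derivative - \<sigma> * x powr (- \<sigma> - 1)) (at x)"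
    using x by (intro has_real_derivative_powr) auto
  then have "(\<lambda>n. ((x + h n) powr (- \<sigma>) - x powr (- \<sigma>)) / h n) \<longlonglongrightarrow> - \<sigma> * x powr (- \<sigma> - 1)"
    unfolding DERIV_def by (rule filterlim_compose[OF _ h0])
  then have "(\<lambda>n. ennreal (\<mu> e * - (((x + h n) powr (- \<sigma>) - x powr (- \<sigma>)) / h n))) \<longlonglongrightarrow> ennreal (\<mu> e * - (- \<sigma> * x powr (- \<sigma> - 1)))"
    by (intro tendsto_ennrealI tendsto_intros)
  then have lim_r: "(\<lambda>n. ennreal (\<mu> e * ((x powr (- \<sigma>) - (x + h n) powr (- \<sigma>)) / h n))) \<longlonglongrightarrow> ennreal (\<sigma> * \<mu> e * x powr (- \<sigma> - 1))"
    by (simp add: minus_divide_left mult_ac)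
  have "(\<integral>\<^sup>+r\<in>{e..}. ennreal (w r * ?g r) \<partial>lborel)
    = (\<integral>\<^sup>+r. liminf (\<lambda>n. u n r) \<partial>lborel)"
    using AE_lborel_singleton[of x]
    by (intro nn_integral_cong_AE, eventually_elim) (simp add: lim_imp_Liminf[OF _ lim_u])
  also have "\<dots> \<le> liminf (\<lambda>n. \<integral>\<^sup>+r. u n r \<partial>lborel)"
    by (rule nn_integral_liminf) simp
  also have "\<dots> \<le> liminf (\<lambda>n. ennreal (\<mu> e * ((x powr (- \<sigma>) - (x + h n) powr (- \<sigma>)) / h n)))"
    by (intro Liminf_mono always_eventually allI le_u)
  also have "\<dots> = ennreal (\<sigma> * \<mu> e * x powr (- \<sigma> - 1))"
    by (rule lim_imp_Liminf[OF _ lim_r]) simp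
  finally show ?thesis .
qed

end

section \<open>The Riesz potential of a smooth profile\<close>

abbreviation jump_term :: "real \<Rightarrow> real \<Rightarrow> (real \<Rightarrow> real) \<Rightarrow> real \<Rightarrow> real \<Rightarrow> real"
  where "jump_term \<alpha> e f x r \<equiv> jump_weight \<alpha> r * (f (x + r) - f (x - r)) * indicator {e..} r"

section \<open>Integrals depending on a parameter\<close>

lemma DERIV_lebesgue_integral:
  fixes f f' :: "real \<Rightarrow> 'a \<Rightarrow> real"
  assumes int: "\<And>x. integrable M (f x)" and [measurable]: "\<And>x. f' x \<in> borel_measurable M"
    and D: "\<And>x y. ((\<lambda>x. f x y) has_real_derivative f' x y) (at x)"
    and B: "integrable M B" "\<And>x y. \<bar>f' x y\<bar> \<le> B y"
  shows "((\<lambda>x. \<integral>y. f x y \<partial>M) has_real_derivative (\<integral>y. f' x y \<partial>M)) (at x)"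
  unfolding DERIV_def tendsto_at_iff_sequentially comp_def
proof (intro allI impI)
  fix h :: "nat \<Rightarrow> real" assume h: "\<forall>i. h i \<in> UNIV - {0}" "h \<longlonglongrightarrow> 0"
  have [measurable]: "f x \<in> borel_measurable M" for x using int by (rule borel_measurable_integrable)
  have "(\<lambda>n. \<integral>y. (f (x + h n) y - f x y) / h n \<partial>M) \<longlonglongrightarrow> (\<integral>y. f' x y \<partial>M)"
  proof (rule integral_dominated_convergence[where w = B])
    show "AE y in M. (\<lambda>n. (f (x + h n) y - f x y) / h n) \<longlonglongrightarrow> f' x y"
      using D h unfolding DERIV_def tendsto_at_iff_sequentially comp_def by auto
    show "AE y in M. norm ((f (x + h n) y - f x y) / h n) \<le> B y" for n
    proof (rule AE_I2)
      fix y
      have "norm (f (x + h n) y - f x y) \<le> B y * norm (x + h n - x)"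
        by (rule field_differentiable_bound[where S = UNIV and f' = "\<lambda>x. f' x y"]) (use D B(2) in auto)
      then show "norm ((f (x + h n) y - f x y) / h n) \<le> B y"
        using h(1)[rule_format, of n] by (auto simp: abs_divide divide_le_eq)
    qed
  qed (use B in auto)
  then show "(\<lambda>n. ((\<integral>y. f (x + h n) y \<partial>M) - (\<integral>y. f x y \<partial>M)) / h n) \<longlonglongrightarrow> (\<integral>y. f' x y \<partial>M)"
    by (simp add: int)
qed

lemma isCont_lebesgue_integral:
  fixes f :: "real \<Rightarrow> 'a \<Rightarrow> real"
  assumes [measurable]: "\<And>x. f x \<in> borel_measurable M"
    and C: "AE y in M. isCont (\<lambda>x. f x y) a"
    and B: "integrable M B" "\<And>x y. \<bar>f x y\<bar> \<le> B y"
  shows "isCont (\<lambda>x. \<integral>y. f x y \<partial>M) a"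
  unfolding isCont_def tendsto_at_iff_sequentially comp_def
proof (intro allI impI)
  fix X :: "nat \<Rightarrow> real" assume X: "\<forall>i. X i \<in> UNIV - {a}" "X \<longlonglongrightarrow> a"
  show "(\<lambda>n. \<integral>y. f (X n) y \<partial>M) \<longlonglongrightarrow> (\<integral>y. f a y \<partial>M)"
  proof (rule integral_dominated_convergence[where w = B])
    show "AE y in M. (\<lambda>n. f (X n) y) \<longlonglongrightarrow> f a y"
      using C by eventually_elim (rule isCont_tendsto_compose[OF _ X(2)])
  qed (use B in auto)
qed

context riesz_exponent
begin

lemma integrable_jump_weight:
  assumes "0 < e"
  shows "integrable lborel (\<lambda>r. w r * indicator {e..} r)"
proof (rule integrableI_nonneg)
  have "(\<integral>\<^sup>+r\<in>{e..}. ennreal (w r) \<partial>lborel) = ennreal (0 - - (e powr (- 1 - \<alpha>)))"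
  proof (rule nn_integral_FTC_atLeast)
    show "((\<lambda>r. - (r powr (- 1 - \<alpha>))) has_real_derivative w r) (at r)" if "e \<le> r" for r
    proof -
      have e: "- 1 - \<alpha> - 1 = - 2 - \<alpha>" by simp
      have "- ((- 1 - \<alpha>) * r powr (- 1 - \<alpha> - 1)) = w r"
        unfolding e jump_weight_def by (subst mult_minus_left[symmetric]) simp
      then show ?thesis
        using DERIV_minus[OF has_real_derivative_powr[of r "- 1 - \<alpha>"]] that assms by (simp del: diff_minus_eq_add)
    qed
    show "((\<lambda>r. - (r powr (- 1 - \<alpha>))) \<longlongrightarrow> 0) at_top"
      using tendsto_minus[OF tendsto_neg_powr[of "- 1 - \<alpha>", OF _ filterlim_ident]] \<alpha> by simp
  qed (auto simp: jump_weight_nonneg)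
  then show "(\<integral>\<^sup>+r. ennreal (w r * indicator {e..} r) \<partial>lborel) < \<infinity>"
    by (simp add: ennreal_mult' jump_weight_nonneg ennreal_indicator)
qed (auto simp: jump_weight_nonneg)

lemma jump_increment_bound:
  fixes f :: "real \<Rightarrow> real"
  assumes "\<And>x. \<bar>f x\<bar> \<le> L"
  shows "\<bar>jump_term \<alpha> e f x r\<bar> \<le> 2 * L * (w r * indicator {e..} r)"
proof -
  have "\<bar>f (x + r) - f (x - r)\<bar> \<le> 2 * L" using assms[of "x + r"] assms[of "x - r"] by linarith
  then show ?thesis using jump_weight_nonneg[of r]
    by (auto simp: abs_mult indicator_def mult.commute[of _ "w r"] intro!: mult_left_mono)
qed

lemma ktrunc_mult_bound: "\<bar>a\<bar> \<le> M \<Longrightarrow> \<bar>a * \<kappa> z\<bar> \<le> M * \<kappa> z"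
  using ktrunc_nonneg[of z] by (auto simp: abs_mult intro!: mult_right_mono)

end

locale riesz_profile = riesz_exponent +
  fixes u :: "real \<Rightarrow> real"
  assumes C1: "C1_bounded u" and u_int: "integrable lborel u"
begin

definition \<phi> :: "real \<Rightarrow> real"
  where "\<phi> x = (LBINT y. u y * rker \<alpha> (x - y))"

lemma u_measurable [measurable]: "u \<in> borel_measurable borel"
  using borel_measurable_integrable[OF u_int] by simp

lemma u_DERIV: "(u has_real_derivative deriv u x) (at x)"
  using C1 unfolding C1_bounded_def C1_differentiable_on_eq
  by (auto simp: DERIV_deriv_iff_real_differentiable)

lemma isCont_deriv: "isCont (deriv u) x"
proof -
  have "continuous_on UNIV (\<lambda>x. vector_derivative u (at x))"
    using C1 unfolding C1_bounded_def C1_differentiable_on_eq by auto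
  moreover have "vector_derivative u (at x) = deriv u x" for x
    using u_DERIV[of x] by (intro vector_derivative_at) (simp add: has_real_derivative_iff_has_vector_derivative)
  ultimately show ?thesis by (simp add: continuous_on_eq_continuous_at)
qed

lemma deriv_measurable [measurable]: "deriv u \<in> borel_measurable borel"
  by (intro borel_measurable_continuous_onI) (simp add: isCont_deriv continuous_at_imp_continuous_on)

lemma u_bounds: obtains M where "0 < M" "\<And>x. \<bar>u x\<bar> \<le> M" "\<And>x. \<bar>deriv u x\<bar> \<le> M"
proof -
  obtain a b where "\<forall>x\<in>range u. norm x \<le> a" "\<forall>x\<in>range (deriv u). norm x \<le> b"
    using C1 unfolding C1_bounded_def bounded_iff by auto
  then show ?thesis
    by (intro that[of "max 1 (max a b)"]) (auto simp: le_max_iff_disj)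
qed

lemma kernel_near_integrable:
  "integrable lborel (\<lambda>y::real. rker \<alpha> y * indicator {-1..1} y)"
proof (rule integrableI_nonneg)
  show "(\<integral>\<^sup>+y. ennreal (rker \<alpha> y * indicator {-1..1} y) \<partial>lborel) < \<infinity>"
    using nn_integral_abs_powr_finite[of "\<alpha> - 1" "-1" 1] \<alpha> by (simp add: ennreal_mult' ennreal_indicator)
qed auto

text \<open>Near the singularity v is replaced by its bound, elsewhere the kernel by 1. A bounded
  integrable function thus has a bounded Riesz potential.\<close>

lemma kernel_split:
  assumes v: "\<bar>v\<bar> \<le> M"
  shows "\<bar>v * rker \<alpha> z\<bar> \<le> M * (rker \<alpha> z * indicator {-1..1} z) + \<bar>v :: real\<bar>"
proof (cases "\<bar>z\<bar> \<le> 1")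
  case True
  then show ?thesis using v mult_right_mono[OF v, of "rker \<alpha> z"]
    by (auto simp: abs_mult indicator_def abs_le_iff)
next
  case False
  then have "rker \<alpha> z \<le> 1 powr (\<alpha> - 1)" using \<alpha> by (intro powr_mono2') auto
  then have "\<bar>v\<bar> * rker \<alpha> z \<le> \<bar>v\<bar> * 1" by (intro mult_left_mono) auto
  moreover have "z \<notin> {-1..1}" using False by auto
  ultimately show ?thesis by (simp add: abs_mult)
qed

lemma integrable_riesz:
  assumes [measurable]: "v \<in> borel_measurable borel" and v: "\<And>y. \<bar>v y\<bar> \<le> M" "integrable lborel v"
  shows "integrable lborel (\<lambda>y. v y * rker \<alpha> (x - y))"
proof (rule Bochner_Integration.integrable_bound)
  have "integrable lborel (\<lambda>y. rker \<alpha> (x + -1 * y) * indicator {-1..1} (x + -1 * y) :: real)"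
    by (rule lborel_integrable_real_affine[OF kernel_near_integrable]) simp
  then show "integrable lborel (\<lambda>y. M * (rker \<alpha> (x + -1 * y) * indicator {-1..1} (x + -1 * y)) + \<bar>v y\<bar>)"
    using v(2) by auto
  show "AE y in lborel. norm (v y * rker \<alpha> (x - y))
    \<le> norm (M * (rker \<alpha> (x + -1 * y) * indicator {-1..1} (x + -1 * y)) + \<bar>v y\<bar>)"
  proof (rule AE_I2)
    fix y
    show "norm (v y * rker \<alpha> (x - y))
      \<le> norm (M * (rker \<alpha> (x + -1 * y) * indicator {-1..1} (x + -1 * y)) + \<bar>v y\<bar>)"
      using order_trans[OF kernel_split[OF v(1), of y "x - y"] abs_ge_self] by simp
  qed
qed simp

lemma riesz_bounded:
  assumes [measurable]: "v \<in> borel_measurable borel" and v: "\<And>y. \<bar>v y\<bar> \<le> M" "integrable lborel v"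
  shows "\<bar>LBINT y. v y * rker \<alpha> (x - y)\<bar> \<le>
    M * (LBINT y. rker \<alpha> y * indicator {-1..1} y) + (LBINT y. \<bar>v y\<bar>)"
proof -
  have i: "integrable lborel (\<lambda>y. rker \<alpha> (x + -1 * y) * indicator {-1..1} (x + -1 * y) :: real)"
    by (rule lborel_integrable_real_affine[OF kernel_near_integrable]) simp
  have "\<bar>LBINT y. v y * rker \<alpha> (x - y)\<bar>
    \<le> (LBINT y. M * (rker \<alpha> (x + -1 * y) * indicator {-1..1} (x + -1 * y)) + \<bar>v y\<bar>)"
  proof (rule order_trans[OF integral_abs_bound integral_mono])
    show "\<bar>v y * rker \<alpha> (x - y)\<bar> \<le> M * (rker \<alpha> (x + -1 * y) * indicator {-1..1} (x + -1 * y)) + \<bar>v y\<bar>" for y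
      using kernel_split[OF v(1), of y "x - y"] by simp
  qed (use integrable_riesz[OF assms] i v(2) in auto)
  also have "\<dots> = M * (LBINT y. rker \<alpha> (x + -1 * y) * indicator {-1..1} (x + -1 * y)) + (LBINT y. \<bar>v y\<bar>)"
    using i v(2) by simp
  also have "(LBINT y. rker \<alpha> (x + -1 * y) * indicator {-1..1} (x + -1 * y)) = (LBINT y. rker \<alpha> y * indicator {-1..1} y)"
    by (subst (2) lborel_integral_real_affine[where c = "-1" and t = x]) auto
  finally show ?thesis .
qed

lemma \<phi>_bounded: obtains L where "0 < L" "\<And>x. \<bar>\<phi> x\<bar> \<le> L"
proof -
  obtain M where M: "0 < M" "\<And>x. \<bar>u x\<bar> \<le> M" using u_bounds by metis
  let ?L = "M * (LBINT y. rker \<alpha> y * indicator {-1..1} y) + (LBINT y. \<bar>u y\<bar>)"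
  have "\<bar>\<phi> x\<bar> \<le> ?L" for x
    unfolding \<phi>_def by (rule riesz_bounded[OF _ M(2) u_int]) simp
  then show ?thesis by (intro that[of "max 1 ?L"]) (auto simp: le_max_iff_disj)
qed

text \<open>Translates of the singular kernel have no common integrable majorant, so its near part
  is written with the shift on u, which is continuous and bounded. In the far part the kernel is at
  most 1 and \<open>\<bar>u\<bar>\<close> dominates; the cutoff is discontinuous at x = a only for
  the two values y = a + 1 and y = a - 1, a null set.\<close>

lemma isCont_\<phi>: "isCont \<phi> a"
proof -
  obtain M where M: "0 < M" "\<And>x. \<bar>u x\<bar> \<le> M" using u_bounds by metis
  let ?near = "\<lambda>x y. u (x - y) * (rker \<alpha> y * indicator {-1..1} y)"
  let ?far = "\<lambda>x y. u y * (rker \<alpha> (x - y) * indicator (- {-1..1}) (x - y))"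
  have far_le: "\<bar>?far x y\<bar> \<le> \<bar>u y\<bar>" for x y
  proof (cases "\<bar>x - y\<bar> \<le> 1")
    case False
    then have "rker \<alpha> (x - y) \<le> 1 powr (\<alpha> - 1)" using \<alpha> by (intro powr_mono2') auto
    then have "\<bar>u y\<bar> * rker \<alpha> (x - y) \<le> \<bar>u y\<bar> * 1" by (intro mult_left_mono) auto
    then show ?thesis by (auto simp: abs_mult indicator_def)
  qed (auto simp: abs_le_iff)
  have far_int: "integrable lborel (?far x)" for x
    by (rule Bochner_Integration.integrable_bound[OF u_int]) (use far_le in auto)
  have near_int: "integrable lborel (?near x)" for x
    by (rule Bochner_Integration.integrable_bound[where f = "\<lambda>y. M * (rker \<alpha> y * indicator {-1..1} y)"])
       (use kernel_near_integrable M in \<open>auto simp: abs_mult intro!: mult_right_mono\<close>)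
  have "\<phi> = (\<lambda>x. (LBINT y. ?near x y) + (LBINT y. ?far x y))"
  proof
    fix x
    have i: "integrable lborel (\<lambda>y. ?near x (x + -1 * y))"
      by (rule lborel_integrable_real_affine[OF near_int]) simp
    have "\<phi> x = (LBINT y. ?near x (x + -1 * y) + ?far x y)"
      unfolding \<phi>_def by (intro Bochner_Integration.integral_cong) (auto simp: indicator_def)
    also have "\<dots> = (LBINT y. ?near x (x + -1 * y)) + (LBINT y. ?far x y)"
      by (rule Bochner_Integration.integral_add[OF i far_int])
    also have "(LBINT y. ?near x (x + -1 * y)) = (LBINT y. ?near x y)"
      by (subst (2) lborel_integral_real_affine[where c = "-1" and t = x]) auto
    finally show "\<phi> x = (LBINT y. ?near x y) + (LBINT y. ?far x y)" .
  qed
  moreover have "isCont (\<lambda>x. LBINT y. ?near x y) a"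
  proof (rule isCont_lebesgue_integral[where B = "\<lambda>y. M * (rker \<alpha> y * indicator {-1..1} y)"])
    show "AE y in lborel. isCont (\<lambda>x. ?near x y) a"
      by (intro AE_I2 continuous_intros isCont_o2[OF _ DERIV_isCont[OF u_DERIV]])
  qed (use kernel_near_integrable M in \<open>auto simp: abs_mult intro!: mult_right_mono\<close>)
  moreover have "isCont (\<lambda>x. LBINT y. ?far x y) a"
  proof (rule isCont_lebesgue_integral[where B = "\<lambda>y. \<bar>u y\<bar>"])
    show "AE y in lborel. isCont (\<lambda>x. ?far x y) a"
      using AE_lborel_singleton[of "a + 1"] AE_lborel_singleton[of "a - 1"]
    proof eventually_elim
      fix y assume y: "y \<noteq> a + 1" "y \<noteq> a - 1"
      show "isCont (\<lambda>x. ?far x y) a"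
      proof (cases "\<bar>a - y\<bar> < 1")
        case True
        then have "eventually (\<lambda>x. \<bar>x - y\<bar> < 1) (nhds a)"
          by (intro eventually_nhds_in_open[of "{x. \<bar>x - y\<bar> < 1}", simplified] open_Collect_less continuous_intros) auto
        then have "eventually (\<lambda>x. ?far x y = 0) (nhds a)"
          by eventually_elim (auto simp: indicator_def abs_less_iff)
        then show ?thesis by (subst isCont_cong[where g = "\<lambda>_. 0"]) auto
      next
        case False
        then have "1 < \<bar>a - y\<bar>" using y by linarith
        then have "eventually (\<lambda>x. 1 < \<bar>x - y\<bar>) (nhds a)"
          by (intro eventually_nhds_in_open[of "{x. 1 < \<bar>x - y\<bar>}", simplified] open_Collect_less continuous_intros) auto
        then have "eventually (\<lambda>x. ?far x y = u y * rker \<alpha> (x - y)) (nhds a)"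
          by eventually_elim (auto simp: indicator_def)
        moreover have "isCont (\<lambda>x. u y * rker \<alpha> (x - y)) a"
          using False by (intro continuous_intros) auto
        ultimately show ?thesis by (subst isCont_cong) auto
      qed
    qed
  qed (use far_le u_int in auto)
  ultimately show ?thesis by (simp only: continuous_add)
qed

lemma \<phi>_measurable [measurable]: "\<phi> \<in> borel_measurable borel"
  by (intro borel_measurable_continuous_onI) (simp add: isCont_\<phi> continuous_at_imp_continuous_on)

section \<open>The truncated identity for the potential, and its derivative\<close>

abbreviation window :: "(real \<Rightarrow> real) \<Rightarrow> real \<Rightarrow> real \<Rightarrow> real"
  where "window f x r \<equiv> LBINT s. f s * indicator {x - r..x + r} s"

text \<open>In the identity of extended reals the left-hand side is finite, hence so is each summand
  on the right. Integrability over r >= e is a consequence of the identity, not a separate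
  estimate.\<close>

lemma riesz_identity_nonneg:
  assumes [measurable]: "v \<in> borel_measurable borel"
    and v: "\<And>y. 0 \<le> v y" "\<And>y. v y \<le> M" "integrable lborel v" and e: "0 < e"
  defines "R \<equiv> \<lambda>s. LBINT y. v y * rker \<alpha> (s - y)"
  shows "integrable lborel (\<lambda>r. w r * window R x r * indicator {e..} r)" (is "integrable _ ?g")
    and "\<mu> e * R x =
      (LBINT r. w r * window R x r * indicator {e..} r)
      + (LBINT y. v y * (\<kappa> ((x - y) / e) / e))" (is ?eq)
    and "integrable lborel (\<lambda>y. v y * (\<kappa> ((x - y) / e) / e))" (is ?int)
    and "integrable lborel (\<lambda>s. R s * indicator {a..b} s)" (is ?int2)
proof -
  have vM: "\<bar>v y\<bar> \<le> M" for y using v by simp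
  have [measurable]: "R \<in> borel_measurable borel" unfolding R_def by measurable
  have R: "0 \<le> R s" for s unfolding R_def using v by (intro Bochner_Integration.integral_nonneg) auto
  have iR: "integrable lborel (\<lambda>s. R s * indicator {a..b} s)" for a b
  proof (rule Bochner_Integration.integrable_bound)
    let ?L = "M * (LBINT y. rker \<alpha> y * indicator {-1..1} y) + (LBINT y. \<bar>v y\<bar>)"
    show "integrable lborel (\<lambda>s. ?L * indicator {a..b} s)"
      by (intro integrable_mult_right integrable_real_indicator) (auto simp: emeasure_lborel_Icc_eq)
    have "\<bar>R s\<bar> \<le> ?L" for s unfolding R_def by (rule riesz_bounded[OF _ vM v(3)]) simp
    then show "AE s in lborel. norm (R s * indicator {a..b} s) \<le> norm (?L * indicator {a..b} s)"
      by (intro AE_I2) (auto simp: indicator_def intro!: order_trans[OF _ abs_ge_self])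
  qed simp
  then show ?int2 .
  have R_nn: "(\<integral>\<^sup>+y. ennreal (v y) * ennreal (rker \<alpha> (s - y)) \<partial>lborel) = ennreal (R s)" for s
    unfolding R_def using v
    by (subst nn_integral_eq_integral[symmetric, OF integrable_riesz[OF _ vM]]) (auto simp: ennreal_mult)
  let ?G = "\<lambda>r. LBINT s. R s * indicator {x - r..x + r} s"
  have [measurable]: "?G \<in> borel_measurable borel" by measurable
  have G: "0 \<le> ?G r" for r using R by (intro Bochner_Integration.integral_nonneg) auto
  have G_nn: "(\<integral>\<^sup>+s\<in>{x - r..x + r}. ennreal (R s) \<partial>lborel) = ennreal (?G r)" for r
    using R by (subst nn_integral_eq_integral[symmetric, OF iR]) (auto simp: ennreal_mult ennreal_indicator)
  have "integrable lborel (\<lambda>y. \<kappa> ((x / e) + (- 1 / e) * y))"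
    using e by (intro lborel_integrable_real_affine integrable_ktrunc) auto
  then have ik: "integrable lborel (\<lambda>y. \<kappa> ((x - y) / e))" by (simp add: diff_divide_distrib)
  show ic: ?int
  proof (rule Bochner_Integration.integrable_bound)
    show "integrable lborel (\<lambda>y. M * (\<kappa> ((x - y) / e) / e))" using ik by simp
    show "AE y in lborel. norm (v y * (\<kappa> ((x - y) / e) / e)) \<le> norm (M * (\<kappa> ((x - y) / e) / e))"
    proof (rule AE_I2)
      fix y
      have "0 \<le> M" using v(1)[of y] v(2)[of y] by linarith
      then show "norm (v y * (\<kappa> ((x - y) / e) / e)) \<le> norm (M * (\<kappa> ((x - y) / e) / e))"
        using v vM by (auto simp: abs_mult intro!: divide_right_mono mult_right_mono)
    qed
  qed simp
  have ic0: "0 \<le> v y * (\<kappa> ((x - y) / e) / e)" for y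
    using v e ktrunc_nonneg by simp
  have c_nn: "(\<integral>\<^sup>+y. ennreal (v y) * ennreal (\<kappa> ((x - y) / e) / e) \<partial>lborel) = ennreal (LBINT y. v y * (\<kappa> ((x - y) / e) / e))"
    using ic0 v e ktrunc_nonneg
    by (subst nn_integral_eq_integral[symmetric, OF ic])
      (auto simp: ennreal_mult[symmetric] divide_nonneg_pos simp del: times_divide_eq_right)
  have g0: "0 \<le> ?g r" for r using G jump_weight_nonneg by simp
  have "ennreal (\<mu> e) * ennreal (R x) = (\<integral>\<^sup>+r\<in>{e..}. ennreal (w r) * ennreal (?G r) \<partial>lborel)
    + ennreal (LBINT y. v y * (\<kappa> ((x - y) / e) / e))"
    using riesz_kernel_convolution_identity[OF e, of "\<lambda>y. ennreal (v y)" x]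
    unfolding R_nn c_nn G_nn by simp
  also have "(\<integral>\<^sup>+r\<in>{e..}. ennreal (w r) * ennreal (?G r) \<partial>lborel) = (\<integral>\<^sup>+r. ennreal (?g r) \<partial>lborel)"
    using G jump_weight_nonneg by (simp add: ennreal_mult ennreal_indicator)
  finally have eq: "ennreal (\<mu> e * R x) = (\<integral>\<^sup>+r. ennreal (?g r) \<partial>lborel) + ennreal (LBINT y. v y * (\<kappa> ((x - y) / e) / e))"
    using R jump_mass_pos[OF e] by (simp add: ennreal_mult)
  have "(\<integral>\<^sup>+r. ennreal (?g r) \<partial>lborel) < \<infinity>"
  proof -
    have "(\<integral>\<^sup>+r. ennreal (?g r) \<partial>lborel) \<le> ennreal (\<mu> e * R x)"
      unfolding eq by simp
    also have "\<dots> < \<infinity>" by simp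
    finally show ?thesis .
  qed
  then show ig: "integrable lborel ?g" using g0 by (intro integrableI_nonneg) auto
  have "0 \<le> (LBINT r. ?g r)" using g0 by (intro Bochner_Integration.integral_nonneg) auto
  moreover have "0 \<le> (LBINT y. v y * (\<kappa> ((x - y) / e) / e))" using ic0 by (intro Bochner_Integration.integral_nonneg) auto
  ultimately show ?eq
    using eq R jump_mass_pos[OF e] unfolding nn_integral_eq_integral[OF ig AE_I2[OF g0]]
    by (simp add: ennreal_plus[symmetric] del: ennreal_plus)
qed

lemma \<phi>_identity:
  assumes e: "0 < e"
  shows "integrable lborel (\<lambda>r. w r * window \<phi> x r * indicator {e..} r)"
    and "\<mu> e * \<phi> x =
      (LBINT r. w r * window \<phi> x r * indicator {e..} r)
      + (LBINT z. u (x - e * z) * \<kappa> z)"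
proof -
  obtain M where M: "0 < M" "\<And>x. \<bar>u x\<bar> \<le> M" using u_bounds by metis
  \<comment> \<open>Positive and negative part of u, indexed by a Boolean so that the nonnegative
    case is invoked once for both.\<close>
  define v where "v = (\<lambda>b y. if b then max (u y) 0 else max (- u y) 0)"
  have [measurable]: "v b \<in> borel_measurable borel" for b unfolding v_def by (cases b) auto
  have v: "0 \<le> v b y" "v b y \<le> M" "integrable lborel (v b)" for b y
    using M(1) M(2)[of y] u_int by (cases b; auto simp: v_def abs_le_iff)+
  have vM: "\<bar>v b y\<bar> \<le> M" for b y using v[of b] by simp
  have u: "u y = v True y - v False y" for y by (auto simp: v_def)
  define R where "R = (\<lambda>b s. LBINT y. v b y * rker \<alpha> (s - y))"
  have \<phi>: "\<phi> s = R True s - R False s" for s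
    unfolding \<phi>_def R_def u left_diff_distrib
    by (intro Bochner_Integration.integral_diff integrable_riesz[OF _ vM v(3)]) auto
  define g where "g = (\<lambda>b r. w r * window (R b) x r * indicator {e..} r)"
  have ig: "integrable lborel (g b)" for b
    unfolding g_def R_def by (rule riesz_identity_nonneg(1)[OF _ v e]) simp
  have id: "\<mu> e * R b x = (LBINT r. g b r) + (LBINT y. v b y * (\<kappa> ((x - y) / e) / e))" for b
    unfolding g_def R_def by (rule riesz_identity_nonneg(2)[OF _ v e]) simp
  have ic: "integrable lborel (\<lambda>y. v b y * (\<kappa> ((x - y) / e) / e))" for b
    by (rule riesz_identity_nonneg(3)[OF _ v e]) simp
  have iR: "integrable lborel (\<lambda>s. R b s * indicator {c..d} s)" for b c d
    unfolding R_def by (rule riesz_identity_nonneg(4)[OF _ v e]) simp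
  have "(LBINT s. \<phi> s * indicator {c..d} s) = (LBINT s. R True s * indicator {c..d} s) - (LBINT s. R False s * indicator {c..d} s)" for c d
    unfolding \<phi> left_diff_distrib by (rule Bochner_Integration.integral_diff[OF iR iR])
  then have eq: "(\<lambda>r. w r * window \<phi> x r * indicator {e..} r) = (\<lambda>r. g True r - g False r)"
    unfolding g_def by (simp only: right_diff_distrib left_diff_distrib)
  show "integrable lborel (\<lambda>r. w r * window \<phi> x r * indicator {e..} r)"
    unfolding eq using ig by auto
  have "\<mu> e * \<phi> x = (\<mu> e * R True x) - (\<mu> e * R False x)"
    by (simp add: \<phi> right_diff_distrib)
  also have "\<dots> = (LBINT r. g True r - g False r) + (LBINT y. v True y * (\<kappa> ((x - y) / e) / e) - v False y * (\<kappa> ((x - y) / e) / e))"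
    unfolding id Bochner_Integration.integral_diff[OF ig ig] Bochner_Integration.integral_diff[OF ic ic] by simp
  also have "(\<lambda>y. v True y * (\<kappa> ((x - y) / e) / e) - v False y * (\<kappa> ((x - y) / e) / e)) = (\<lambda>y. u y * (\<kappa> ((x - y) / e) / e))"
    by (simp only: u left_diff_distrib)
  also have "(LBINT y. u y * (\<kappa> ((x - y) / e) / e)) = (LBINT z. u (x - e * z) * \<kappa> z)"
    using e by (subst lborel_integral_real_affine[where c = "- e" and t = x]) auto
  finally show "\<mu> e * \<phi> x =
      (LBINT r. w r * window \<phi> x r * indicator {e..} r)
      + (LBINT z. u (x - e * z) * \<kappa> z)"
    unfolding eq .
qed

text \<open>Differentiability is bootstrapped from continuity. In \<open>\<phi>_identity\<close> the
  variable x enters through window integrals of \<phi>, whose derivatives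
  \<open>\<phi> (x + r) - \<phi> (x - r)\<close> are bounded, and through u, which is C^1. The Riesz
  kernel, whose derivative is not locally integrable, is never differentiated.\<close>

lemma \<phi>_deriv:
  assumes e: "0 < e"
  shows "(\<phi> has_real_derivative ((LBINT r. jump_term \<alpha> e \<phi> x r)
      + (LBINT z. deriv u (x - e * z) * \<kappa> z)) / \<mu> e) (at x)"
proof -
  obtain M where M: "0 < M" "\<And>x. \<bar>u x\<bar> \<le> M" "\<And>x. \<bar>deriv u x\<bar> \<le> M" using u_bounds by metis
  obtain L where L: "0 < L" "\<And>x. \<bar>\<phi> x\<bar> \<le> L" using \<phi>_bounded by metis
  have "\<exists>F. \<forall>x. - \<infinity> < ereal x \<longrightarrow> ereal x < \<infinity> \<longrightarrow> (F has_vector_derivative \<phi> x) (at x)"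
    by (rule einterval_antiderivative) (simp_all add: isCont_\<phi>)
  then obtain F where F: "\<And>x. (F has_real_derivative \<phi> x) (at x)"
    unfolding has_real_derivative_iff_has_vector_derivative by auto
  have [measurable]: "F \<in> borel_measurable borel"
    by (intro borel_measurable_continuous_onI continuous_at_imp_continuous_on ballI DERIV_isCont[OF F])
  have inner: "window \<phi> x r = F (x + r) - F (x - r)" if "0 \<le> r" for x r
  proof -
    have "(LBINT s. indicator {x - r..x + r} s *\<^sub>R \<phi> s) = F (x + r) - F (x - r)"
    proof (rule integral_FTC_atLeastAtMost)
      show "(F has_vector_derivative \<phi> s) (at s within {x - r..x + r})" for s
        using F[of s] by (simp add: has_real_derivative_iff_has_vector_derivative has_vector_derivative_at_within)
      show "continuous_on {x - r..x + r} \<phi>"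
        by (intro continuous_at_imp_continuous_on ballI isCont_\<phi>)
    qed (use that in simp)
    then show ?thesis by (simp only: real_scaleR_def mult.commute)
  qed
  have eq: "w r * window \<phi> x r * indicator {e..} r
    = jump_term \<alpha> e F x r" for x r
    using e by (cases "e \<le> r") (auto simp: inner)
  have \<phi>_eq: "\<phi> = (\<lambda>x. ((LBINT r. jump_term \<alpha> e F x r)
      + (LBINT z. u (x - e * z) * \<kappa> z)) / \<mu> e)"
    using \<phi>_identity(2)[OF e, unfolded eq] jump_mass_pos[OF e]
    by (intro ext) (simp add: eq_divide_eq mult.commute[of _ "\<mu> e"])
  have "((\<lambda>x. LBINT r. jump_term \<alpha> e F x r) has_real_derivative
    (LBINT r. jump_term \<alpha> e \<phi> x r)) (at x)"
  proof (rule DERIV_lebesgue_integral[where B = "\<lambda>r. 2 * L * (w r * indicator {e..} r)"])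
    show "integrable lborel (\<lambda>r. jump_term \<alpha> e F x r)" for x
      using \<phi>_identity(1)[OF e, of x] by (simp only: eq)
    show "((\<lambda>x. jump_term \<alpha> e F x r) has_real_derivative
      jump_term \<alpha> e \<phi> x r) (at x)" for x r
    proof -
      have "((\<lambda>x. F (x + r)) has_real_derivative \<phi> (x + r) * 1) (at x)" "((\<lambda>x. F (x - r)) has_real_derivative \<phi> (x - r) * 1) (at x)"
        by (rule DERIV_chain2[OF F]; auto intro!: derivative_eq_intros)+
      from DERIV_cmult_right[OF DERIV_cmult[OF DERIV_diff[OF this]]] show ?thesis by (simp only: mult_1_right)
    qed
    show "\<bar>jump_term \<alpha> e \<phi> x r\<bar> \<le> 2 * L * (w r * indicator {e..} r)" for x r
      by (rule jump_increment_bound[OF L(2)])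
  qed (use integrable_jump_weight[OF e] in auto)
  moreover have "((\<lambda>x. LBINT z. u (x - e * z) * \<kappa> z) has_real_derivative
    (LBINT z. deriv u (x - e * z) * \<kappa> z)) (at x)"
  proof (rule DERIV_lebesgue_integral[where B = "\<lambda>z. M * \<kappa> z"])
    show "integrable lborel (\<lambda>z. u (x - e * z) * \<kappa> z)" for x
      by (rule Bochner_Integration.integrable_bound[where f = "\<lambda>z. M * \<kappa> z"])
        (use M(2) integrable_ktrunc in \<open>auto intro!: order_trans[OF ktrunc_mult_bound[OF M(2)]]\<close>)
    show "((\<lambda>x. u (x - e * z) * \<kappa> z) has_real_derivative deriv u (x - e * z) * \<kappa> z) (at x)" for x z
    proof -
      have "((\<lambda>x. u (x - e * z)) has_real_derivative deriv u (x - e * z) * 1) (at x)"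
        by (rule DERIV_chain2[OF u_DERIV]) (auto intro!: derivative_eq_intros)
      from DERIV_cmult_right[OF this] show ?thesis by (simp only: mult_1_right)
    qed
  qed (use M integrable_ktrunc in \<open>auto intro!: ktrunc_mult_bound\<close>)
  ultimately show ?thesis
    by (subst \<phi>_eq) (intro DERIV_cdivide DERIV_add)
qed

lemma \<phi>_DERIV: "(\<phi> has_real_derivative deriv \<phi> x) (at x)"
  using \<phi>_deriv[OF zero_less_one, of x] unfolding DERIV_imp_deriv[OF \<phi>_deriv[OF zero_less_one, of x]] .

text \<open>As \<open>\<mu> e\<close> is the integral of 2 r times the weight, the right-hand side
  is the truncated operator of the overview. The left-hand side tends to \<open>deriv u x\<close>
  times the integral of \<kappa> as e tends to 0.\<close>

lemma deriv_\<phi>_identity: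
  assumes "0 < e"
  shows "(LBINT z. deriv u (x - e * z) * \<kappa> z) =
    \<mu> e * deriv \<phi> x - (LBINT r. jump_term \<alpha> e \<phi> x r)"
  unfolding DERIV_imp_deriv[OF \<phi>_deriv[OF assms]] using jump_mass_pos[OF assms] by simp

lemma isCont_deriv_\<phi>: "isCont (deriv \<phi>) a"
proof -
  obtain M where M: "0 < M" "\<And>x. \<bar>deriv u x\<bar> \<le> M" using u_bounds by metis
  obtain L where L: "0 < L" "\<And>x. \<bar>\<phi> x\<bar> \<le> L" using \<phi>_bounded by metis
  \<comment> \<open>The derivative does not depend on the scale, so one fixed value of e suffices
    for its regularity.\<close>
  have eq: "deriv \<phi> = (\<lambda>x. ((LBINT r. jump_term \<alpha> 1 \<phi> x r)
      + (LBINT z. deriv u (x - 1 * z) * \<kappa> z)) / \<mu> 1)"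
    by (intro ext DERIV_imp_deriv \<phi>_deriv) simp
  have i1: "isCont (\<lambda>x. LBINT r. jump_term \<alpha> 1 \<phi> x r) a"
  proof (rule isCont_lebesgue_integral[where B = "\<lambda>r. 2 * L * (w r * indicator {1..} r)"])
    show "AE r in lborel. isCont (\<lambda>x. jump_term \<alpha> 1 \<phi> x r) a"
      by (intro AE_I2 isCont_mult isCont_diff isCont_o2[OF _ isCont_\<phi>] isCont_add continuous_const continuous_ident)
    show "\<bar>jump_term \<alpha> 1 \<phi> x r\<bar> \<le> 2 * L * (w r * indicator {1..} r)" for x r
      by (rule jump_increment_bound[OF L(2)])
  qed (use integrable_jump_weight[of 1] in auto)
  have i2: "isCont (\<lambda>x. LBINT z. deriv u (x - 1 * z) * \<kappa> z) a"
  proof (rule isCont_lebesgue_integral[where B = "\<lambda>z. M * \<kappa> z"])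
    show "AE z in lborel. isCont (\<lambda>x. deriv u (x - 1 * z) * \<kappa> z) a"
      by (intro AE_I2 isCont_mult isCont_diff isCont_o2[OF _ isCont_deriv] continuous_const continuous_ident)
  qed (use M integrable_ktrunc in \<open>auto intro!: ktrunc_mult_bound\<close>)
  show ?thesis
    unfolding eq using jump_mass_pos[of 1] by (intro isCont_divide isCont_add i1 i2) auto
qed

lemma deriv_\<phi>_bounded: obtains L where "0 < L" "\<And>x. \<bar>deriv \<phi> x\<bar> \<le> L"
proof -
  obtain M where M: "0 < M" "\<And>x. \<bar>deriv u x\<bar> \<le> M" using u_bounds by metis
  obtain L where L: "0 < L" "\<And>x. \<bar>\<phi> x\<bar> \<le> L" using \<phi>_bounded by metis
  let ?B = "((LBINT r. 2 * L * (w r * indicator {1..} r)) + (LBINT z. M * \<kappa> z)) / \<mu> 1"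
  have "\<bar>deriv \<phi> x\<bar> \<le> ?B" for x
  proof -
    let ?I = "LBINT r. jump_term \<alpha> 1 \<phi> x r"
    let ?J = "LBINT z. deriv u (x - 1 * z) * \<kappa> z"
    have "\<bar>?I\<bar> \<le> (LBINT r. 2 * L * (w r * indicator {1..} r))"
      by (rule order_trans[OF integral_abs_bound integral_mono'])
        (use integrable_jump_weight[of 1] L jump_weight_nonneg in
          \<open>auto intro!: jump_increment_bound[OF L(2)] simp del: abs_mult\<close>)
    moreover have "\<bar>?J\<bar> \<le> (LBINT z. M * \<kappa> z)"
      by (rule order_trans[OF integral_abs_bound integral_mono'])
        (use M integrable_ktrunc ktrunc_nonneg in \<open>auto intro!: ktrunc_mult_bound\<close>)
    ultimately have "\<bar>?I + ?J\<bar> / \<mu> 1 \<le> ?B"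
      using jump_mass_pos[of 1] by (intro divide_right_mono) linarith+
    then show ?thesis
      using DERIV_imp_deriv[OF \<phi>_deriv[of 1 x]] jump_mass_pos[of 1] by (simp add: abs_divide)
  qed
  then show ?thesis by (intro that[of "max 1 ?B"]) (auto simp: le_max_iff_disj)
qed

end

section \<open>A lower bound for the weighted form\<close>

lemma ennreal_integral_le_nn_integral:
  fixes f :: "'a \<Rightarrow> real"
  assumes "integrable M f"
  shows "ennreal (\<integral>x. f x \<partial>M) \<le> (\<integral>\<^sup>+x. ennreal (f x) \<partial>M)"
proof -
  have i: "integrable M (\<lambda>x. max 0 (f x))" using assms by auto
  have "ennreal (\<integral>x. f x \<partial>M) \<le> ennreal (\<integral>x. max 0 (f x) \<partial>M)"
    using assms i by (intro ennreal_leI integral_mono) auto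
  also have "\<dots> = (\<integral>\<^sup>+x. ennreal (f x) \<partial>M)"
    by (subst nn_integral_eq_integral[symmetric, OF i]) (auto simp: max_def ennreal_neg intro!: nn_integral_cong)
  finally show ?thesis .
qed

text \<open>The expansion of (a t - b s)^2 / (s t). With s and t the values of the test function at
  the two points, this is the ground state substitution.\<close>

lemma am_gm_weighted:
  fixes a b s t :: real
  assumes "0 < s" "0 < t"
  shows "a * b \<le> (a\<^sup>2 * (t / s) + b\<^sup>2 * (s / t)) / 2"
proof -
  have "0 \<le> (a * t - b * s)\<^sup>2 / (s * t)" using assms by simp
  also have "\<dots> = a\<^sup>2 * (t / s) + b\<^sup>2 * (s / t) - 2 * a * b"
    using assms by (simp add: power2_eq_square field_simps)
  finally show ?thesis by simp
qed

lemma (in riesz_exponent) ktrunc_mass_bounds: "0 \<le> ktrunc_mass \<alpha> X" "ktrunc_mass \<alpha> X \<le> (LBINT z. \<kappa> z)"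
proof -
  have k: "0 \<le> \<kappa> z" for z by (rule ktrunc_nonneg)
  show "0 \<le> ktrunc_mass \<alpha> X"
    unfolding ktrunc_mass_def using k by (intro Bochner_Integration.integral_nonneg) auto
  show "ktrunc_mass \<alpha> X \<le> (LBINT z. \<kappa> z)"
    unfolding ktrunc_mass_def
    by (intro integral_mono integrable_real_mult_indicator integrable_ktrunc) (auto simp: indicator_def k)
qed

lemma measurable_ktrunc_mass [measurable]: "ktrunc_mass \<alpha> \<in> borel_measurable borel"
  unfolding ktrunc_mass_def[abs_def] by measurable

text \<open>
  With the odd power \<open>\<eta>\<close> of order \<open>\<delta> / 2\<close>, this is
  \<open>x powr (\<alpha> - \<delta>) * (\<eta> (x + r) - \<eta> (x - r)) - (\<theta> (x + r) - \<theta> (x - r))\<close> for the even extension \<open>\<theta>\<close> of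
  \<open>x powr (\<alpha> - \<delta>) * \<eta> x\<close>.
\<close>

definition jump_kernel :: "real \<Rightarrow> real \<Rightarrow> real \<Rightarrow> real \<Rightarrow> real"
  where "jump_kernel \<alpha> \<delta> r x = x powr (\<alpha> - \<delta>) * (odd_powr (\<delta> / 2) (x + r) - odd_powr (\<delta> / 2) (x - r))
    + (\<bar>x - r\<bar> powr (\<alpha> - \<delta> / 2) - \<bar>x + r\<bar> powr (\<alpha> - \<delta> / 2))"

lemma measurable_jump_kernel [measurable (raw)]:
  assumes [measurable]: "f \<in> borel_measurable M" "h \<in> borel_measurable M"
  shows "(\<lambda>x. jump_kernel \<alpha> \<delta> (f x) (h x)) \<in> borel_measurable M"
  unfolding jump_kernel_def by measurable

text \<open>The test function of order \<delta> / 2 is a strict supersolution at x: the total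
  coefficient produced by AM-GM stays below the local one, with the \<open>C\<close> term as margin.
  Both sides are still to be multiplied by
  \<open>(\<phi> x)\<^sup>2 * x powr (- (\<delta> / 2))\<close>.\<close>

abbreviation power_supersolution :: "real \<Rightarrow> real \<Rightarrow> real \<Rightarrow> real \<Rightarrow> real \<Rightarrow> bool"
  where "power_supersolution \<alpha> \<delta> C e x \<equiv>
    (\<integral>\<^sup>+r\<in>{e..}. ennreal (jump_weight \<alpha> r * jump_kernel \<alpha> \<delta> r x) \<partial>lborel)
    + ennreal (C * x powr (- \<delta> / 2 - 1) * ktrunc_mass \<alpha> (x / e))
    \<le> ennreal ((\<delta> - \<alpha>) * jump_mass \<alpha> e * x powr (\<alpha> - \<delta> / 2 - 1))"

text \<open>The odd increment in \<open>jump_kernel\<close> is handled by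
  \<open>jump_odd_powr_le\<close>, the even one by \<open>jump_abs_powr_le\<close>; the exponents
  match, so the two bounds simply add.\<close>

lemma (in riesz_exponent) jump_kernel_integral_le:
  assumes \<delta>: "2 * \<alpha> < \<delta>" "\<delta> < 2"
  shows "\<exists>C>0. \<forall>x>0. \<forall>e>0.
    power_supersolution \<alpha> \<delta> C e x"
proof -
  define \<sigma> where "\<sigma> = \<delta> / 2 - \<alpha>"
  have \<sigma>: "0 < \<sigma>" "\<sigma> < 1 - \<alpha>" and \<beta>: "\<alpha> < \<delta> / 2" "\<delta> / 2 < 1" using \<delta> by (auto simp: \<sigma>_def)
  obtain C where C: "0 < C" and K1: "\<And>x e. 0 < x \<Longrightarrow> 0 < e \<Longrightarrow>
    (\<integral>\<^sup>+r\<in>{e..}. ennreal (w r * (odd_powr (\<delta> / 2) (x + r) - odd_powr (\<delta> / 2) (x - r))) \<partial>lborel)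
    + ennreal (C * x powr (\<delta> / 2 - \<alpha> - 1) * ktrunc_mass \<alpha> (x / e)) \<le> ennreal (\<delta> / 2 * \<mu> e * x powr (\<delta> / 2 - 1))"
    using jump_odd_powr_le[OF \<beta>] by blast
  show ?thesis
  proof (intro exI[of _ C] conjI allI impI C)
    fix x e :: real assume x: "0 < x" and e: "0 < e"
    let ?A = "\<lambda>r. ennreal (w r * (odd_powr (\<delta> / 2) (x + r) - odd_powr (\<delta> / 2) (x - r))) * indicator {e..} r"
    let ?B = "\<lambda>r. ennreal (w r * (\<bar>x - r\<bar> powr (- \<sigma>) - \<bar>x + r\<bar> powr (- \<sigma>))) * indicator {e..} r"
    let ?X = "x powr (\<alpha> - \<delta>)"
    have "(\<integral>\<^sup>+r\<in>{e..}. ennreal (w r * jump_kernel \<alpha> \<delta> r x) \<partial>lborel)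
      \<le> (\<integral>\<^sup>+r. ennreal ?X * ?A r + ?B r \<partial>lborel)"
    proof (rule nn_integral_mono)
      fix r
      have "ennreal (w r * jump_kernel \<alpha> \<delta> r x) \<le>
        ennreal (?X * (w r * (odd_powr (\<delta> / 2) (x + r) - odd_powr (\<delta> / 2) (x - r))))
        + ennreal (w r * (\<bar>x - r\<bar> powr (- \<sigma>) - \<bar>x + r\<bar> powr (- \<sigma>)))"
        unfolding jump_kernel_def distrib_left \<sigma>_def
        by (auto simp: ennreal_plus_if mult.left_commute intro!: ennreal_leI)
      then show "ennreal (w r * jump_kernel \<alpha> \<delta> r x) * indicator {e..} r \<le> ennreal ?X * ?A r + ?B r"
        by (auto simp: ennreal_mult' indicator_def)
    qed
    also have "\<dots> = ennreal ?X * (\<integral>\<^sup>+r. ?A r \<partial>lborel) + (\<integral>\<^sup>+r. ?B r \<partial>lborel)"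
      by (simp add: nn_integral_add nn_integral_cmult)
    finally have "(\<integral>\<^sup>+r\<in>{e..}. ennreal (w r * jump_kernel \<alpha> \<delta> r x) \<partial>lborel)
      + ennreal ?X * ennreal (C * x powr (\<delta> / 2 - \<alpha> - 1) * ktrunc_mass \<alpha> (x / e))
      \<le> ennreal ?X * ((\<integral>\<^sup>+r. ?A r \<partial>lborel) + ennreal (C * x powr (\<delta> / 2 - \<alpha> - 1) * ktrunc_mass \<alpha> (x / e))) + (\<integral>\<^sup>+r. ?B r \<partial>lborel)"
      by (simp add: distrib_left add.assoc add.left_commute add_left_mono add.commute)
    also have "\<dots> \<le> ennreal ?X * ennreal (\<delta> / 2 * \<mu> e * x powr (\<delta> / 2 - 1)) + ennreal (\<sigma> * \<mu> e * x powr (- \<sigma> - 1))"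
      by (intro add_mono mult_left_mono K1 x e jump_abs_powr_le[OF \<sigma>]) simp
    also have "\<dots> = ennreal (\<delta> / 2 * \<mu> e * (?X * x powr (\<delta> / 2 - 1)) + \<sigma> * \<mu> e * x powr (- \<sigma> - 1))"
      using \<delta> \<alpha> \<sigma> jump_mass_pos[OF e] by (simp add: ennreal_mult'[symmetric] ennreal_plus[symmetric] mult_ac del: ennreal_plus)
    also have "?X * x powr (\<delta> / 2 - 1) = x powr (\<alpha> - \<delta> / 2 - 1)"
      using x by (simp add: powr_add[symmetric] field_simps)
    also have "- \<sigma> - 1 = \<alpha> - \<delta> / 2 - 1" by (simp add: \<sigma>_def)
    also have "\<delta> / 2 * \<mu> e * x powr (\<alpha> - \<delta> / 2 - 1) + \<sigma> * \<mu> e * x powr (\<alpha> - \<delta> / 2 - 1)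
      = (\<delta> - \<alpha>) * \<mu> e * x powr (\<alpha> - \<delta> / 2 - 1)"
      unfolding distrib_right[symmetric] by (simp add: \<sigma>_def)
    finally have "(\<integral>\<^sup>+r\<in>{e..}. ennreal (w r * jump_kernel \<alpha> \<delta> r x) \<partial>lborel)
      + ennreal (?X * (C * x powr (\<delta> / 2 - \<alpha> - 1) * ktrunc_mass \<alpha> (x / e))) \<le> \<dots>"
      by (simp only: ennreal_mult'[OF powr_ge_zero])
    moreover have "?X * x powr (\<delta> / 2 - \<alpha> - 1) = x powr (- \<delta> / 2 - 1)"
      using x by (simp add: powr_add[symmetric] field_simps)
    then have "?X * (C * x powr (\<delta> / 2 - \<alpha> - 1) * ktrunc_mass \<alpha> (x / e)) = C * x powr (- \<delta> / 2 - 1) * ktrunc_mass \<alpha> (x / e)"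
      by (metis mult.assoc mult.left_commute)
    ultimately show "power_supersolution \<alpha> \<delta> C e x"
      by (simp only:)
  qed
qed

text \<open>Isolates what the quadratic estimate uses about \<phi>. The function u does not occur
  here and returns only when e tends to 0.\<close>

locale weighted_profile = riesz_exponent +
  fixes \<delta> :: real and \<phi> :: "real \<Rightarrow> real" and L :: real
  assumes \<delta>: "2 * \<alpha> < \<delta>" "\<delta> < 2"
    and odd: "\<And>x. \<phi> (- x) = - \<phi> x"
    and D: "\<And>x. (\<phi> has_real_derivative deriv \<phi> x) (at x)"
    and cont_deriv: "\<And>x. isCont (deriv \<phi>) x"
    and L: "0 < L" "\<And>x. \<bar>\<phi> x\<bar> \<le> L" "\<And>x. \<bar>deriv \<phi> x\<bar> \<le> L"
    and int: "integrable lborel (\<lambda>x. \<bar>\<phi> x\<bar> * x powr (\<alpha> - \<delta>) * indicator {0<..} x)"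
begin

lemma \<phi>_meas [measurable]: "\<phi> \<in> borel_measurable borel"
  by (intro borel_measurable_continuous_onI continuous_at_imp_continuous_on ballI DERIV_isCont[OF D])

lemma deriv_\<phi>_meas [measurable]: "deriv \<phi> \<in> borel_measurable borel"
  by (intro borel_measurable_continuous_onI continuous_at_imp_continuous_on ballI cont_deriv)

lemma \<phi>_0: "\<phi> 0 = 0" using odd[of 0] by simp

lemma \<phi>_lipschitz_0: "\<bar>\<phi> x\<bar> \<le> L * \<bar>x\<bar>"
  using field_differentiable_bound[of UNIV \<phi> "deriv \<phi>" L x 0] D L by (auto simp: \<phi>_0)

definition g :: "real \<Rightarrow> real"
  where "g x = \<phi> x * x powr (\<alpha> - \<delta>) * indicator {0<..} x"

lemma g_meas [measurable]: "g \<in> borel_measurable borel"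
  unfolding g_def[abs_def] by measurable

lemma integrable_g: "integrable lborel g"
  by (rule Bochner_Integration.integrable_bound[OF int]) (auto simp: g_def abs_mult)

lemma integrable_g_mult:
  assumes [measurable]: "h \<in> borel_measurable borel" and h: "\<And>x. \<bar>h x\<bar> \<le> B"
  shows "integrable lborel (\<lambda>x. g x * h x)"
proof (rule Bochner_Integration.integrable_bound)
  show "integrable lborel (\<lambda>x. B * g x)" using integrable_g by simp
  show "AE x in lborel. norm (g x * h x) \<le> norm (B * g x)"
    by (intro AE_I2) (auto simp: abs_mult mult.commute intro!: mult_right_mono order_trans[OF h abs_ge_self])
qed simp

text \<open>p < 3 suffices at 0 because \<phi> vanishes there linearly, and p > 1 suffices at
  infinity because \<phi> is bounded.\<close>

lemma integrable_square_powr: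
  assumes "1 < p" "p < 3"
  shows "integrable lborel (\<lambda>x. (\<phi> x)\<^sup>2 * x powr (- p) * indicator {0<..} x)"
proof (rule integrableI_nonneg)
  let ?a = "\<lambda>x. ennreal (L\<^sup>2) * (ennreal (\<bar>x\<bar> powr (2 - p)) * indicator {0..1} x)"
  let ?b = "\<lambda>x. ennreal (L\<^sup>2) * (ennreal (\<bar>x\<bar> powr (- p)) * indicator {x. 1 \<le> \<bar>x\<bar>} x)"
  have "(\<integral>\<^sup>+x. ennreal ((\<phi> x)\<^sup>2 * x powr (- p) * indicator {0<..} x) \<partial>lborel) \<le> (\<integral>\<^sup>+x. ?a x + ?b x \<partial>lborel)"
  proof (rule nn_integral_mono)
    fix x :: real
    consider "x \<le> 0" | "0 < x" "x \<le> 1" | "1 < x" by linarith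
    then show "ennreal ((\<phi> x)\<^sup>2 * x powr (- p) * indicator {0<..} x) \<le> ?a x + ?b x"
    proof cases
      case 2
      have "(\<phi> x)\<^sup>2 \<le> (L * x)\<^sup>2" using \<phi>_lipschitz_0[of x] 2 by (intro power2_le_iff_abs_le[THEN iffD2]) (auto simp: L less_imp_le)
      then have "(\<phi> x)\<^sup>2 * x powr (- p) \<le> (L * x)\<^sup>2 * x powr (- p)" by (rule mult_right_mono) simp
      also have "\<dots> = L\<^sup>2 * x powr (2 - p)" using 2 by (simp add: power_mult_distrib powr_diff powr_minus_divide)
      finally have "ennreal ((\<phi> x)\<^sup>2 * x powr (- p) * indicator {0<..} x) \<le> ?a x"
        using 2 by (auto simp: ennreal_mult[symmetric] intro!: ennreal_leI)
      then show ?thesis by (rule add_increasing2[rotated]) simp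
    next
      case 3
      have "(\<phi> x)\<^sup>2 \<le> L\<^sup>2" using L(2)[of x] L(1) by (intro power2_le_iff_abs_le[THEN iffD2]) auto
      then have "(\<phi> x)\<^sup>2 * x powr (- p) \<le> L\<^sup>2 * x powr (- p)" by (rule mult_right_mono) simp
      then have "ennreal ((\<phi> x)\<^sup>2 * x powr (- p) * indicator {0<..} x) \<le> ?b x"
        using 3 by (auto simp: ennreal_mult[symmetric] intro!: ennreal_leI)
      then show ?thesis by (rule add_increasing[rotated]) simp
    qed auto
  qed
  also have "\<dots> = (\<integral>\<^sup>+x. ?a x \<partial>lborel) + (\<integral>\<^sup>+x. ?b x \<partial>lborel)" by (rule nn_integral_add) auto
  also have "\<dots> < \<infinity>"
    using nn_integral_abs_powr_tail[of "- p" 1] nn_integral_abs_powr_finite[of "2 - p" 0 1] assms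
    by (simp add: nn_integral_cmult ennreal_mult_less_top)
  finally show "(\<integral>\<^sup>+x. ennreal ((\<phi> x)\<^sup>2 * x powr (- p) * indicator {0<..} x) \<partial>lborel) < \<infinity>" .
qed auto

text \<open>The function \<open>(\<phi> x)\<^sup>2 * x powr (- \<gamma>) / 2\<close> with \<gamma> =
  \<delta> - \<alpha> in (0, 2) has zero limit at both ends, since \<phi> is O(x) at 0 and bounded;
  so the integral of its derivative is 0.\<close>

lemma integral_g_deriv:
  "(LBINT x. g x * deriv \<phi> x) = (\<delta> - \<alpha>) / 2 * (LBINT x. (\<phi> x)\<^sup>2 * x powr (- (\<delta> - \<alpha> + 1)) * indicator {0<..} x)"
proof -
  define \<gamma> where "\<gamma> = \<delta> - \<alpha>"
  have \<gamma>: "0 < \<gamma>" "\<gamma> < 2" using \<alpha> \<delta> by (auto simp: \<gamma>_def)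
  let ?f = "\<lambda>x. \<phi> x * deriv \<phi> x * x powr (- \<gamma>) - \<gamma> / 2 * ((\<phi> x)\<^sup>2 * x powr (- (\<gamma> + 1)))"
  let ?F = "\<lambda>x. (\<phi> x)\<^sup>2 * x powr (- \<gamma>) / 2"
  have i1: "integrable lborel (\<lambda>x. g x * deriv \<phi> x)" by (rule integrable_g_mult[OF _ L(3)]) simp
  have i2: "integrable lborel (\<lambda>x. (\<phi> x)\<^sup>2 * x powr (- (\<gamma> + 1)) * indicator {0<..} x)"
    using \<gamma> by (intro integrable_square_powr) auto
  have f_eq: "indicator {0<..} x *\<^sub>R ?f x = g x * deriv \<phi> x - \<gamma> / 2 * ((\<phi> x)\<^sup>2 * x powr (- (\<gamma> + 1)) * indicator {0<..} x)" for x
    by (auto simp: g_def \<gamma>_def indicator_def)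
  have "(LBINT x=0..\<infinity>. ?f x) = 0 - 0"
  proof (rule interval_integral_FTC_integrable)
    show "(?F has_vector_derivative ?f x) (at x)" if "0 < ereal x" for x
    proof -
      have x: "0 < x" using that by simp
      have "(?F has_real_derivative (2 * \<phi> x * deriv \<phi> x * x powr (- \<gamma>) + (\<phi> x)\<^sup>2 * (- \<gamma> * x powr (- \<gamma> - 1))) / 2) (at x)"
        using x by (auto intro!: derivative_eq_intros D)
      moreover have "(2 * \<phi> x * deriv \<phi> x * x powr (- \<gamma>) + (\<phi> x)\<^sup>2 * (- \<gamma> * x powr (- \<gamma> - 1))) / 2 = ?f x"
      proof -
        have "- \<gamma> - 1 = - (\<gamma> + 1)" by simp
        then show ?thesis by (simp only:) (simp add: field_simps)
      qed
      ultimately show ?thesis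
        unfolding has_real_derivative_iff_has_vector_derivative[symmetric] by (rule DERIV_cong)
    qed
    show "isCont ?f x" if "0 < ereal x" for x
      using that by (intro continuous_intros cont_deriv DERIV_isCont[OF D]) auto
    show "set_integrable lborel (einterval 0 \<infinity>) ?f"
    proof -
      have e: "einterval 0 \<infinity> = {0<..}" by (auto simp: einterval_def)
      show ?thesis
        unfolding set_integrable_def e f_eq
        by (intro Bochner_Integration.integrable_diff i1 integrable_mult_right i2)
    qed
    have "(?F \<longlongrightarrow> 0) (at_right 0)"
    proof (rule Lim_null_comparison)
      show "\<forall>\<^sub>F x in at_right 0. norm (?F x) \<le> L\<^sup>2 * x powr (2 - \<gamma>)"
        using eventually_at_right_less[of 0]
      proof eventually_elim
        fix x :: real assume x: "0 < x"
        have "(\<phi> x)\<^sup>2 \<le> (L * x)\<^sup>2" using \<phi>_lipschitz_0[of x] x by (intro power2_le_iff_abs_le[THEN iffD2]) (auto simp: L less_imp_le)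
        then have "(\<phi> x)\<^sup>2 * x powr (- \<gamma>) \<le> (L * x)\<^sup>2 * x powr (- \<gamma>)" by (rule mult_right_mono) simp
        also have "\<dots> = L\<^sup>2 * x powr (2 - \<gamma>)" using x by (simp add: power_mult_distrib powr_diff powr_minus_divide)
        finally have "(\<phi> x)\<^sup>2 * x powr (- \<gamma>) \<le> L\<^sup>2 * x powr (2 - \<gamma>)" .
        moreover have "0 \<le> (\<phi> x)\<^sup>2 * x powr (- \<gamma>)" by simp
        moreover have "norm (?F x) = (\<phi> x)\<^sup>2 * x powr (- \<gamma>) / 2" by (simp add: abs_mult)
        ultimately show "norm (?F x) \<le> L\<^sup>2 * x powr (2 - \<gamma>)" by linarith
      qed
      show "((\<lambda>x. L\<^sup>2 * x powr (2 - \<gamma>)) \<longlongrightarrow> 0) (at_right 0)"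
        using \<gamma> by (auto intro!: tendsto_eq_intros eventually_at_right_less[THEN eventually_mono])
    qed
    then show "((?F \<circ> real_of_ereal) \<longlongrightarrow> 0) (at_right 0)"
      by (simp add: zero_ereal_def ereal_tendsto_simps del: ereal_eq_0)
    have "(?F \<longlongrightarrow> 0) at_top"
    proof (rule Lim_null_comparison)
      show "\<forall>\<^sub>F x in at_top. norm (?F x) \<le> L\<^sup>2 * x powr (- \<gamma>)"
      proof (rule always_eventually, rule allI)
        fix x :: real
        have "(\<phi> x)\<^sup>2 \<le> L\<^sup>2" using L(2)[of x] L(1) by (intro power2_le_iff_abs_le[THEN iffD2]) auto
        then have "(\<phi> x)\<^sup>2 * x powr (- \<gamma>) \<le> L\<^sup>2 * x powr (- \<gamma>)" by (rule mult_right_mono) simp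
        moreover have "0 \<le> (\<phi> x)\<^sup>2 * x powr (- \<gamma>)" by simp
        moreover have "norm (?F x) = (\<phi> x)\<^sup>2 * x powr (- \<gamma>) / 2" by (simp add: abs_mult)
        ultimately show "norm (?F x) \<le> L\<^sup>2 * x powr (- \<gamma>)" by linarith
      qed
      show "((\<lambda>x. L\<^sup>2 * x powr (- \<gamma>)) \<longlongrightarrow> 0) at_top"
        using tendsto_mult[OF tendsto_const tendsto_neg_powr[of "- \<gamma>", OF _ filterlim_ident], of "L\<^sup>2"] \<gamma> by simp
    qed
    then show "((?F \<circ> real_of_ereal) \<longlongrightarrow> 0) (at_left \<infinity>)"
      by (simp add: ereal_tendsto_simps)
  qed simp
  then have "(LBINT x. indicator {0<..} x *\<^sub>R ?f x) = 0"
    using interval_integral_to_infinity_eq[of lborel 0 ?f] by (simp add: set_lebesgue_integral_def zero_ereal_def del: ereal_eq_0)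
  then show ?thesis
    unfolding f_eq using i1 i2 by (simp add: \<gamma>_def)
qed

section \<open>The nonlocal part of the form, for one shift r at a time\<close>

definition shift_form :: "real \<Rightarrow> real"
  where "shift_form r = (LBINT x. g x * (\<phi> (x + r) - \<phi> (x - r)))"

text \<open>In the term with \<open>\<phi> (x - r)\<close> the region x > r is translated to the
  half-line and the region x < r is reflected, using oddness. As \<alpha> - \<delta> < 0, all
  products get nonnegative coefficients. The form subtracts \<open>shift_form\<close>, so an upper
  bound by AM-GM goes in the right direction.\<close>

lemma shift_form_eq:
  assumes r: "0 < r"
  defines "E \<equiv> \<lambda>x. (x powr (\<alpha> - \<delta>) - (x + r) powr (\<alpha> - \<delta>)) * (\<phi> x * \<phi> (x + r)) * indicator {0<..} x
    + (r - x) powr (\<alpha> - \<delta>) * (\<phi> x * \<phi> (r - x)) * indicator {0<..<r} x"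
  shows "integrable lborel E" and "shift_form r = (LBINT x. E x)"
proof -
  have [measurable]: "(\<lambda>x. g (c + x)) \<in> borel_measurable borel" for c by measurable
  define a where "a = (\<lambda>x. g x * \<phi> (x + r))"
  define b where "b = (\<lambda>x. g x * \<phi> (x - r))"
  define b1 where "b1 = (\<lambda>x. b (r + 1 * x) * indicator {0<..} x)"
  define b2 where "b2 = (\<lambda>x. b (r + 1 * x) * indicator {..0} x)"
  have [measurable]: "b \<in> borel_measurable borel" unfolding b_def by measurable
  have ia: "integrable lborel a" unfolding a_def by (rule integrable_g_mult[OF _ L(2)]) simp
  have ib: "integrable lborel b" unfolding b_def by (rule integrable_g_mult[OF _ L(2)]) simp
  have ib': "integrable lborel (\<lambda>x. b (r + 1 * x))" by (rule lborel_integrable_real_affine[OF ib]) simp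
  have ib1: "integrable lborel b1" unfolding b1_def by (rule integrable_real_mult_indicator[OF _ ib']) simp
  have ib2: "integrable lborel b2" unfolding b2_def by (rule integrable_real_mult_indicator[OF _ ib']) simp
  have ib2': "integrable lborel (\<lambda>x. b2 (0 + -1 * x))" by (rule lborel_integrable_real_affine[OF ib2]) simp
  have "(LBINT x. b x) = (LBINT x. b (r + 1 * x))"
    by (subst lborel_integral_real_affine[where c = 1 and t = r]) auto
  also have "\<dots> = (LBINT x. b1 x + b2 x)"
    by (intro Bochner_Integration.integral_cong) (auto simp: b1_def b2_def indicator_def)
  also have "\<dots> = (LBINT x. b1 x) + (LBINT x. b2 (0 + -1 * x))"
    using ib1 ib2 lborel_integral_real_affine[of "-1" b2 0] by simp
  finally have ib_eq: "(LBINT x. b x) = \<dots>" .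
  have E_eq: "E x = a x - (b1 x + b2 (0 + -1 * x))" for x
    using r by (cases "x = 0") (auto simp: E_def a_def b_def b1_def b2_def g_def indicator_def odd \<phi>_0 algebra_simps)
  show "integrable lborel E"
    unfolding E_eq[abs_def] by (intro Bochner_Integration.integrable_diff Bochner_Integration.integrable_add ia ib1 ib2')
  have "shift_form r = (LBINT x. a x - b x)"
    unfolding shift_form_def a_def b_def by (simp add: right_diff_distrib)
  also have "\<dots> = (LBINT x. a x) - (LBINT x. b x)"
    by (rule Bochner_Integration.integral_diff[OF ia ib])
  also have "\<dots> = (LBINT x. E x)"
    unfolding ib_eq E_eq[abs_def] by (simp only: Bochner_Integration.integral_diff[OF ia Bochner_Integration.integrable_add[OF ib1 ib2']] Bochner_Integration.integral_add[OF ib1 ib2'])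
  finally show "shift_form r = (LBINT x. E x)" .
qed

text \<open>AM-GM with the weights \<open>x powr (\<delta> / 2)\<close> splits each product into two
  squares. The square at the partner point is moved back to x by the same translation or reflection.
  The coefficients of \<open>(\<phi> x)\<^sup>2\<close> then add up to \<open>jump_kernel\<close>
  times \<open>x powr (- (\<delta> / 2))\<close>.\<close>

lemma shift_form_le:
  assumes r: "0 < r"
  shows "ennreal (2 * shift_form r) \<le>
    (\<integral>\<^sup>+x\<in>{0<..}. ennreal ((\<phi> x)\<^sup>2 * x powr (- (\<delta> / 2)) * jump_kernel \<alpha> \<delta> r x) \<partial>lborel)"
proof -
  let ?\<beta> = "\<delta> / 2" and ?s = "\<alpha> - \<delta>"
  let ?R = "\<lambda>a y. (\<phi> a)\<^sup>2 * (y powr ?\<beta> / a powr ?\<beta>)"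
  have s: "?s < 0" using \<alpha> \<delta> by simp
  let ?d = "\<lambda>x. x powr ?s - (x + r) powr ?s"
  have d: "0 \<le> ?d x" if "0 < x" for x using that r s by (simp add: powr_mono2')
  \<comment> \<open>\<open>?V2\<close> and \<open>?V4\<close> are \<open>U2\<close> and
    \<open>U4\<close> after the change of variables that puts the squared factor at x.\<close>
  let ?V2 = "\<lambda>x. ennreal (((x - r) powr ?s - x powr ?s) * ?R x (x - r)) * indicator {r<..} x"
  let ?V4 = "\<lambda>x. ennreal (x powr ?s * ?R x (r - x)) * indicator {0<..<r} x"
  define U1 where "U1 = (\<lambda>x. ennreal (?d x * ?R x (x + r)) * indicator {0<..} x)"
  define U2 where "U2 = (\<lambda>x. ennreal (?d x * ?R (x + r) x) * indicator {0<..} x)"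
  define U3 where "U3 = (\<lambda>x. ennreal ((r - x) powr ?s * ?R x (r - x)) * indicator {0<..<r} x)"
  define U4 where "U4 = (\<lambda>x. ennreal ((r - x) powr ?s * ?R (r - x) x) * indicator {0<..<r} x)"
  have [measurable]: "U1 \<in> borel_measurable borel" "U2 \<in> borel_measurable borel" "U3 \<in> borel_measurable borel" "U4 \<in> borel_measurable borel"
    unfolding U1_def U2_def U3_def U4_def by measurable
  let ?E1 = "\<lambda>x. ?d x * (\<phi> x * \<phi> (x + r)) * indicator {0<..} x"
  let ?E2 = "\<lambda>x. (r - x) powr ?s * (\<phi> x * \<phi> (r - x)) * indicator {0<..<r} x"
  let ?E = "\<lambda>x. ?E1 x + ?E2 x"
  have E_le: "ennreal (2 * ?E x) \<le> (U1 x + U2 x) + (U3 x + U4 x)" for x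
  proof -
    have "ennreal (2 * ?E1 x) \<le> U1 x + U2 x"
    proof (cases "0 < x")
      case True
      have "?d x * (\<phi> x * \<phi> (x + r)) \<le> ?d x * ((?R x (x + r) + ?R (x + r) x) / 2)"
        using True r by (intro mult_left_mono am_gm_weighted d) auto
      then have "2 * (?d x * (\<phi> x * \<phi> (x + r))) \<le> ?d x * ?R x (x + r) + ?d x * ?R (x + r) x"
        by (simp only: distrib_left times_divide_eq_right) simp
      then show ?thesis
        using True d[OF True] by (simp add: U1_def U2_def ennreal_plus[symmetric] ennreal_leI del: ennreal_plus)
    qed simp
    moreover have "ennreal (2 * ?E2 x) \<le> U3 x + U4 x"
    proof (cases "x \<in> {0<..<r}")
      case True
      have "(r - x) powr ?s * (\<phi> x * \<phi> (r - x)) \<le> (r - x) powr ?s * ((?R x (r - x) + ?R (r - x) x) / 2)"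
        using True r by (intro mult_left_mono am_gm_weighted) auto
      then have "2 * ((r - x) powr ?s * (\<phi> x * \<phi> (r - x))) \<le> (r - x) powr ?s * ?R x (r - x) + (r - x) powr ?s * ?R (r - x) x"
        by (simp only: distrib_left times_divide_eq_right) simp
      then show ?thesis
        using True by (simp add: U3_def U4_def ennreal_plus[symmetric] ennreal_leI del: ennreal_plus)
    qed simp
    ultimately have "ennreal (2 * ?E1 x) + ennreal (2 * ?E2 x)
      \<le> (U1 x + U2 x) + (U3 x + U4 x)" by (rule add_mono)
    moreover have "ennreal (2 * ?E x) \<le> ennreal (2 * ?E1 x) + ennreal (2 * ?E2 x)"
      unfolding distrib_left by (auto simp: ennreal_plus_if intro!: ennreal_leI)
    ultimately show ?thesis by (rule order_trans[rotated])
  qed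
  have "(\<integral>\<^sup>+x. U2 x \<partial>lborel) = (\<integral>\<^sup>+x. ?V2 x \<partial>lborel)"
    by (subst nn_integral_real_affine[where c = 1 and t = "- r"]) (auto simp: U2_def indicator_def intro!: nn_integral_cong)
  moreover have "(\<integral>\<^sup>+x. U4 x \<partial>lborel) = (\<integral>\<^sup>+x. ?V4 x \<partial>lborel)"
    by (subst nn_integral_real_affine[where c = "-1" and t = r]) (auto simp: U4_def indicator_def intro!: nn_integral_cong)
  moreover have "ennreal (2 * shift_form r) \<le> (\<integral>\<^sup>+x. ennreal (2 * ?E x) \<partial>lborel)"
  proof -
    have "ennreal (2 * shift_form r) = ennreal (LBINT x. 2 * ?E x)"
      unfolding shift_form_eq(2)[OF r] by (simp only: integral_mult_right_zero)
    also have "\<dots> \<le> (\<integral>\<^sup>+x. ennreal (2 * ?E x) \<partial>lborel)"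
      by (rule ennreal_integral_le_nn_integral) (rule integrable_mult_right[OF shift_form_eq(1)[OF r]])
    finally show ?thesis .
  qed
  moreover have "\<dots> \<le> (\<integral>\<^sup>+x. (U1 x + U2 x) + (U3 x + U4 x) \<partial>lborel)" by (intro nn_integral_mono E_le)
  moreover have "\<dots> = ((\<integral>\<^sup>+x. U1 x \<partial>lborel) + (\<integral>\<^sup>+x. U2 x \<partial>lborel)) + ((\<integral>\<^sup>+x. U3 x \<partial>lborel) + (\<integral>\<^sup>+x. U4 x \<partial>lborel))"
    by (simp add: nn_integral_add)
  ultimately have le: "ennreal (2 * shift_form r) \<le> ((\<integral>\<^sup>+x. U1 x \<partial>lborel) + (\<integral>\<^sup>+x. ?V2 x \<partial>lborel))
      + ((\<integral>\<^sup>+x. U3 x \<partial>lborel) + (\<integral>\<^sup>+x. ?V4 x \<partial>lborel))"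
    by simp
  also have "\<dots> = (\<integral>\<^sup>+x. (U1 x + ?V2 x) + (U3 x + ?V4 x) \<partial>lborel)"
    by (simp add: nn_integral_add)
  also have "\<dots> = (\<integral>\<^sup>+x\<in>{0<..}. ennreal ((\<phi> x)\<^sup>2 * x powr (- ?\<beta>) * jump_kernel \<alpha> \<delta> r x) \<partial>lborel)"
  proof (rule nn_integral_cong_AE, use AE_lborel_singleton[of r] in eventually_elim)
    fix x assume xr: "x \<noteq> r"
    define G where "G = (\<phi> x)\<^sup>2 * x powr (- ?\<beta>)"
    have G: "0 \<le> G" "(\<phi> x)\<^sup>2 * (t / x powr ?\<beta>) = G * t" for t by (auto simp: G_def powr_minus_divide)
    let ?G1 = "G * (x + r) powr ?\<beta>" and ?G2 = "G * (r - x) powr ?\<beta>" and ?G3 = "G * (x - r) powr ?\<beta>"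
    have pp: "y powr ?s * y powr ?\<beta> = y powr (\<alpha> - ?\<beta>)" for y by (simp add: powr_add[symmetric])
    consider "x \<le> 0" | "0 < x" "x < r" | "r < x" using xr by linarith
    then show "(U1 x + ?V2 x) + (U3 x + ?V4 x)
      = ennreal ((\<phi> x)\<^sup>2 * x powr (- ?\<beta>) * jump_kernel \<alpha> \<delta> r x) * indicator {0<..} x"
    proof cases
      case 1
      then show ?thesis using r by (simp add: U1_def U3_def)
    next
      case 2
      have J: "jump_kernel \<alpha> \<delta> r x = ?d x * (x + r) powr ?\<beta> + ((r - x) powr ?s * (r - x) powr ?\<beta> + x powr ?s * (r - x) powr ?\<beta>)"
        using 2 r pp[of "x + r"] pp[of "r - x"] by (simp add: jump_kernel_def odd_powr_def algebra_simps)
      have "U1 x + ?V2 x + (U3 x + ?V4 x)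
      = ennreal (?d x * ?G1) + (ennreal ((r - x) powr ?s * ?G2) + ennreal (x powr ?s * ?G2))"
        unfolding U1_def U3_def G using 2 by simp
      also have "\<dots> = ennreal (?d x * ?G1 + ((r - x) powr ?s * ?G2 + x powr ?s * ?G2))"
        using d[OF 2(1)] G(1) by (simp add: ennreal_plus[symmetric] del: ennreal_plus)
      also have "?d x * ?G1 + ((r - x) powr ?s * ?G2 + x powr ?s * ?G2) = G * jump_kernel \<alpha> \<delta> r x"
        unfolding J by (simp add: algebra_simps)
      finally show ?thesis using 2 by (simp add: G_def)
    next
      case 3
      have J: "jump_kernel \<alpha> \<delta> r x = ?d x * (x + r) powr ?\<beta> + ((x - r) powr ?s - x powr ?s) * (x - r) powr ?\<beta>"
        using 3 r pp[of "x + r"] pp[of "x - r"] by (simp add: jump_kernel_def odd_powr_def algebra_simps)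
      have d': "0 \<le> (x - r) powr ?s - x powr ?s" using 3 r s by (simp add: powr_mono2')
      have "U1 x + ?V2 x + (U3 x + ?V4 x)
      = ennreal (?d x * ?G1) + ennreal (((x - r) powr ?s - x powr ?s) * ?G3)"
        unfolding U1_def U3_def G using 3 r by simp
      also have "\<dots> = ennreal (?d x * ?G1 + ((x - r) powr ?s - x powr ?s) * ?G3)"
        using d[of x] d' 3 r G(1) by (simp add: ennreal_plus[symmetric] del: ennreal_plus)
      also have "?d x * ?G1 + ((x - r) powr ?s - x powr ?s) * ?G3 = G * jump_kernel \<alpha> \<delta> r x"
        unfolding J by (simp add: algebra_simps)
      finally show ?thesis using 3 r by (simp add: G_def)
    qed
  qed
  finally show ?thesis .
qed

text \<open>By \<open>shift_form_le\<close>, twice the nonlocal part P is at most Y, and the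
  supersolution property bounds Y by (\<delta> - \<alpha>) \<open>\<mu> e\<close> I1 - C I2. By
  \<open>integral_g_deriv\<close> the first of these terms is exactly twice the local part of the
  form. Halving leaves C / 2 times I2.\<close>

lemma form_lower_bound:
  assumes C: "0 < C" and e: "0 < e"
    and K: "\<And>x. 0 < x \<Longrightarrow> power_supersolution \<alpha> \<delta> C e x"
  shows "C / 2 * (LBINT x. (\<phi> x)\<^sup>2 * x powr (- (1 + \<delta>)) * indicator {0<..} x * ktrunc_mass \<alpha> (x / e))
    \<le> (LBINT x. g x * (\<mu> e * deriv \<phi> x - (LBINT r. jump_term \<alpha> e \<phi> x r)))"
proof -
  let ?G = "\<lambda>x. ennreal ((\<phi> x)\<^sup>2 * x powr (- (\<delta> / 2))) * indicator {0<..} x"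
  let ?J = "\<lambda>x r. ennreal (w r * jump_kernel \<alpha> \<delta> r x) * indicator {e..} r"
  let ?W = "\<lambda>x. \<integral>\<^sup>+r. ?J x r \<partial>lborel"
  let ?p = "\<lambda>r. w r * indicator {e..} r * shift_form r"
  let ?q = "\<lambda>x. (\<phi> x)\<^sup>2 * x powr (- (1 + \<delta>)) * indicator {0<..} x :: real"
  let ?o = "\<lambda>x. (\<phi> x)\<^sup>2 * x powr (- (\<delta> - \<alpha> + 1)) * indicator {0<..} x :: real"
  let ?t = "\<lambda>x r. jump_term \<alpha> e \<phi> x r"
  let ?T = "\<lambda>x. LBINT r. ?t x r"
  let ?H = "\<lambda>x r. g x * ?t x r"
  define B where "B = (LBINT r. 2 * L * (w r * indicator {e..} r))"
  have iB: "integrable lborel (\<lambda>r. 2 * L * (w r * indicator {e..} r))"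
    using integrable_jump_weight[OF e] by simp
  have t_le: "\<bar>?t x r\<bar> \<le> 2 * L * (w r * indicator {e..} r)" for x r
    by (rule jump_increment_bound[OF L(2)])
  have it: "integrable lborel (?t x)" for x
  proof (rule Bochner_Integration.integrable_bound[OF iB])
    show "AE r in lborel. norm (?t x r) \<le> norm (2 * L * (w r * indicator {e..} r))"
      unfolding real_norm_def by (intro AE_I2 order_trans[OF t_le abs_ge_self])
  qed simp
  have ita: "(LBINT r. \<bar>?t x r\<bar>) \<le> B" for x
    unfolding B_def using it iB t_le by (intro integral_mono) auto
  \<comment> \<open>Absolute convergence comes from the cutoff: the weight is integrable over r >=
    e, \<phi> is bounded and g is integrable.\<close>
  have iH: "integrable (lborel \<Otimes>\<^sub>M lborel) (\<lambda>(x, r). ?H x r)"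
  proof (rule lborel_pair.Fubini_integrable)
    have "integrable lborel (\<lambda>x. g x * (LBINT r. \<bar>?t x r\<bar>))"
      by (rule integrable_g_mult[of _ B]) (use ita in \<open>auto intro!: Bochner_Integration.integral_nonneg\<close>)
    from integrable_abs[OF this]
    show "integrable lborel (\<lambda>x. LBINT r. norm (case (x, r) of (x, r) \<Rightarrow> ?H x r))"
      by (simp add: abs_mult Bochner_Integration.integral_nonneg)
  qed (use it in auto)
  have P_eq: "(LBINT x. g x * ?T x) = (LBINT r. ?p r)"
  proof -
    have "(LBINT x. g x * ?T x) = (LBINT x. LBINT r. ?H x r)" by simp
    also have "\<dots> = (LBINT r. LBINT x. ?H x r)"
      by (rule lborel_pair.Fubini_integral[OF iH, symmetric])
    also have "\<dots> = (LBINT r. ?p r)"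
      unfolding shift_form_def by (subst integral_mult_right_zero[symmetric]) (simp add: mult_ac)
    finally show ?thesis .
  qed
  have iP: "integrable lborel (\<lambda>r. ?p r)"
    using lborel_pair.integrable_snd[OF iH]
    unfolding shift_form_def by (subst integral_mult_right_zero[symmetric]) (simp add: mult_ac)
  define P where "P = (LBINT r. ?p r)"
  define Y where "Y = (\<integral>\<^sup>+x. ?G x *
      ?W x \<partial>lborel)"
  have P_le: "ennreal (2 * P) \<le> Y"
  proof -
    have "ennreal (2 * P) \<le> (\<integral>\<^sup>+r. ennreal (2 * ?p r) \<partial>lborel)"
      using ennreal_integral_le_nn_integral[of lborel "\<lambda>r. 2 * ?p r"] iP
      by (simp add: P_def)
    also have "\<dots> \<le> (\<integral>\<^sup>+r. \<integral>\<^sup>+x. ?G x *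
      ?J x r \<partial>lborel \<partial>lborel)"
    proof (rule nn_integral_mono)
      fix r
      show "ennreal (2 * ?p r) \<le>
        (\<integral>\<^sup>+x. ?G x * ?J x r \<partial>lborel)"
      proof (cases "e \<le> r")
        case True
        have "ennreal (2 * ?p r) = ennreal (w r) * ennreal (2 * shift_form r)"
          using True by (simp add: ennreal_mult'[OF jump_weight_nonneg, symmetric] mult_ac)
        also have "\<dots> \<le> ennreal (w r) * (\<integral>\<^sup>+x\<in>{0<..}. ennreal ((\<phi> x)\<^sup>2 * x powr (- (\<delta> / 2)) * jump_kernel \<alpha> \<delta> r x) \<partial>lborel)"
          using True e by (intro mult_left_mono shift_form_le) auto
        also have "\<dots> = (\<integral>\<^sup>+x. ennreal (w r) * (ennreal ((\<phi> x)\<^sup>2 * x powr (- (\<delta> / 2)) * jump_kernel \<alpha> \<delta> r x) * indicator {0<..} x) \<partial>lborel)"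
          by (rule nn_integral_cmult[symmetric]) measurable
        also have "\<dots> = (\<integral>\<^sup>+x. ?G x * ?J x r \<partial>lborel)"
        proof (rule nn_integral_cong)
          fix x
          have nn: "0 \<le> (\<phi> x)\<^sup>2 * x powr (- (\<delta> / 2))" by simp
          show "ennreal (w r) * (ennreal ((\<phi> x)\<^sup>2 * x powr (- (\<delta> / 2)) * jump_kernel \<alpha> \<delta> r x) * indicator {0<..} x)
            = ?G x * ?J x r"
            using True by (simp only: ennreal_mult'[OF nn] ennreal_mult'[OF jump_weight_nonneg]) (simp add: mult_ac)
        qed
        finally show ?thesis .
      qed simp
    qed
    also have "\<dots> = (\<integral>\<^sup>+x. \<integral>\<^sup>+r. ?G x *
      ?J x r \<partial>lborel \<partial>lborel)"
      by (rule lborel_pair.Fubini') measurable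
    also have "\<dots> = Y"
      unfolding Y_def by (intro nn_integral_cong nn_integral_cmult) measurable
    finally show ?thesis .
  qed
  define I1 where "I1 = (LBINT x. ?o x)"
  define I2 where "I2 = (LBINT x. ?q x * ktrunc_mass \<alpha> (x / e))"
  have iI1: "integrable lborel (\<lambda>x. ?o x)"
    using \<alpha> \<delta> by (intro integrable_square_powr) auto
  have iI2: "integrable lborel (\<lambda>x. ?q x * ktrunc_mass \<alpha> (x / e))"
  proof (rule Bochner_Integration.integrable_bound)
    let ?N = "LBINT z. \<kappa> z"
    show "integrable lborel (\<lambda>x. ?N * ?q x)"
      using \<alpha> \<delta> by (intro integrable_mult_right integrable_square_powr) auto
    show "AE x in lborel. norm (?q x * ktrunc_mass \<alpha> (x / e))
      \<le> norm (?N * ?q x)"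
    proof (rule AE_I2)
      fix x
      have "?q x * ktrunc_mass \<alpha> (x / e) \<le> ?q x * ?N"
        using ktrunc_mass_bounds(2) by (intro mult_left_mono) auto
      also have "\<dots> \<le> \<bar>?N * ?q x\<bar>" by (subst mult.commute) (rule abs_ge_self)
      finally show "norm (?q x * ktrunc_mass \<alpha> (x / e)) \<le> norm (?N * ?q x)"
        using ktrunc_mass_bounds(1) by simp
    qed
  qed simp
  have I0: "0 \<le> I1" "0 \<le> I2"
    unfolding I1_def I2_def using ktrunc_mass_bounds(1) by (auto intro!: Bochner_Integration.integral_nonneg)
  have "Y + ennreal (C * I2) \<le> ennreal ((\<delta> - \<alpha>) * \<mu> e * I1)"
  proof -
    have "ennreal (C * I2) = (\<integral>\<^sup>+x. ennreal (C * (?q x * ktrunc_mass \<alpha> (x / e))) \<partial>lborel)"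
      unfolding I2_def using iI2 C ktrunc_mass_bounds(1)
      by (subst nn_integral_eq_integral) (auto intro!: AE_I2)
    also have "\<dots> = (\<integral>\<^sup>+x. ?G x * ennreal (C * x powr (- \<delta> / 2 - 1) * ktrunc_mass \<alpha> (x / e)) \<partial>lborel)"
    proof (rule nn_integral_cong)
      fix x :: real
      show "ennreal (C * (?q x * ktrunc_mass \<alpha> (x / e)))
        = ?G x * ennreal (C * x powr (- \<delta> / 2 - 1) * ktrunc_mass \<alpha> (x / e))"
      proof (cases "0 < x")
        case True
        have "x powr (- (1 + \<delta>)) = x powr (- (\<delta> / 2)) * x powr (- \<delta> / 2 - 1)"
          using True by (simp add: powr_add[symmetric] add.commute[of 1])
        then show ?thesis using True by (simp add: ennreal_mult'[symmetric] mult_ac)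
      qed simp
    qed
    finally have "Y + ennreal (C * I2) = (\<integral>\<^sup>+x. ?G x * ?W x \<partial>lborel) + (\<integral>\<^sup>+x. ?G x * ennreal (C * x powr (- \<delta> / 2 - 1) * ktrunc_mass \<alpha> (x / e)) \<partial>lborel)"
      by (simp add: Y_def)
    also have "\<dots> = (\<integral>\<^sup>+x. ?G x * ?W x + ?G x * ennreal (C * x powr (- \<delta> / 2 - 1) * ktrunc_mass \<alpha> (x / e)) \<partial>lborel)"
      by (rule nn_integral_add[symmetric]) measurable
    also have "\<dots> \<le> (\<integral>\<^sup>+x. ?G x * ennreal ((\<delta> - \<alpha>) * \<mu> e * x powr (\<alpha> - \<delta> / 2 - 1)) \<partial>lborel)"
    proof (rule nn_integral_mono)
      fix x :: real
      show "?G x * ?W x + ?G x * ennreal (C * x powr (- \<delta> / 2 - 1) * ktrunc_mass \<alpha> (x / e)) \<le> ?G x * ennreal ((\<delta> - \<alpha>) * \<mu> e * x powr (\<alpha> - \<delta> / 2 - 1))"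
        unfolding distrib_left[symmetric] using K[of x] by (cases "0 < x") (auto intro!: mult_left_mono)
    qed
    also have "\<dots> = (\<integral>\<^sup>+x. ennreal ((\<delta> - \<alpha>) * \<mu> e * ?o x) \<partial>lborel)"
    proof (rule nn_integral_cong)
      fix x :: real
      show "?G x * ennreal ((\<delta> - \<alpha>) * \<mu> e * x powr (\<alpha> - \<delta> / 2 - 1))
        = ennreal ((\<delta> - \<alpha>) * \<mu> e * ?o x)"
      proof (cases "0 < x")
        case True
        have "x powr (- (\<delta> - \<alpha> + 1)) = x powr (- (\<delta> / 2)) * x powr (\<alpha> - \<delta> / 2 - 1)"
        proof -
          have "- (\<delta> - \<alpha> + 1) = - (\<delta> / 2) + (\<alpha> - \<delta> / 2 - 1)" by (simp add: field_simps)
          then show ?thesis by (simp only: powr_add)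
        qed
        then show ?thesis using True by (simp add: ennreal_mult'[symmetric] mult_ac)
      qed simp
    qed
    also have "\<dots> = ennreal ((\<delta> - \<alpha>) * \<mu> e * I1)"
      unfolding I1_def using iI1 \<alpha> \<delta> jump_mass_pos[OF e]
      by (subst nn_integral_eq_integral) (auto intro!: AE_I2)
    finally show ?thesis .
  qed
  then have "ennreal (2 * P) + ennreal (C * I2) \<le> ennreal ((\<delta> - \<alpha>) * \<mu> e * I1)"
    using P_le by (meson add_mono order_refl order_trans)
  \<comment> \<open>If P is negative, \<open>ennreal (2 * P)\<close> is 0, and the inequality
    obtained is stronger than the one claimed.\<close>
  then have main: "2 * P + C * I2 \<le> (\<delta> - \<alpha>) * \<mu> e * I1"
    using C I0 \<alpha> \<delta> jump_mass_pos[OF e]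
    by (cases "0 \<le> P") (auto simp: ennreal_plus[symmetric] ennreal_neg ennreal_le_iff simp del: ennreal_plus)
  have Tb: "\<bar>?T x\<bar> \<le> B" for x
    using integral_abs_bound[of lborel "?t x"] ita[of x] by linarith
  have "(LBINT x. g x * (\<mu> e * deriv \<phi> x - ?T x)) = (LBINT x. \<mu> e * (g x * deriv \<phi> x) - g x * ?T x)"
    by (simp add: right_diff_distrib mult.left_commute)
  also have "\<dots> = \<mu> e * (LBINT x. g x * deriv \<phi> x) - (LBINT x. g x * ?T x)"
    by (subst Bochner_Integration.integral_diff)
      (use integrable_g_mult[OF _ L(3)] integrable_g_mult[of ?T, OF _ Tb] in auto)
  also have "\<dots> = (\<delta> - \<alpha>) / 2 * \<mu> e * I1 - P"
    unfolding integral_g_deriv I1_def[symmetric] P_eq P_def[symmetric] by simp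
  finally show ?thesis
    using main unfolding I2_def[symmetric] by (simp add: field_simps)
qed

end

section \<open>Moments of the odd kernel\<close>

definition odd_kernel :: "real \<Rightarrow> real \<Rightarrow> real \<Rightarrow> real"
  where "odd_kernel \<alpha> x y = rker \<alpha> (x - y) - rker \<alpha> (x + y)"

lemma measurable_odd_kernel [measurable (raw)]:
  assumes [measurable]: "f \<in> borel_measurable M" "h \<in> borel_measurable M"
  shows "(\<lambda>x. odd_kernel \<alpha> (f x) (h x)) \<in> borel_measurable M"
  unfolding odd_kernel_def by measurable

lemma integral_fold:
  fixes f :: "real \<Rightarrow> real"
  assumes i: "integrable lborel f"
  shows "integrable lborel (\<lambda>x. (f x + f (- x)) * indicator {0<..} x)"
    and "(LBINT x. f x) = (LBINT x. (f x + f (- x)) * indicator {0<..} x)"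
proof -
  have [measurable]: "f \<in> borel_measurable borel" using borel_measurable_integrable[OF i] by simp
  have i1: "integrable lborel (\<lambda>x. f x * indicator {0<..} x)"
    and i2: "integrable lborel (\<lambda>x. f x * indicator {..<0} x)"
    by (intro integrable_real_mult_indicator i, simp)+
  have "integrable lborel (\<lambda>x. f (0 + -1 * x) * indicator {..<0} (0 + -1 * x) :: real)"
    by (rule lborel_integrable_real_affine[OF i2]) simp
  moreover have e: "f (0 + -1 * x) * indicator {..<0} (0 + -1 * x) = f (- x) * indicator {0<..} x" for x
    by (auto simp: indicator_def)
  ultimately have i2': "integrable lborel (\<lambda>x. f (- x) * indicator {0<..} x)" by (simp only: e)
  show "integrable lborel (\<lambda>x. (f x + f (- x)) * indicator {0<..} x)"
    unfolding distrib_right by (rule Bochner_Integration.integrable_add[OF i1 i2'])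
  have "(LBINT x. f x) = (LBINT x. f x * indicator {0<..} x + f x * indicator {..<0} x)"
    by (intro integral_cong_AE eventually_mono[OF AE_lborel_singleton[of 0]]) (auto simp: indicator_def)
  also have "\<dots> = (LBINT x. f x * indicator {0<..} x) + (LBINT x. f x * indicator {..<0} x)"
    by (rule Bochner_Integration.integral_add[OF i1 i2])
  also have "(LBINT x. f x * indicator {..<0} x) = (LBINT x. f (- x) * indicator {0<..} x)"
    using lborel_integral_real_affine[of "-1" "\<lambda>x. f x * indicator {..<0} x" 0] by (simp only: e) simp
  also have "(LBINT x. f x * indicator {0<..} x) + (LBINT x. f (- x) * indicator {0<..} x)
    = (LBINT x. f x * indicator {0<..} x + f (- x) * indicator {0<..} x)"
    by (rule Bochner_Integration.integral_add[OF i1 i2', symmetric])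
  finally show "(LBINT x. f x) = (LBINT x. (f x + f (- x)) * indicator {0<..} x)"
    by (simp add: distrib_right)
qed

context riesz_exponent
begin

lemma odd_kernel_nonneg:
  assumes "0 < x" "0 < y" "x \<noteq> y"
  shows "0 \<le> odd_kernel \<alpha> x y"
  using assms \<alpha> unfolding odd_kernel_def by (simp add: powr_mono2')

lemma odd_kernel_commute: "odd_kernel \<alpha> x y = odd_kernel \<alpha> y x"
  by (simp add: odd_kernel_def abs_minus_commute add.commute)

lemma odd_kernel_1_pos:
  assumes "0 < t" "t \<noteq> 1"
  shows "0 < odd_kernel \<alpha> t 1"
  using assms \<alpha> powr_less_mono2_neg[of "\<alpha> - 1" "\<bar>t - 1\<bar>" "\<bar>t + 1\<bar>"] unfolding odd_kernel_def by simp

text \<open>Both kernels equal 1 at t = 0, so their difference is of first order: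
  \<open>(1 - t) powr (\<alpha> - 1)\<close> is at most 1 / (1 - t) <= 1 + 2 t, and
  \<open>(1 + t) powr (\<alpha> - 1)\<close> is at least 1 / (1 + t) >= 1 - t.\<close>

lemma odd_kernel_1_le:
  assumes "0 < t" "t \<le> 1/2"
  shows "odd_kernel \<alpha> t 1 \<le> 3 * t"
proof -
  have "(1 - t) powr (\<alpha> - 1) \<le> (1 - t) powr (- 1)"
    using assms \<alpha> by (intro powr_mono') auto
  also have "\<dots> = 1 / (1 - t)" using assms by (simp add: powr_minus_divide)
  also have "\<dots> \<le> 1 + 2 * t"
  proof -
    have "t * (2 * t) \<le> t * 1" using assms by (intro mult_left_mono) auto
    then show ?thesis using assms by (simp add: divide_le_eq algebra_simps)
  qed
  finally have 1: "(1 - t) powr (\<alpha> - 1) \<le> 1 + 2 * t" .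
  have "1 - t \<le> 1 / (1 + t)" using assms by (simp add: le_divide_eq algebra_simps)
  also have "\<dots> = (1 + t) powr (- 1)" using assms by (simp add: powr_minus_divide)
  also have "\<dots> \<le> (1 + t) powr (\<alpha> - 1)" using assms \<alpha> by (intro powr_mono) auto
  finally have 2: "1 - t \<le> (1 + t) powr (\<alpha> - 1)" .
  have "\<bar>t - 1\<bar> = 1 - t" "\<bar>t + 1\<bar> = 1 + t" using assms by auto
  then show ?thesis using 1 2 by (simp add: odd_kernel_def)
qed

text \<open>Homogeneity reduces the claim to y = 1. There the kernel is O(t) at 0, which admits
  \<tau> < 2, has an integrable singularity at 1, and decays with order \<alpha> - 2 at infinity.
  The order \<delta> evaluates the outer potential, \<delta> - \<alpha> gives the weighted
  integrability of \<phi>, and 0 the integrability of the kernel itself.\<close>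

lemma odd_kernel_moment:
  assumes \<tau>: "0 \<le> \<tau>" "\<tau> < 2"
  shows "\<exists>B>0. \<forall>y>0. (\<integral>\<^sup>+x\<in>{0<..}. ennreal (odd_kernel \<alpha> x y * x powr (- \<tau>)) \<partial>lborel)
    = ennreal (B * y powr (\<alpha> - \<tau>))"
proof -
  let ?f = "\<lambda>t. ennreal (odd_kernel \<alpha> t 1 * t powr (- \<tau>)) * indicator {0<..} t"
  define M where "M = (\<integral>\<^sup>+t. ?f t \<partial>lborel)"
  have scale: "(\<integral>\<^sup>+x\<in>{0<..}. ennreal (odd_kernel \<alpha> x y * x powr (- \<tau>)) \<partial>lborel) = ennreal (y powr (\<alpha> - \<tau>)) * M"
    if y: "0 < y" for y
  proof -
    have "(\<integral>\<^sup>+x\<in>{0<..}. ennreal (odd_kernel \<alpha> x y * x powr (- \<tau>)) \<partial>lborel)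
       = ennreal y * (\<integral>\<^sup>+t. ennreal (odd_kernel \<alpha> (0 + y * t) y * (0 + y * t) powr (- \<tau>)) * indicator {0<..} (0 + y * t) \<partial>lborel)"
      using y by (subst nn_integral_real_affine[where c = y and t = 0]) auto
    also have "\<dots> = ennreal y * (\<integral>\<^sup>+t. ennreal (y powr (\<alpha> - 1 - \<tau>)) * ?f t \<partial>lborel)"
    proof (rule arg_cong2[of _ _ _ _ "(*)"], rule refl, rule nn_integral_cong)
      fix t
      have k: "odd_kernel \<alpha> (0 + y * t) y = y powr (\<alpha> - 1) * odd_kernel \<alpha> t 1"
      proof -
        have "0 + y * t - y = y * (t - 1)" "0 + y * t + y = y * (t + 1)" by (auto simp: algebra_simps)
        then show ?thesis
          using y unfolding odd_kernel_def by (simp only: abs_mult powr_mult right_diff_distrib[symmetric] abs_of_pos)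
      qed
      show "ennreal (odd_kernel \<alpha> (0 + y * t) y * (0 + y * t) powr (- \<tau>)) * indicator {0<..} (0 + y * t)
        = ennreal (y powr (\<alpha> - 1 - \<tau>)) * ?f t"
      proof (cases "0 < t")
        case True
        have "odd_kernel \<alpha> (0 + y * t) y * (0 + y * t) powr (- \<tau>) = y powr (\<alpha> - 1 - \<tau>) * (odd_kernel \<alpha> t 1 * t powr (- \<tau>))"
          unfolding k using y True powr_add[of y "\<alpha> - 1" "- \<tau>"] by (simp add: powr_mult)
        then show ?thesis using True y by (simp add: ennreal_mult')
      next
        case False
        then show ?thesis using y by (simp add: zero_less_mult_iff)
      qed
    qed
    also have "\<dots> = ennreal y * (ennreal (y powr (\<alpha> - 1 - \<tau>)) * M)"
      unfolding M_def by (subst nn_integral_cmult) auto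
    also have "\<dots> = ennreal (y * y powr (\<alpha> - 1 - \<tau>)) * M"
      using y by (simp add: ennreal_mult mult_ac)
    also have "y * y powr (\<alpha> - 1 - \<tau>) = y powr (\<alpha> - \<tau>)" using y by (simp add: powr_diff)
    finally show ?thesis .
  qed
  have "M < \<infinity>"
  proof -
    let ?a = "\<lambda>t::real. 3 * (ennreal (\<bar>t\<bar> powr (1 - \<tau>)) * indicator {0..1} t)"
    let ?b = "\<lambda>t::real. ennreal ((1/2) powr (- \<tau>)) * (ennreal (rker \<alpha> (t - 1)) * indicator {0..2} t)"
    let ?c = "\<lambda>t::real. 3 * (ennreal (\<bar>t\<bar> powr (\<alpha> - 2 - \<tau>)) * indicator {t. 1 \<le> \<bar>t\<bar>} t)"
    have le: "?f t \<le> ?a t + (?b t + ?c t)" for t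
    proof -
      have k: "odd_kernel \<alpha> t 1 \<le> rker \<alpha> (t - 1)" by (simp add: odd_kernel_def)
      consider "t \<le> 0" | "0 < t" "t \<le> 1/2" | "1/2 < t" "t \<le> 2" | "2 < t" by linarith
      then show ?thesis
      proof cases
        case 2
        have "odd_kernel \<alpha> t 1 * t powr (- \<tau>) \<le> 3 * t * t powr (- \<tau>)"
          using odd_kernel_1_le 2 by (intro mult_right_mono) auto
        also have "\<dots> = 3 * t powr (1 - \<tau>)" using 2 by (simp add: powr_diff powr_minus_divide)
        finally have "ennreal (odd_kernel \<alpha> t 1 * t powr (- \<tau>)) \<le> ennreal (3 * t powr (1 - \<tau>))" by (rule ennreal_leI)
        then have "?f t \<le> ?a t" using 2 by (simp add: ennreal_mult')
        then show ?thesis by (rule add_increasing2[rotated]) simp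
      next
        case 3
        have "t powr (- \<tau>) \<le> (1/2) powr (- \<tau>)" using 3 \<tau> \<alpha> by (intro powr_mono2') auto
        then have "odd_kernel \<alpha> t 1 * t powr (- \<tau>) \<le> rker \<alpha> (t - 1) * (1/2) powr (- \<tau>)"
          using k by (intro mult_mono) auto
        then have "ennreal (odd_kernel \<alpha> t 1 * t powr (- \<tau>)) \<le> ennreal ((1/2) powr (- \<tau>) * rker \<alpha> (t - 1))"
          by (intro ennreal_leI) (simp add: mult.commute)
        then have "?f t \<le> ?b t" using 3 by (simp add: ennreal_mult')
        then have "?f t \<le> ?b t + ?c t" by (rule add_increasing2[rotated]) simp
        then show ?thesis by (rule add_increasing[rotated]) simp
      next
        case 4
        \<comment> \<open>Homogeneity and symmetry under exchange of the arguments carry the linear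
          bound near 0 over to infinity.\<close>
        have "odd_kernel \<alpha> t 1 = t powr (\<alpha> - 1) * odd_kernel \<alpha> (1 / t) 1"
        proof -
          have "t - 1 = t * (1 - 1 / t)" "t + 1 = t * (1 + 1 / t)" using 4 by (auto simp: field_simps)
          then have "rker \<alpha> (t - 1) = t powr (\<alpha> - 1) * rker \<alpha> (1 / t - 1)"
            "rker \<alpha> (t + 1) = t powr (\<alpha> - 1) * rker \<alpha> (1 / t + 1)"
            using 4 by (simp_all only: abs_mult powr_mult abs_minus_commute[of "1 / t" 1] add.commute[of "1 / t" 1] abs_of_pos)
          then show ?thesis by (simp only: odd_kernel_def right_diff_distrib)
        qed
        also have "\<dots> \<le> t powr (\<alpha> - 1) * (3 * (1 / t))"
          using 4 by (intro mult_left_mono odd_kernel_1_le) auto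
        also have "\<dots> = 3 * t powr (\<alpha> - 2)" using 4 by (simp add: powr_diff power2_eq_square)
        finally have "odd_kernel \<alpha> t 1 * t powr (- \<tau>) \<le> 3 * t powr (\<alpha> - 2) * t powr (- \<tau>)"
          by (rule mult_right_mono) simp
        also have "\<dots> = 3 * t powr (\<alpha> - 2 - \<tau>)"
          using powr_add[of t "\<alpha> - 2" "- \<tau>"] by simp
        finally have "ennreal (odd_kernel \<alpha> t 1 * t powr (- \<tau>)) \<le> ennreal (3 * t powr (\<alpha> - 2 - \<tau>))"
          by (rule ennreal_leI)
        then have "?f t \<le> ?c t" using 4 by (simp add: ennreal_mult')
        then have "?f t \<le> ?b t + ?c t" by (rule add_increasing[rotated]) simp
        then show ?thesis by (rule add_increasing[rotated]) simp
      qed auto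
    qed
    have b: "(\<integral>\<^sup>+t\<in>{0..2}. ennreal (rker \<alpha> (t - 1)) \<partial>lborel) < \<infinity>"
    proof -
      have "(\<integral>\<^sup>+t\<in>{0..2}. ennreal (rker \<alpha> (t - 1)) \<partial>lborel)
        = (\<integral>\<^sup>+t\<in>{-1..1}. ennreal (rker \<alpha> t) \<partial>lborel)"
        by (subst nn_integral_real_affine[where c = "1" and t = 1]) (auto intro!: nn_integral_cong simp: indicator_def)
      then show ?thesis using nn_integral_abs_powr_finite[of "\<alpha> - 1" "-1" 1] \<alpha> by simp
    qed
    have "M \<le> (\<integral>\<^sup>+t. ?a t + (?b t + ?c t) \<partial>lborel)"
      unfolding M_def by (intro nn_integral_mono le)
    also have "\<dots> = (\<integral>\<^sup>+t. ?a t \<partial>lborel) + ((\<integral>\<^sup>+t. ?b t \<partial>lborel) + (\<integral>\<^sup>+t. ?c t \<partial>lborel))"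
      by (simp add: nn_integral_add)
    also have "\<dots> < \<infinity>"
      using b \<tau> \<alpha> nn_integral_abs_powr_tail[of "\<alpha> - 2 - \<tau>" 1] nn_integral_abs_powr_finite[of "1 - \<tau>" 0 1]
      by (simp add: nn_integral_cmult ennreal_mult_less_top)
    finally show ?thesis .
  qed
  moreover have "M \<noteq> 0"
  proof
    assume "M = 0"
    then have "AE t in lborel. ?f t = 0" unfolding M_def by (subst (asm) nn_integral_0_iff_AE) auto
    then have "AE t::real in lborel. t \<notin> {2<..<3}"
    proof eventually_elim
      fix t :: real assume "?f t = 0"
      moreover have "0 < odd_kernel \<alpha> t 1 * t powr (- \<tau>)" if "2 < t"
        using odd_kernel_1_pos[of t] that by simp
      ultimately show "t \<notin> {2<..<3}" by (auto simp: ennreal_eq_0_iff)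
    qed
    then have "emeasure lborel {2<..<3::real} = 0"
      using emeasure_eq_0_AE[of "\<lambda>x::real. x \<in> {2<..<3}" lborel] by (simp del: greaterThanLessThan_iff)
    then show False by simp
  qed
  ultimately obtain m where m: "M = ennreal m" "0 < m"
    by (cases M) (auto simp: less_le)
  show ?thesis
    using scale m by (intro exI[of _ m]) (auto simp: ennreal_mult mult_ac)
qed

lemma integrable_odd_kernel:
  assumes x: "0 < x"
  shows "integrable lborel (\<lambda>y. odd_kernel \<alpha> x y * indicator {0<..} y)"
proof (rule integrableI_nonneg)
  obtain B where B: "\<And>y. 0 < y \<Longrightarrow> (\<integral>\<^sup>+x\<in>{0<..}. ennreal (odd_kernel \<alpha> x y * x powr (- 0)) \<partial>lborel) = ennreal (B * y powr (\<alpha> - 0))"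
    using odd_kernel_moment[of 0] by auto
  have "(\<integral>\<^sup>+y. ennreal (odd_kernel \<alpha> x y * indicator {0<..} y) \<partial>lborel) = (\<integral>\<^sup>+y\<in>{0<..}. ennreal (odd_kernel \<alpha> y x * y powr (- 0)) \<partial>lborel)"
    by (intro nn_integral_cong) (auto simp: indicator_def odd_kernel_commute[of x])
  also have "\<dots> < \<infinity>" unfolding B[OF x] by simp
  finally show "(\<integral>\<^sup>+y. ennreal (odd_kernel \<alpha> x y * indicator {0<..} y) \<partial>lborel) < \<infinity>" .
  show "AE y in lborel. 0 \<le> odd_kernel \<alpha> x y * indicator {0<..} y"
    using AE_lborel_singleton[of x] by eventually_elim (use odd_kernel_nonneg[OF x] in \<open>auto simp: indicator_def\<close>)
qed simp

end

locale odd_riesz_profile = riesz_profile +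
  assumes odd: "odd_function u"
begin

lemma u_minus: "u (- x) = - u x"
  using odd by (simp add: odd_function_def)

lemma \<phi>_minus: "\<phi> (- x) = - \<phi> x"
proof -
  have "\<phi> (- x) = (LBINT y. u (0 + -1 * y) * rker \<alpha> (- x - (0 + -1 * y)))"
    unfolding \<phi>_def by (subst lborel_integral_real_affine[where c = "-1" and t = 0]) auto
  also have "\<dots> = (LBINT y. - (u y * rker \<alpha> (x - y)))"
    by (intro Bochner_Integration.integral_cong) (auto simp: u_minus abs_minus_commute)
  finally show ?thesis by (simp add: \<phi>_def)
qed

lemma deriv_u_minus: "deriv u (- x) = deriv u x"
proof -
  have "((\<lambda>x. - u (- x)) has_real_derivative - (deriv u (- x) * - 1)) (at x)"
    by (intro DERIV_minus DERIV_chain2[OF u_DERIV]) (auto intro!: derivative_eq_intros)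
  moreover have "(\<lambda>x. - u (- x)) = u" by (simp add: u_minus)
  ultimately show ?thesis using DERIV_unique[OF u_DERIV[of x]] by simp
qed

lemma \<phi>_le_odd_kernel:
  assumes x: "0 < x"
  shows "ennreal \<bar>\<phi> x\<bar> \<le> (\<integral>\<^sup>+y\<in>{0<..}. ennreal (\<bar>u y\<bar> * odd_kernel \<alpha> x y) \<partial>lborel)"
proof -
  obtain M where M: "0 < M" "\<And>x. \<bar>u x\<bar> \<le> M" using u_bounds by metis
  let ?F = "\<lambda>y. u y * rker \<alpha> (x - y)"
  have i: "integrable lborel ?F" by (rule integrable_riesz[OF _ M(2) u_int]) simp
  have "\<bar>\<phi> x\<bar> \<le> (LBINT y. \<bar>(?F y + ?F (- y)) * indicator {0<..} y\<bar>)"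
    unfolding \<phi>_def integral_fold(2)[OF i] by (rule integral_abs_bound)
  then have "ennreal \<bar>\<phi> x\<bar> \<le> ennreal (LBINT y. \<bar>(?F y + ?F (- y)) * indicator {0<..} y\<bar>)" by (rule ennreal_leI)
  also have "\<dots> \<le> (\<integral>\<^sup>+y. ennreal \<bar>(?F y + ?F (- y)) * indicator {0<..} y\<bar> \<partial>lborel)"
    by (rule ennreal_integral_le_nn_integral) (rule integrable_abs[OF integral_fold(1)[OF i]])
  also have "\<dots> = (\<integral>\<^sup>+y\<in>{0<..}. ennreal (\<bar>u y\<bar> * odd_kernel \<alpha> x y) \<partial>lborel)"
  proof (rule nn_integral_cong_AE, use AE_lborel_singleton[of x] in eventually_elim)
    fix y assume "y \<noteq> x"
    have "?F y + ?F (- y) = u y * odd_kernel \<alpha> x y"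
      by (simp add: u_minus odd_kernel_def right_diff_distrib)
    then show "ennreal \<bar>(?F y + ?F (- y)) * indicator {0<..} y\<bar> = ennreal (\<bar>u y\<bar> * odd_kernel \<alpha> x y) * indicator {0<..} y"
      using odd_kernel_nonneg[OF x, of y] \<open>y \<noteq> x\<close> by (auto simp: indicator_def abs_mult)
  qed
  finally show ?thesis .
qed

text \<open>By Tonelli and the moment of order \<delta> - \<alpha>, the integral is at most a
  multiple of that of \<open>\<bar>u y\<bar> * y powr (2 * \<alpha> - \<delta>)\<close> over the
  half-line. For y <= 1 the linear bound on the odd function u gives an exponent above -1 because
  \<delta> < 2; for y > 1 the power is at most 1 because \<delta> > 2 \<alpha>, and u is
  integrable.\<close>

lemma integrable_\<phi>_powr:
  assumes \<delta>: "2 * \<alpha> < \<delta>" "\<delta> < 2"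
  shows "integrable lborel (\<lambda>x. \<bar>\<phi> x\<bar> * x powr (\<alpha> - \<delta>) * indicator {0<..} x)"
proof (rule integrableI_nonneg)
  obtain M where M: "0 < M" "\<And>x. \<bar>u x\<bar> \<le> M" "\<And>x. \<bar>deriv u x\<bar> \<le> M" using u_bounds by metis
  have u0: "u 0 = 0" using u_minus[of 0] by simp
  have uM: "\<bar>u y\<bar> \<le> M * \<bar>y\<bar>" for y
    using field_differentiable_bound[of UNIV u "deriv u" M y 0] u_DERIV M by (auto simp: u0)
  obtain B where B: "0 < B" "\<And>y. 0 < y \<Longrightarrow> (\<integral>\<^sup>+x\<in>{0<..}. ennreal (odd_kernel \<alpha> x y * x powr (- (\<delta> - \<alpha>))) \<partial>lborel)
    = ennreal (B * y powr (\<alpha> - (\<delta> - \<alpha>)))"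
    using odd_kernel_moment[of "\<delta> - \<alpha>"] \<delta> \<alpha> by auto
  let ?p = "\<alpha> - (\<delta> - \<alpha>)"
  let ?h = "\<lambda>x y. ennreal \<bar>u y\<bar> * indicator {0<..} y * (ennreal (odd_kernel \<alpha> x y * x powr (- (\<delta> - \<alpha>))) * indicator {0<..} x)"
  have "(\<integral>\<^sup>+x. ennreal (\<bar>\<phi> x\<bar> * x powr (\<alpha> - \<delta>) * indicator {0<..} x) \<partial>lborel) \<le> (\<integral>\<^sup>+x. \<integral>\<^sup>+y. ?h x y \<partial>lborel \<partial>lborel)"
  proof (rule nn_integral_mono)
    fix x :: real
    show "ennreal (\<bar>\<phi> x\<bar> * x powr (\<alpha> - \<delta>) * indicator {0<..} x) \<le> (\<integral>\<^sup>+y. ?h x y \<partial>lborel)"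
    proof (cases "0 < x")
      case True
      have "ennreal (\<bar>\<phi> x\<bar> * x powr (\<alpha> - \<delta>) * indicator {0<..} x) = ennreal (x powr (\<alpha> - \<delta>)) * ennreal \<bar>\<phi> x\<bar>"
        using True by (simp add: ennreal_mult'[symmetric] mult.commute)
      also have "\<dots> \<le> ennreal (x powr (\<alpha> - \<delta>)) * (\<integral>\<^sup>+y\<in>{0<..}. ennreal (\<bar>u y\<bar> * odd_kernel \<alpha> x y) \<partial>lborel)"
        by (intro mult_left_mono \<phi>_le_odd_kernel True) simp
      also have "\<dots> = (\<integral>\<^sup>+y. ennreal (x powr (\<alpha> - \<delta>)) * (ennreal (\<bar>u y\<bar> * odd_kernel \<alpha> x y) * indicator {0<..} y) \<partial>lborel)"
        by (rule nn_integral_cmult[symmetric]) measurable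
      also have "\<dots> = (\<integral>\<^sup>+y. ?h x y \<partial>lborel)"
        using True by (intro nn_integral_cong) (auto simp: ennreal_mult'[symmetric] indicator_def mult_ac)
      finally show ?thesis .
    qed simp
  qed
  also have "\<dots> = (\<integral>\<^sup>+y. \<integral>\<^sup>+x. ?h x y \<partial>lborel \<partial>lborel)"
    by (rule lborel_pair.Fubini'[symmetric]) measurable
  also have "\<dots> = (\<integral>\<^sup>+y. ennreal \<bar>u y\<bar> * indicator {0<..} y * ennreal (B * y powr ?p) \<partial>lborel)"
  proof (rule nn_integral_cong)
    fix y :: real
    have "(\<integral>\<^sup>+x. ?h x y \<partial>lborel) = ennreal \<bar>u y\<bar> * indicator {0<..} y * (\<integral>\<^sup>+x\<in>{0<..}. ennreal (odd_kernel \<alpha> x y * x powr (- (\<delta> - \<alpha>))) \<partial>lborel)"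
      by (rule nn_integral_cmult) measurable
    then show "(\<integral>\<^sup>+x. ?h x y \<partial>lborel) = ennreal \<bar>u y\<bar> * indicator {0<..} y * ennreal (B * y powr ?p)"
      using B(2)[of y] by (cases "0 < y") auto
  qed
  also have "\<dots> \<le> (\<integral>\<^sup>+y. ennreal (M * B) * (ennreal (\<bar>y\<bar> powr (1 + ?p)) * indicator {0..1} y) + ennreal B * ennreal \<bar>u y\<bar> \<partial>lborel)"
  proof (rule nn_integral_mono)
    fix y :: real
    consider "y \<le> 0" | "0 < y" "y \<le> 1" | "1 < y" by linarith
    then show "ennreal \<bar>u y\<bar> * indicator {0<..} y * ennreal (B * y powr ?p) \<le>
      ennreal (M * B) * (ennreal (\<bar>y\<bar> powr (1 + ?p)) * indicator {0..1} y) + ennreal B * ennreal \<bar>u y\<bar>"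
    proof cases
      case 2
      have "\<bar>u y\<bar> * (B * y powr ?p) \<le> (M * \<bar>y\<bar>) * (B * y powr ?p)"
        using uM B by (intro mult_right_mono) auto
      also have "\<dots> = M * B * \<bar>y\<bar> powr (1 + ?p)" using 2 by (simp add: powr_add)
      finally have "ennreal \<bar>u y\<bar> * indicator {0<..} y * ennreal (B * y powr ?p) \<le> ennreal (M * B) * (ennreal (\<bar>y\<bar> powr (1 + ?p)) * indicator {0..1} y)"
        using 2 M B by (simp add: ennreal_mult'[symmetric] ennreal_leI)
      then show ?thesis by (rule add_increasing2[rotated]) simp
    next
      case 3
      have "y powr ?p \<le> y powr 0" using 3 \<delta> by (intro powr_mono) auto
      then have "\<bar>u y\<bar> * (B * y powr ?p) \<le> \<bar>u y\<bar> * (B * 1)" using B 3 by (intro mult_left_mono) auto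
      then have "ennreal \<bar>u y\<bar> * indicator {0<..} y * ennreal (B * y powr ?p) \<le> ennreal B * ennreal \<bar>u y\<bar>"
        using 3 B by (simp add: ennreal_mult'[symmetric] ennreal_leI mult.commute)
      then show ?thesis by (rule add_increasing[rotated]) simp
    qed simp
  qed
  also have "\<dots> = ennreal (M * B) * (\<integral>\<^sup>+y\<in>{0..1}. ennreal (\<bar>y\<bar> powr (1 + ?p)) \<partial>lborel) + ennreal B * (\<integral>\<^sup>+y. ennreal \<bar>u y\<bar> \<partial>lborel)"
    by (simp add: nn_integral_add nn_integral_cmult)
  also have "\<dots> < \<infinity>"
    using nn_integral_abs_powr_finite[of "1 + ?p" 0 1] \<delta> \<alpha> u_int
    by (simp add: ennreal_mult_less_top integrable_iff_bounded)
  finally show "(\<integral>\<^sup>+x. ennreal (\<bar>\<phi> x\<bar> * x powr (\<alpha> - \<delta>) * indicator {0<..} x) \<partial>lborel) < \<infinity>" .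
qed auto

end

section \<open>The inequality\<close>

lemma (in riesz_exponent) ktrunc_mass_tendsto:
  assumes X: "filterlim X at_top sequentially"
  shows "(\<lambda>n. ktrunc_mass \<alpha> (X n)) \<longlonglongrightarrow> (LBINT z. \<kappa> z)"
  unfolding ktrunc_mass_def
proof (rule integral_dominated_convergence[where w = "\<kappa>"])
  show "AE z in lborel. (\<lambda>n. \<kappa> z * indicator {- X n / 2..X n / 2} z) \<longlonglongrightarrow> \<kappa> z"
  proof (rule AE_I2, rule tendsto_eventually)
    fix z
    have "\<forall>\<^sub>F n in sequentially. 2 * \<bar>z\<bar> \<le> X n" using X by (simp add: filterlim_at_top)
    then show "\<forall>\<^sub>F n in sequentially. \<kappa> z * indicator {- X n / 2..X n / 2} z = \<kappa> z"
      by eventually_elim (auto simp: indicator_def abs_le_iff)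
  qed
qed (use integrable_ktrunc ktrunc_nonneg in \<open>auto simp: indicator_def intro!: AE_I2\<close>)

context odd_riesz_profile
begin

text \<open>The limit e -> 0 in \<open>form_lower_bound\<close>. Both sides converge by dominated
  convergence, each with the factor N, the integral of \<kappa>; N is positive and cancels, so the
  constant does not depend on it.\<close>

lemma hardy_form_bound:
  assumes \<delta>: "2 * \<alpha> < \<delta>" "\<delta> < 2" and C: "0 < C"
    and K: "\<And>x e. 0 < x \<Longrightarrow> 0 < e \<Longrightarrow> power_supersolution \<alpha> \<delta> C e x"
  shows "C / 2 * (LBINT x. (\<phi> x)\<^sup>2 * x powr (- (1 + \<delta>)) * indicator {0<..} x)
    \<le> (LBINT x. \<phi> x * deriv u x * x powr (\<alpha> - \<delta>) * indicator {0<..} x)"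
proof -
  obtain L1 where L1: "0 < L1" "\<And>x. \<bar>\<phi> x\<bar> \<le> L1" using \<phi>_bounded by metis
  obtain L2 where L2: "0 < L2" "\<And>x. \<bar>deriv \<phi> x\<bar> \<le> L2" using deriv_\<phi>_bounded by metis
  obtain M where M: "0 < M" "\<And>x. \<bar>u x\<bar> \<le> M" "\<And>x. \<bar>deriv u x\<bar> \<le> M" using u_bounds by metis
  interpret W: weighted_profile \<alpha> \<delta> \<phi> "max L1 L2"
    by unfold_locales
      (use \<alpha> \<delta> \<phi>_minus \<phi>_DERIV isCont_deriv_\<phi> integrable_\<phi>_powr[OF \<delta>] L1 L2 in \<open>auto simp: le_max_iff_disj\<close>)
  define N where "N = (LBINT z. \<kappa> z)"
  have N: "0 < N" unfolding N_def by (rule ktrunc_integral_pos)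
  define e where "e = (\<lambda>n. inverse (real (Suc n)))"
  have e: "0 < e n" for n by (simp add: e_def)
  have e0: "e \<longlonglongrightarrow> 0" unfolding e_def by (rule LIMSEQ_inverse_real_of_nat)
  let ?V = "\<lambda>e x. LBINT z. deriv u (x - e * z) * \<kappa> z"
  have Vb: "\<bar>?V e x\<bar> \<le> M * N" for e x
  proof -
    have "\<bar>?V e x\<bar> \<le> (LBINT z. M * \<kappa> z)"
      by (rule order_trans[OF integral_abs_bound integral_mono'])
        (use M integrable_ktrunc ktrunc_nonneg in \<open>auto intro!: ktrunc_mult_bound\<close>)
    then show ?thesis by (simp add: N_def)
  qed
  have Vlim: "(\<lambda>n. ?V (e n) x) \<longlonglongrightarrow> deriv u x * N" for x
  proof -
    have "(\<lambda>n. ?V (e n) x) \<longlonglongrightarrow> (LBINT z. deriv u x * \<kappa> z)"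
    proof (rule integral_dominated_convergence[where w = "\<lambda>z. M * \<kappa> z"])
      have "(\<lambda>n. x - e n * z) \<longlonglongrightarrow> x" for z
        using tendsto_diff[OF tendsto_const tendsto_mult_left_zero[OF e0], of x z] by simp
      then show "AE z in lborel. (\<lambda>n. deriv u (x - e n * z) * \<kappa> z) \<longlonglongrightarrow> deriv u x * \<kappa> z"
        by (intro AE_I2 tendsto_intros isCont_tendsto_compose[OF isCont_deriv])
    qed (use M integrable_ktrunc in \<open>auto intro!: AE_I2 ktrunc_mult_bound\<close>)
    then show ?thesis by (simp add: N_def)
  qed
  have lim_r: "(\<lambda>n. LBINT x. W.g x * ?V (e n) x) \<longlonglongrightarrow> (LBINT x. W.g x * (deriv u x * N))"
  proof (rule integral_dominated_convergence[where w = "\<lambda>x. \<bar>W.g x\<bar> * (M * N)"])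
    show "AE x in lborel. (\<lambda>n. W.g x * ?V (e n) x) \<longlonglongrightarrow> W.g x * (deriv u x * N)"
      by (intro AE_I2 tendsto_intros Vlim)
    show "AE x in lborel. norm (W.g x * ?V (e n) x) \<le> \<bar>W.g x\<bar> * (M * N)" for n
      using Vb by (intro AE_I2) (auto simp: abs_mult intro!: mult_left_mono)
  qed (use W.integrable_g in auto)
  let ?q = "\<lambda>x. (\<phi> x)\<^sup>2 * x powr (- (1 + \<delta>)) * indicator {0<..} x :: real"
  have iq: "integrable lborel ?q" using \<delta> \<alpha> by (intro W.integrable_square_powr) auto
  have lim_l: "(\<lambda>n. LBINT x. ?q x * ktrunc_mass \<alpha> (x / e n)) \<longlonglongrightarrow> (LBINT x. ?q x * N)"
  proof (rule integral_dominated_convergence[where w = "\<lambda>x. ?q x * N"])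
    show "AE x in lborel. (\<lambda>n. ?q x * ktrunc_mass \<alpha> (x / e n)) \<longlonglongrightarrow> ?q x * N"
    proof (rule AE_I2)
      fix x :: real
      show "(\<lambda>n. ?q x * ktrunc_mass \<alpha> (x / e n)) \<longlonglongrightarrow> ?q x * N"
      proof (cases "0 < x")
        case True
        have "filterlim (\<lambda>n. x * real (Suc n)) at_top sequentially"
          using True by (intro filterlim_tendsto_pos_mult_at_top[OF tendsto_const] filterlim_compose[OF filterlim_real_sequentially filterlim_Suc]) auto
        then have "filterlim (\<lambda>n. x / e n) at_top sequentially" by (simp add: e_def divide_inverse)
        then show ?thesis unfolding N_def by (intro tendsto_intros ktrunc_mass_tendsto)
      qed simp
    qed
    show "AE x in lborel. norm (?q x * ktrunc_mass \<alpha> (x / e n)) \<le> ?q x * N" for n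
      using ktrunc_mass_bounds unfolding N_def
      by (intro AE_I2) (auto simp: abs_mult indicator_def intro!: mult_left_mono)
  qed (use iq in auto)
  have "C / 2 * (LBINT x. ?q x * ktrunc_mass \<alpha> (x / e n)) \<le> (LBINT x. W.g x * ?V (e n) x)" for n
    unfolding deriv_\<phi>_identity[OF e] by (rule W.form_lower_bound[OF C e]) (rule K[OF _ e])
  then have "C / 2 * (LBINT x. ?q x * N) \<le> (LBINT x. W.g x * (deriv u x * N))"
    by (intro LIMSEQ_le[OF tendsto_mult[OF tendsto_const lim_l] lim_r]) auto
  also have "(LBINT x. ?q x * N) = N * (LBINT x. ?q x)" by simp
  also have "(LBINT x. W.g x * (deriv u x * N)) = (LBINT x. N * (\<phi> x * deriv u x * x powr (\<alpha> - \<delta>) * indicator {0<..} x))"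
    by (simp add: W.g_def mult_ac)
  also have "\<dots> = N * (LBINT x. \<phi> x * deriv u x * x powr (\<alpha> - \<delta>) * indicator {0<..} x)"
    by simp
  finally have "N * (C / 2 * (LBINT x. ?q x)) \<le> N * (LBINT x. \<phi> x * deriv u x * x powr (\<alpha> - \<delta>) * indicator {0<..} x)"
    by (simp only: mult.left_commute)
  then show ?thesis using N by (simp only: mult_le_cancel_left_pos)
qed

lemma riesz_potential_u: "riesz_potential \<alpha> u x = riesz_const \<alpha> * \<phi> x"
proof -
  obtain M where M: "0 < M" "\<And>x. \<bar>u x\<bar> \<le> M" using u_bounds by metis
  show ?thesis unfolding \<phi>_def
    by (rule riesz_potential_eq_integral) (rule integrable_riesz[OF _ M(2) u_int], simp)
qed

text \<open>Integrating the outer potential against \<open>x powr (- \<delta>)\<close> first, over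
  x, produces the moment \<open>B * y powr (\<alpha> - \<delta>)\<close>. The inner function is odd
  and bounded, so the half-line formula \<open>riesz_potential_odd\<close> is available even when
  the integral over the line does not converge absolutely.\<close>

lemma riesz_potential_product_integral:
  assumes \<delta>: "2 * \<alpha> < \<delta>" "\<delta> < 2"
    and B: "0 < B" "\<And>y. 0 < y \<Longrightarrow> (\<integral>\<^sup>+x\<in>{0<..}. ennreal (odd_kernel \<alpha> x y * x powr (- \<delta>)) \<partial>lborel) = ennreal (B * y powr (\<alpha> - \<delta>))"
  shows "(LINT x:{0<..}|lborel. riesz_potential \<alpha> (\<lambda>y. riesz_potential \<alpha> u y * deriv u y) x / x powr \<delta>)
    = (riesz_const \<alpha>)\<^sup>2 * B * (LBINT x. \<phi> x * deriv u x * x powr (\<alpha> - \<delta>) * indicator {0<..} x)"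
proof -
  obtain L where L: "0 < L" "\<And>x. \<bar>\<phi> x\<bar> \<le> L" using \<phi>_bounded by metis
  obtain M where M: "0 < M" "\<And>x. \<bar>u x\<bar> \<le> M" "\<And>x. \<bar>deriv u x\<bar> \<le> M" using u_bounds by metis
  define c where "c = riesz_const \<alpha>"
  define f where "f = (\<lambda>y. c * \<phi> y * deriv u y)"
  have [measurable]: "f \<in> borel_measurable borel" unfolding f_def by measurable
  have f_eq: "(\<lambda>y. riesz_potential \<alpha> u y * deriv u y) = f" by (simp add: f_def riesz_potential_u c_def)
  have f_odd: "odd_function f" by (simp add: odd_function_def f_def \<phi>_minus deriv_u_minus)
  have f_bd: "\<bar>f y\<bar> \<le> \<bar>c\<bar> * M * \<bar>\<phi> y\<bar>" for y
    using mult_left_mono[OF M(3)[of y], of "\<bar>c\<bar> * \<bar>\<phi> y\<bar>"] by (simp add: f_def abs_mult mult_ac)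
  have f_bd': "\<bar>f y\<bar> \<le> \<bar>c\<bar> * M * L" for y
    using f_bd[of y] mult_left_mono[OF L(2)[of y], of "\<bar>c\<bar> * M"] M by simp
  \<comment> \<open>Cut off to a bounded interval, f is bounded and integrable, the two hypotheses
    of \<open>integrable_riesz\<close>.\<close>
  have loc: "set_integrable lborel {-R..R} (\<lambda>y. f y * rker \<alpha> (x - y))" for x R
  proof -
    let ?v = "\<lambda>y. f y * indicator {-R..R} y"
    have iv: "integrable lborel ?v"
    proof (rule Bochner_Integration.integrable_bound)
      show "integrable lborel (\<lambda>y. (\<bar>c\<bar> * M * L) * indicator {-R..R} y)"
        by (intro integrable_mult_right integrable_real_indicator) (auto simp: emeasure_lborel_Icc_eq)
      show "AE y in lborel. norm (?v y) \<le> norm ((\<bar>c\<bar> * M * L) * indicator {-R..R} y)"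
        by (intro AE_I2) (auto simp: indicator_def intro!: order_trans[OF f_bd' abs_ge_self])
    qed simp
    have vb: "\<bar>?v y\<bar> \<le> \<bar>c\<bar> * M * L" for y
      using f_bd'[of y] L M by (auto simp: indicator_def)
    have "integrable lborel (\<lambda>y. ?v y * rker \<alpha> (x - y))"
      by (rule integrable_riesz[OF _ vb iv]) simp
    then show ?thesis by (simp add: set_integrable_def mult_ac)
  qed
  let ?F = "\<lambda>x y. f y * odd_kernel \<alpha> x y * x powr (- \<delta>) * (indicator {0<..} x * indicator {0<..} y)"
  \<comment> \<open>The moment is used twice: here with absolute values, for integrability on the
    product space, and in \<open>inner\<close> with signs, for the value after Fubini.\<close>
  have inner_nn: "(\<integral>\<^sup>+x. ennreal \<bar>?F x y\<bar> \<partial>lborel) = ennreal (\<bar>f y\<bar> * (B * y powr (\<alpha> - \<delta>)) * indicator {0<..} y)" for y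
  proof (cases "0 < y")
    case True
    have "(\<integral>\<^sup>+x. ennreal \<bar>?F x y\<bar> \<partial>lborel) = (\<integral>\<^sup>+x. ennreal \<bar>f y\<bar> * (ennreal (odd_kernel \<alpha> x y * x powr (- \<delta>)) * indicator {0<..} x) \<partial>lborel)"
    proof (rule nn_integral_cong_AE, use AE_lborel_singleton[of y] in eventually_elim)
      fix x assume "x \<noteq> y"
      then show "ennreal \<bar>?F x y\<bar> = ennreal \<bar>f y\<bar> * (ennreal (odd_kernel \<alpha> x y * x powr (- \<delta>)) * indicator {0<..} x)"
        using True odd_kernel_nonneg[of x y] by (auto simp: indicator_def abs_mult ennreal_mult'[symmetric] mult_ac)
    qed
    also have "\<dots> = ennreal \<bar>f y\<bar> * ennreal (B * y powr (\<alpha> - \<delta>))"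
      by (subst nn_integral_cmult) (auto simp: B(2)[OF True])
    finally show ?thesis using True B by (simp add: ennreal_mult)
  qed simp
  have inner: "(LBINT x. ?F x y) = f y * (B * y powr (\<alpha> - \<delta>)) * indicator {0<..} y" for y
  proof (cases "0 < y")
    case True
    have "(LBINT x. odd_kernel \<alpha> x y * x powr (- \<delta>) * indicator {0<..} x) = enn2real (\<integral>\<^sup>+x. ennreal (odd_kernel \<alpha> x y * x powr (- \<delta>) * indicator {0<..} x) \<partial>lborel)"
    proof (rule integral_eq_nn_integral)
      show "AE x in lborel. 0 \<le> odd_kernel \<alpha> x y * x powr (- \<delta>) * indicator {0<..} x"
        using AE_lborel_singleton[of y]
        by eventually_elim (use True odd_kernel_nonneg in \<open>auto simp: indicator_def\<close>)
    qed measurable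
    also have "(\<integral>\<^sup>+x. ennreal (odd_kernel \<alpha> x y * x powr (- \<delta>) * indicator {0<..} x) \<partial>lborel) = ennreal (B * y powr (\<alpha> - \<delta>))"
      unfolding B(2)[OF True, symmetric] by (intro nn_integral_cong) (auto simp: indicator_def)
    also have "enn2real \<dots> = B * y powr (\<alpha> - \<delta>)" using B by simp
    finally have "(LBINT x. f y * (odd_kernel \<alpha> x y * x powr (- \<delta>) * indicator {0<..} x)) = f y * (B * y powr (\<alpha> - \<delta>))"
      by simp
    then show ?thesis using True by (simp add: mult_ac)
  qed simp
  have iF: "integrable (lborel \<Otimes>\<^sub>M lborel) (\<lambda>(x, y). ?F x y)"
  proof (rule integrableI_bounded)
    have "(\<integral>\<^sup>+z. ennreal (norm (case z of (x, y) \<Rightarrow> ?F x y)) \<partial>(lborel \<Otimes>\<^sub>M lborel)) = (\<integral>\<^sup>+x. \<integral>\<^sup>+y. ennreal \<bar>?F x y\<bar> \<partial>lborel \<partial>lborel)"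
      by (subst lborel.nn_integral_fst[symmetric]) auto
    also have "\<dots> = (\<integral>\<^sup>+y. \<integral>\<^sup>+x. ennreal \<bar>?F x y\<bar> \<partial>lborel \<partial>lborel)"
      by (rule lborel_pair.Fubini'[symmetric]) measurable
    also have "\<dots> = (\<integral>\<^sup>+y. ennreal (\<bar>f y\<bar> * (B * y powr (\<alpha> - \<delta>)) * indicator {0<..} y) \<partial>lborel)"
      unfolding inner_nn ..
    also have "\<dots> \<le> (\<integral>\<^sup>+y. ennreal (\<bar>c\<bar> * M * B * (\<bar>\<phi> y\<bar> * y powr (\<alpha> - \<delta>) * indicator {0<..} y)) \<partial>lborel)"
    proof (rule nn_integral_mono, rule ennreal_leI)
      fix y
      have "\<bar>f y\<bar> * (B * y powr (\<alpha> - \<delta>) * indicator {0<..} y) \<le> \<bar>c\<bar> * M * \<bar>\<phi> y\<bar> * (B * y powr (\<alpha> - \<delta>) * indicator {0<..} y)"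
        using B by (intro mult_right_mono f_bd) auto
      then show "\<bar>f y\<bar> * (B * y powr (\<alpha> - \<delta>)) * indicator {0<..} y \<le> \<bar>c\<bar> * M * B * (\<bar>\<phi> y\<bar> * y powr (\<alpha> - \<delta>) * indicator {0<..} y)"
        by (simp only: mult_ac)
    qed
    also have "\<dots> < \<infinity>"
      using integrable_mult_right[OF integrable_\<phi>_powr[OF \<delta>], of "\<bar>c\<bar> * M * B"] M B
      by (subst nn_integral_eq_integral) auto
    finally show "(\<integral>\<^sup>+z. ennreal (norm (case z of (x, y) \<Rightarrow> ?F x y)) \<partial>(lborel \<Otimes>\<^sub>M lborel)) < \<infinity>" .
  qed measurable
  have "indicator {0<..} x *\<^sub>R (riesz_potential \<alpha> f x / x powr \<delta>) = c * (LBINT y. ?F x y)" for x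
  proof (cases "0 < x")
    case True
    have e: "indicator {0<..} y *\<^sub>R (f y * (rker \<alpha> (x - y) - rker \<alpha> (x + y))) = x powr \<delta> * ?F x y" for y
      using True by (simp add: odd_kernel_def powr_minus_divide)
    have "integrable lborel (\<lambda>y. f y * (odd_kernel \<alpha> x y * indicator {0<..} y))"
    proof (rule Bochner_Integration.integrable_bound)
      show "integrable lborel (\<lambda>y. \<bar>c\<bar> * M * L * (odd_kernel \<alpha> x y * indicator {0<..} y))"
        by (intro integrable_mult_right integrable_odd_kernel[OF True])
      show "AE y in lborel. norm (f y * (odd_kernel \<alpha> x y * indicator {0<..} y))
        \<le> norm (\<bar>c\<bar> * M * L * (odd_kernel \<alpha> x y * indicator {0<..} y))"
        unfolding norm_mult by (intro AE_I2 mult_right_mono order_trans[OF _ abs_ge_self]) (use f_bd' M L in \<open>auto simp: abs_mult\<close>)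
    qed simp
    then have "set_integrable lborel {0<..} (\<lambda>y. f y * (rker \<alpha> (x - y) - rker \<alpha> (x + y)))"
      by (simp add: set_integrable_def odd_kernel_def mult_ac)
    from riesz_potential_odd[OF f_odd loc this]
    have "riesz_potential \<alpha> f x = c * (x powr \<delta> * (LBINT y. ?F x y))"
      unfolding set_lebesgue_integral_def e c_def by (simp only: integral_mult_right_zero)
    then show ?thesis using True by simp
  qed simp
  then have "(LINT x:{0<..}|lborel. riesz_potential \<alpha> f x / x powr \<delta>) = (LBINT x. c * (LBINT y. ?F x y))"
    unfolding set_lebesgue_integral_def by (simp only:)
  also have "\<dots> = c * (LBINT x. LBINT y. ?F x y)" by simp
  also have "(LBINT x. LBINT y. ?F x y) = (LBINT y. LBINT x. ?F x y)"
    by (rule lborel_pair.Fubini_integral[OF iF, symmetric])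
  also have "\<dots> = (LBINT y. c * B * (\<phi> y * deriv u y * y powr (\<alpha> - \<delta>) * indicator {0<..} y))"
    unfolding inner by (simp add: f_def mult_ac)
  also have "c * \<dots> = c\<^sup>2 * B * (LBINT y. \<phi> y * deriv u y * y powr (\<alpha> - \<delta>) * indicator {0<..} y)"
    by (simp add: power2_eq_square)
  finally show ?thesis unfolding f_eq c_def .
qed

lemma riesz_potential_square_integral:
  fixes \<delta> :: real
  shows
  "(LINT x:{0<..}|lborel. (riesz_potential \<alpha> u x)\<^sup>2 / x powr (1 + \<delta>))
    = (riesz_const \<alpha>)\<^sup>2 * (LBINT x. (\<phi> x)\<^sup>2 * x powr (- (1 + \<delta>)) * indicator {0<..} x)"
proof -
  have "indicator {0<..} x *\<^sub>R ((riesz_potential \<alpha> u x)\<^sup>2 / x powr (1 + \<delta>)) = (riesz_const \<alpha>)\<^sup>2 * ((\<phi> x)\<^sup>2 * x powr (- (1 + \<delta>)) * indicator {0<..} x)" for x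
    by (simp only: riesz_potential_u power_mult_distrib powr_minus_divide) simp
  then show ?thesis unfolding set_lebesgue_integral_def by (simp only: integral_mult_right_zero)
qed

end

theorem proposition1p3:
  fixes \<alpha> \<delta> :: real
  assumes "0 < \<alpha>" "\<alpha> < 1" "2 * \<alpha> < \<delta>" "\<delta> < 2"
  shows "\<exists>C>0. \<forall>u :: real \<Rightarrow> real.
    odd_function u \<longrightarrow> C1_bounded u \<longrightarrow> integrable lborel u \<longrightarrow>
    (LINT x:{0<..}|lborel.
        riesz_potential \<alpha> (\<lambda>y. riesz_potential \<alpha> u y * deriv u y) x / x powr \<delta>)
    \<ge> C * (LINT x:{0<..}|lborel. (riesz_potential \<alpha> u x)\<^sup>2 / x powr (1 + \<delta>))"
proof -
  interpret riesz_exponent \<alpha> by unfold_locales (use assms in auto)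
  obtain C where C: "0 < C" and K: "\<And>x e. 0 < x \<Longrightarrow> 0 < e \<Longrightarrow>
      power_supersolution \<alpha> \<delta> C e x"
    using jump_kernel_integral_le[OF assms(3,4)] by blast
  obtain B where B: "0 < B" "\<And>y. 0 < y \<Longrightarrow>
      (\<integral>\<^sup>+x\<in>{0<..}. ennreal (odd_kernel \<alpha> x y * x powr (- \<delta>)) \<partial>lborel) = ennreal (B * y powr (\<alpha> - \<delta>))"
    using odd_kernel_moment[of \<delta>] assms by auto
  show ?thesis
  \<comment> \<open>B is the moment of order \<delta>, C / 2 comes from
    \<open>hardy_form_bound\<close>, and the square of \<open>riesz_const \<alpha>\<close> is a
    factor of both sides.\<close>
  proof (intro exI[of _ "B * C / 2"] conjI allI impI)
    show "0 < B * C / 2" using B C by simp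
    fix u :: "real \<Rightarrow> real" assume u: "odd_function u" "C1_bounded u" "integrable lborel u"
    interpret odd_riesz_profile \<alpha> u by unfold_locales (use assms u in auto)
    show "B * C / 2 * (LINT x:{0<..}|lborel. (riesz_potential \<alpha> u x)\<^sup>2 / x powr (1 + \<delta>))
      \<le> (LINT x:{0<..}|lborel. riesz_potential \<alpha> (\<lambda>y. riesz_potential \<alpha> u y * deriv u y) x / x powr \<delta>)"
    proof -
      have "(riesz_const \<alpha>)\<^sup>2 * B * (C / 2 * (LBINT x. (\<phi> x)\<^sup>2 * x powr (- (1 + \<delta>)) * indicator {0<..} x))
        \<le> (riesz_const \<alpha>)\<^sup>2 * B * (LBINT x. \<phi> x * deriv u x * x powr (\<alpha> - \<delta>) * indicator {0<..} x)"
        using B(1) by (intro mult_left_mono hardy_form_bound[OF assms(3,4) C K]) auto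
      also have "\<dots> = (LINT x:{0<..}|lborel. riesz_potential \<alpha> (\<lambda>y. riesz_potential \<alpha> u y * deriv u y) x / x powr \<delta>)"
        by (rule riesz_potential_product_integral[OF assms(3,4) B, symmetric])
      finally show ?thesis
        unfolding riesz_potential_square_integral by (simp only: mult_ac times_divide_eq_right times_divide_eq_left)
    qed
  qed
qed

end
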